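(* Let $\mathsf H$ be a bounded heart in a triangulated category $\mathsf D$, and let $\lambda\colon K(\mathsf D)\to\Lambda$ be a homomorphism to a free abelian group of finite rank. Let $\Delta(\mathsf H):=\bigcup_{\mathsf H[1]\ge\mathsf K\ge\mathsf H}\mathrm{Faces}(C(\mathsf K))$ be the set of all heart cones $C(\mathsf K)$ for bounded hearts $\mathsf K$ in $\mathsf D$ with $\mathsf H[1]\ge\mathsf K\ge\mathsf H$, together with their faces. Then: (1) $\Delta(\mathsf H)$ is a fan in $\Lambda_{\mathbb R}^*$, and it is the fan associated to the real heart cofan $\nabla_{\mathbb R}(\mathsf H)$, i.e. $\Delta(\mathsf H)=\bigcup_{\sigma\in\nabla_{\mathbb R}(\mathsf H)}\mathrm{Faces}(\mathbb D(\sigma))$. (2) $\Delta(\mathsf H)$ does not depend on the ambient triangulated category $\mathsf D$: if $\mathsf H$ (with the same $\lambda\colon K(\mathsf H)\to\Lambda$) is also a bounded heart in another triangulated category, the resulting fan is the same. (3) If $\mathsf H$ is a length category, then $\Delta(\mathsf H)$ is complete, i.e. the union of its cones is $\Lambda_{\mathbb R}^*$.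
   Context: $\Lambda_{\mathbb R}=\Lambda\otimes\mathbb R$, $\Lambda_{\mathbb R}^*=\operatorname{Hom}(\Lambda,\mathbb R)$. A bounded heart is the heart of a bounded t-structure; for each bounded heart $\mathsf K$ in $\mathsf D$, $K(\mathsf K)=K(\mathsf D)$ canonically, so $\lambda$ is defined on $K(\mathsf K)$; write $\lambda(k)=\lambda([k])$ and $v(k)=v(\lambda(k))$. Hearts are ordered by $\mathsf K\ge\mathsf H$ iff $\operatorname{Hom}_{\mathsf D}(\mathsf K[n],\mathsf H)=0$ for all $n>0$. The heart cone is $C(\mathsf K)=\{v\in\Lambda_{\mathbb R}^*\mid v(k)\ge0\ \forall k\in\mathsf K\}$. Length means noetherian and artinian. Real cones are non-empty subsets closed under sums and non-negative scalars. A face of a cone $\sigma$ is a non-empty $\tau\subseteq\sigma$ with $a+b\in\tau\iff a,b\in\tau$ for $a,b\in\sigma$. $\mathrm{Faces}(\sigma)$ is the set of faces of $\sigma$. A fan is a set of cones closed under faces such that any two cones intersect in a common face. The dual of a real cone $\sigma\subseteq\Lambda_{\mathbb R}$ is $\mathbb D(\sigma)=\{v\in\Lambda_{\mathbb R}^*\mid v|_\sigma\ge0\}$. A coface of a cone $\sigma$ is a cone of the form $\sigma-\kappa=\{s-k\mid s\in\sigma, k\in\kappa\}$ for a subcone $\kappa\subseteq\sigma$ (equivalently for a face $\kappa$). The real heart cofan $\nabla_{\mathbb R}(\mathsf H)$ is the set of all cofaces of the real cones $E(\mathsf K)_{\mathbb R}$, for bounded hearts $\mathsf H[1]\ge\mathsf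 K\ge\mathsf H$, where $E(\mathsf K)_{\mathbb R}\subseteq\Lambda_{\mathbb R}$ is the real cone generated by $\{\lambda(k)\mid k\in\mathsf K\}$. *)

theory Defs
  imports "HOL-Analysis.Convex" "HOL-Algebra.Free_Abelian_Groups"
begin

section \<open>Free abelian groups of finite rank, the dual space, and scalar extension\<close>

definition free_of_finite_rank :: "'l::ab_group_add itself \<Rightarrow> bool" where
  "free_of_finite_rank (_::'l itself) \<longleftrightarrow>
     (\<exists>n. \<exists>\<phi> :: 'l \<Rightarrow> nat \<Rightarrow> int.
        (\<forall>a b i. \<phi> (a + b) i = \<phi> a i + \<phi> b i) \<and>
        bij_betw \<phi> UNIV {c. \<forall>i\<ge>n. c i = 0})"

text \<open>The real vector space of group homomorphisms from \<open>'l\<close> to the reals.\<close>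

typedef (overloaded) 'l real_dual = "{v :: 'l::ab_group_add \<Rightarrow> real. additive v}"
  morphisms eval_dual Abs_real_dual
  by (rule exI[of _ "\<lambda>_. 0"]) (simp add: additive_def)

setup_lifting type_definition_real_dual

instantiation real_dual :: (ab_group_add) real_vector
begin

lift_definition zero_real_dual :: "'a real_dual" is "\<lambda>_. 0"
  by (simp add: additive_def)
lift_definition plus_real_dual :: "'a real_dual \<Rightarrow> 'a real_dual \<Rightarrow> 'a real_dual"
  is "\<lambda>v w a. v a + w a" by (simp add: additive_def)
lift_definition minus_real_dual :: "'a real_dual \<Rightarrow> 'a real_dual \<Rightarrow> 'a real_dual"
  is "\<lambda>v w a. v a - w a" by (simp add: additive_def)
lift_definition uminus_real_dual :: "'a real_dual \<Rightarrow> 'a real_dual"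
  is "\<lambda>v a. - v a" by (simp add: additive_def)
lift_definition scaleR_real_dual :: "real \<Rightarrow> 'a real_dual \<Rightarrow> 'a real_dual"
  is "\<lambda>r v a. r * v a" by (simp add: additive_def algebra_simps)

instance
  by standard (transfer; simp add: algebra_simps fun_eq_iff)+

end

text \<open>
  The tensor product of \<open>'l\<close> with the reals over the integers: finite formal sums
  \<open>\<Sum> a \<otimes> r\<close>, where \<open>Poly_Mapping.single a r\<close> stands for \<open>a \<otimes> r\<close>, modulo
  the subgroup generated by \<open>(a + b) \<otimes> r - a \<otimes> r - b \<otimes> r\<close>. Additivity in the
  real factor already holds for the formal sums.
\<close>

inductive_set tensor_relations :: "('l::ab_group_add \<Rightarrow>\<^sub>0 real) set" where
  zero: "0 \<in> tensor_relations"
| gen: "Poly_Mapping.single (a + b) r - Poly_Mapping.single a r - Poly_Mapping.single b r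
          \<in> tensor_relations"
| diff: "p \<in> tensor_relations \<Longrightarrow> q \<in> tensor_relations \<Longrightarrow> p - q \<in> tensor_relations"

definition tensor_eq :: "('l::ab_group_add \<Rightarrow>\<^sub>0 real) \<Rightarrow> ('l \<Rightarrow>\<^sub>0 real) \<Rightarrow> bool" where
  "tensor_eq p q \<longleftrightarrow> p - q \<in> tensor_relations"

lemma tensor_relations_uminus: "p \<in> tensor_relations \<Longrightarrow> - p \<in> tensor_relations"
  using tensor_relations.diff[OF tensor_relations.zero, of p] by simp

lemma tensor_relations_add:
  "p \<in> tensor_relations \<Longrightarrow> q \<in> tensor_relations \<Longrightarrow> p + q \<in> tensor_relations"
  using tensor_relations.diff[OF _ tensor_relations_uminus, of p q] by simp

lemma equivp_tensor_eq: "equivp (tensor_eq :: ('l::ab_group_add \<Rightarrow>\<^sub>0 real) \<Rightarrow> _)"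
proof (intro equivpI reflpI sympI transpI)
  show "tensor_eq p p" for p :: "'l::ab_group_add \<Rightarrow>\<^sub>0 real"
    by (simp add: tensor_eq_def tensor_relations.zero)
  show "tensor_eq q p" if "tensor_eq p q" for p q :: "'l::ab_group_add \<Rightarrow>\<^sub>0 real"
    using tensor_relations_uminus[of "p - q"] that by (simp add: tensor_eq_def)
  show "tensor_eq p s" if "tensor_eq p q" "tensor_eq q s" for p q s :: "'l::ab_group_add \<Rightarrow>\<^sub>0 real"
    using tensor_relations_add[of "p - q" "q - s"] that by (simp add: tensor_eq_def)
qed

definition formal_scale :: "real \<Rightarrow> ('l \<Rightarrow>\<^sub>0 real) \<Rightarrow> ('l \<Rightarrow>\<^sub>0 real)" where
  "formal_scale r = Poly_Mapping.map (\<lambda>x. r * x)"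

lemma lookup_formal_scale [simp]:
  "Poly_Mapping.lookup (formal_scale r p) a = r * Poly_Mapping.lookup p a"
  by (simp add: formal_scale_def Poly_Mapping.map.rep_eq when_def)

lemma formal_scale_diff: "formal_scale r (p - q) = formal_scale r p - formal_scale r q"
  by (rule poly_mapping_eqI) (simp add: lookup_minus algebra_simps)

lemma formal_scale_single:
  "formal_scale r (Poly_Mapping.single a x) = Poly_Mapping.single a (r * x)"
  by (rule poly_mapping_eqI) (simp add: lookup_single when_def)

lemma tensor_relations_scale: "p \<in> tensor_relations \<Longrightarrow> formal_scale r p \<in> tensor_relations"
proof (induction rule: tensor_relations.induct)
  case zero
  have "formal_scale r (0 :: 'a \<Rightarrow>\<^sub>0 real) = 0" by (rule poly_mapping_eqI) simp
  then show ?case by (simp add: tensor_relations.zero)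
next
  case (gen a b x)
  then show ?case
    by (simp add: formal_scale_diff formal_scale_single tensor_relations.gen)
next
  case (diff p q)
  then show ?case by (simp add: formal_scale_diff tensor_relations.diff)
qed

definition formal_eval :: "('l \<Rightarrow> real) \<Rightarrow> ('l \<Rightarrow>\<^sub>0 real) \<Rightarrow> real" where
  "formal_eval v p = (\<Sum>a\<in>Poly_Mapping.keys p. Poly_Mapping.lookup p a * v a)"

lemma formal_eval_superset:
  assumes "finite S" "Poly_Mapping.keys p \<subseteq> S"
  shows "formal_eval v p = (\<Sum>a\<in>S. Poly_Mapping.lookup p a * v a)"
  unfolding formal_eval_def
  by (rule sum.mono_neutral_left) (use assms in \<open>auto simp: in_keys_iff\<close>)

lemma formal_eval_diff: "formal_eval v (p - q) = formal_eval v p - formal_eval v q"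
proof -
  let ?S = "Poly_Mapping.keys p \<union> Poly_Mapping.keys q"
  have "Poly_Mapping.keys (p - q) \<subseteq> ?S"
    by (auto simp: in_keys_iff lookup_minus)
  then show ?thesis
    by (simp add: formal_eval_superset[of ?S] lookup_minus sum_subtractf algebra_simps)
qed

lemma formal_eval_single: "formal_eval v (Poly_Mapping.single a r) = r * v a"
  by (simp add: formal_eval_superset[of "{a}"])

lemma formal_eval_relations:
  assumes "additive v" "p \<in> tensor_relations"
  shows "formal_eval v p = 0"
  using assms(2)
proof (induction rule: tensor_relations.induct)
  case zero
  then show ?case by (simp add: formal_eval_def)
next
  case (gen a b r)
  then show ?case
    using assms(1)
    by (simp only: formal_eval_diff formal_eval_single additive_def) (simp add: algebra_simps)
next
  case (diff p q)
  then show ?case by (simp add: formal_eval_diff)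
qed

quotient_type (overloaded) 'l tensor_real = "'l::ab_group_add \<Rightarrow>\<^sub>0 real" / tensor_eq
  by (rule equivp_tensor_eq)

instantiation tensor_real :: (ab_group_add) real_vector
begin

lift_definition zero_tensor_real :: "'a tensor_real" is 0 .
lift_definition plus_tensor_real :: "'a tensor_real \<Rightarrow> 'a tensor_real \<Rightarrow> 'a tensor_real"
  is "(+)"
  by (metis tensor_eq_def tensor_relations_add add_diff_add)
lift_definition uminus_tensor_real :: "'a tensor_real \<Rightarrow> 'a tensor_real"
  is "uminus"
  by (metis tensor_eq_def tensor_relations_uminus minus_diff_minus)
lift_definition minus_tensor_real :: "'a tensor_real \<Rightarrow> 'a tensor_real \<Rightarrow> 'a tensor_real"
  is "(-)"
proof -
  fix p p' q q' :: "'a \<Rightarrow>\<^sub>0 real"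
  assume "tensor_eq p p'" "tensor_eq q q'"
  moreover have "(p - q) - (p' - q') = (p - p') - (q - q')" by simp
  ultimately show "tensor_eq (p - q) (p' - q')"
    unfolding tensor_eq_def by (metis tensor_relations.diff)
qed
lift_definition scaleR_tensor_real :: "real \<Rightarrow> 'a tensor_real \<Rightarrow> 'a tensor_real"
  is "formal_scale"
  by (simp add: tensor_eq_def tensor_relations_scale flip: formal_scale_diff)

lemma tensor_eq_refl: "p = q \<Longrightarrow> tensor_eq p q"
  by (simp add: tensor_eq_def tensor_relations.zero)

instance
proof
  fix x y z :: "'a tensor_real" and r s :: real
  show "x + y + z = x + (y + z)" by transfer (simp add: tensor_eq_refl add.assoc)
  show "x + y = y + x" by transfer (simp add: tensor_eq_refl add.commute)
  show "0 + x = x" by transfer (simp add: tensor_eq_refl)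
  show "- x + x = 0" by transfer (simp add: tensor_eq_refl)
  show "x - y = x + - y" by transfer (simp add: tensor_eq_refl)
  show "r *\<^sub>R (x + y) = r *\<^sub>R x + r *\<^sub>R y"
    by transfer (rule tensor_eq_refl, rule poly_mapping_eqI, simp add: lookup_add algebra_simps)
  show "(r + s) *\<^sub>R x = r *\<^sub>R x + s *\<^sub>R x"
    by transfer (rule tensor_eq_refl, rule poly_mapping_eqI, simp add: lookup_add algebra_simps)
  show "r *\<^sub>R s *\<^sub>R x = (r * s) *\<^sub>R x"
    by transfer (rule tensor_eq_refl, rule poly_mapping_eqI, simp)
  show "1 *\<^sub>R x = x"
    by transfer (rule tensor_eq_refl, rule poly_mapping_eqI, simp)
qed

end

text \<open>The map \<open>a \<mapsto> a \<otimes> 1\<close>, and the linear extension of a homomorphism to the tensor product.\<close>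

lift_definition tensor_one :: "'l::ab_group_add \<Rightarrow> 'l tensor_real"
  is "\<lambda>a. Poly_Mapping.single a 1" .

lift_definition pairing :: "'l::ab_group_add real_dual \<Rightarrow> 'l tensor_real \<Rightarrow> real"
  is formal_eval
  by (metis (mono_tags, lifting) eq_iff_diff_eq_0 formal_eval_diff formal_eval_relations
      mem_Collect_eq tensor_eq_def)

lemma pairing_tensor_one: "pairing v (tensor_one a) = eval_dual v a"
  by transfer (simp add: formal_eval_single)


section \<open>Cones, faces, fans and cofaces\<close>

definition cone_face :: "'a::real_vector set \<Rightarrow> 'a set \<Rightarrow> bool" where
  "cone_face \<tau> \<sigma> \<longleftrightarrow>
     \<tau> \<noteq> {} \<and> \<tau> \<subseteq> \<sigma> \<and> (\<forall>a\<in>\<sigma>. \<forall>b\<in>\<sigma>. a + b \<in> \<tau> \<longleftrightarrow> a \<in> \<tau> \<and> b \<in> \<tau>)"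

definition Faces :: "'a::real_vector set \<Rightarrow> 'a set set" where
  "Faces \<sigma> = {\<tau>. cone_face \<tau> \<sigma>}"

definition is_fan :: "'a::real_vector set set \<Rightarrow> bool" where
  "is_fan \<Delta> \<longleftrightarrow>
     (\<forall>\<sigma>\<in>\<Delta>. convex_cone \<sigma>) \<and>
     (\<forall>\<sigma>\<in>\<Delta>. Faces \<sigma> \<subseteq> \<Delta>) \<and>
     (\<forall>\<sigma>\<in>\<Delta>. \<forall>\<tau>\<in>\<Delta>. cone_face (\<sigma> \<inter> \<tau>) \<sigma> \<and> cone_face (\<sigma> \<inter> \<tau>) \<tau>)"

definition complete_fan :: "'a::real_vector set set \<Rightarrow> bool" where
  "complete_fan \<Delta> \<longleftrightarrow> \<Union>\<Delta> = UNIV"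

definition cofaces :: "'a::real_vector set \<Rightarrow> 'a set set" where
  "cofaces \<sigma> = {{s - k | s k. s \<in> \<sigma> \<and> k \<in> \<kappa>} | \<kappa>. convex_cone \<kappa> \<and> \<kappa> \<subseteq> \<sigma>}"

definition dual_cone :: "'l::ab_group_add tensor_real set \<Rightarrow> 'l real_dual set" where
  "dual_cone \<sigma> = {v. \<forall>x\<in>\<sigma>. pairing v x \<ge> 0}"


section \<open>Triangulated categories\<close>

text \<open>
  Every element of \<open>'o\<close> is an object; the morphisms are the elements of \<open>Arr\<close>.
  \<open>g \<cdot> f\<close> is composition (\<open>f\<close> first); it is only meaningful on composable pairs, just as
  \<open>Plus\<close> is only meaningful on parallel ones. An element \<open>(f, g, h)\<close> of \<open>Tri\<close> is a
  distinguished triangle \<open>X \<rightarrow> Y \<rightarrow> Z \<rightarrow> X[1]\<close>.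
\<close>

record ('o, 'm) tri_data =
  Arr :: "'m set"
  Dom :: "'m \<Rightarrow> 'o"
  Cod :: "'m \<Rightarrow> 'o"
  Id :: "'o \<Rightarrow> 'm"
  Comp :: "'m \<Rightarrow> 'm \<Rightarrow> 'm" (infixr \<open>\<cdot>\<index>\<close> 70)
  Plus :: "'m \<Rightarrow> 'm \<Rightarrow> 'm" (infixl \<open>\<boxplus>\<index>\<close> 65)
  Neg :: "'m \<Rightarrow> 'm"
  Zero :: "'o \<Rightarrow> 'o \<Rightarrow> 'm"
  Sh_ob :: "'o \<Rightarrow> 'o"
  Sh_ar :: "'m \<Rightarrow> 'm"
  Tri :: "('m \<times> 'm \<times> 'm) set"

definition Hom :: "('o, 'm) tri_data \<Rightarrow> 'o \<Rightarrow> 'o \<Rightarrow> 'm set" where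
  "Hom D X Y = {f \<in> Arr D. Dom D f = X \<and> Cod D f = Y}"

definition inverse_arrows :: "('o, 'm) tri_data \<Rightarrow> 'm \<Rightarrow> 'm \<Rightarrow> bool" where
  "inverse_arrows D f g \<longleftrightarrow> (\<exists>X Y. f \<in> Hom D X Y \<and> g \<in> Hom D Y X \<and>
      Comp D g f = Id D X \<and> Comp D f g = Id D Y)"

definition iso_arrow :: "('o, 'm) tri_data \<Rightarrow> 'm \<Rightarrow> bool" where
  "iso_arrow D f \<longleftrightarrow> (\<exists>g. inverse_arrows D f g)"

definition isomorphic :: "('o, 'm) tri_data \<Rightarrow> 'o \<Rightarrow> 'o \<Rightarrow> bool" where
  "isomorphic D X Y \<longleftrightarrow> (\<exists>f\<in>Hom D X Y. iso_arrow D f)"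

definition zero_object :: "('o, 'm) tri_data \<Rightarrow> 'o \<Rightarrow> bool" where
  "zero_object D X \<longleftrightarrow> Id D X = Zero D X X"

locale additive_category =
  fixes D :: "('o, 'm) tri_data" (structure)
  assumes id_hom: "Id D X \<in> Hom D X X"
    and comp_hom: "f \<in> Hom D X Y \<Longrightarrow> g \<in> Hom D Y Z \<Longrightarrow> g \<cdot> f \<in> Hom D X Z"
    and id_right: "f \<in> Hom D X Y \<Longrightarrow> f \<cdot> Id D X = f"
    and id_left: "f \<in> Hom D X Y \<Longrightarrow> Id D Y \<cdot> f = f"
    and comp_assoc: "f \<in> Hom D W X \<Longrightarrow> g \<in> Hom D X Y \<Longrightarrow> h \<in> Hom D Y Z \<Longrightarrow>
          h \<cdot> (g \<cdot> f) = (h \<cdot> g) \<cdot> f"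
    and plus_hom: "f \<in> Hom D X Y \<Longrightarrow> g \<in> Hom D X Y \<Longrightarrow> f \<boxplus> g \<in> Hom D X Y"
    and zero_hom: "Zero D X Y \<in> Hom D X Y"
    and neg_hom: "f \<in> Hom D X Y \<Longrightarrow> Neg D f \<in> Hom D X Y"
    and plus_assoc: "f \<in> Hom D X Y \<Longrightarrow> g \<in> Hom D X Y \<Longrightarrow> h \<in> Hom D X Y \<Longrightarrow>
          f \<boxplus> (g \<boxplus> h) = (f \<boxplus> g) \<boxplus> h"
    and plus_comm: "f \<in> Hom D X Y \<Longrightarrow> g \<in> Hom D X Y \<Longrightarrow> f \<boxplus> g = g \<boxplus> f"
    and plus_zero: "f \<in> Hom D X Y \<Longrightarrow> f \<boxplus> Zero D X Y = f"
    and plus_neg: "f \<in> Hom D X Y \<Longrightarrow> f \<boxplus> Neg D f = Zero D X Y"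
    and comp_plus_left: "f \<in> Hom D X Y \<Longrightarrow> g \<in> Hom D X Y \<Longrightarrow> h \<in> Hom D Y Z \<Longrightarrow>
          h \<cdot> (f \<boxplus> g) = (h \<cdot> f) \<boxplus> (h \<cdot> g)"
    and comp_plus_right: "f \<in> Hom D X Y \<Longrightarrow> g \<in> Hom D Y Z \<Longrightarrow> h \<in> Hom D Y Z \<Longrightarrow>
          (g \<boxplus> h) \<cdot> f = (g \<cdot> f) \<boxplus> (h \<cdot> f)"
    and ex_zero_object: "\<exists>X. zero_object D X"
    and ex_biproduct: "\<exists>S. \<exists>i\<in>Hom D X S. \<exists>j\<in>Hom D Y S. \<exists>p\<in>Hom D S X. \<exists>q\<in>Hom D S Y.
          p \<cdot> i = Id D X \<and> q \<cdot> j = Id D Y \<and>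
          q \<cdot> i = Zero D X Y \<and> p \<cdot> j = Zero D Y X \<and> (i \<cdot> p) \<boxplus> (j \<cdot> q) = Id D S"

text \<open>
  The shift is only required to be an auto-equivalence, not an automorphism. The axioms
  \<open>TR2\<close> (in its two-sided form), \<open>TR3\<close> and \<open>TR4\<close> (the octahedral axiom) are Verdier's.
\<close>

locale triangulated_category = additive_category +
  assumes shift_hom: "f \<in> Hom D X Y \<Longrightarrow> Sh_ar D f \<in> Hom D (Sh_ob D X) (Sh_ob D Y)"
    and shift_id: "Sh_ar D (Id D X) = Id D (Sh_ob D X)"
    and shift_comp: "f \<in> Hom D X Y \<Longrightarrow> g \<in> Hom D Y Z \<Longrightarrow>
          Sh_ar D (g \<cdot> f) = Sh_ar D g \<cdot> Sh_ar D f"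
    and shift_plus: "f \<in> Hom D X Y \<Longrightarrow> g \<in> Hom D X Y \<Longrightarrow>
          Sh_ar D (f \<boxplus> g) = Sh_ar D f \<boxplus> Sh_ar D g"
    and shift_fully_faithful: "bij_betw (Sh_ar D) (Hom D X Y) (Hom D (Sh_ob D X) (Sh_ob D Y))"
    and shift_ess_surj: "\<exists>Y. isomorphic D (Sh_ob D Y) X"
    and Tri_hom: "(f, g, h) \<in> Tri D \<Longrightarrow>
          \<exists>X Y Z. f \<in> Hom D X Y \<and> g \<in> Hom D Y Z \<and> h \<in> Hom D Z (Sh_ob D X)"
    and TR1_id: "zero_object D Z \<Longrightarrow> (Id D X, Zero D X Z, Zero D Z (Sh_ob D X)) \<in> Tri D"
    and TR1_iso: "(f, g, h) \<in> Tri D \<Longrightarrow>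
          f \<in> Hom D X Y \<Longrightarrow> g \<in> Hom D Y Z \<Longrightarrow> h \<in> Hom D Z (Sh_ob D X) \<Longrightarrow>
          f' \<in> Hom D X' Y' \<Longrightarrow> g' \<in> Hom D Y' Z' \<Longrightarrow> h' \<in> Hom D Z' (Sh_ob D X') \<Longrightarrow>
          a \<in> Hom D X X' \<Longrightarrow> b \<in> Hom D Y Y' \<Longrightarrow> c \<in> Hom D Z Z' \<Longrightarrow>
          iso_arrow D a \<Longrightarrow> iso_arrow D b \<Longrightarrow> iso_arrow D c \<Longrightarrow>
          b \<cdot> f = f' \<cdot> a \<Longrightarrow> c \<cdot> g = g' \<cdot> b \<Longrightarrow> Sh_ar D a \<cdot> h = h' \<cdot> c \<Longrightarrow>
          (f', g', h') \<in> Tri D"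
    and TR1_cone: "f \<in> Hom D X Y \<Longrightarrow> \<exists>g h. (f, g, h) \<in> Tri D"
    and TR2: "f \<in> Hom D X Y \<Longrightarrow> g \<in> Hom D Y Z \<Longrightarrow> h \<in> Hom D Z (Sh_ob D X) \<Longrightarrow>
          (f, g, h) \<in> Tri D \<longleftrightarrow> (g, h, Neg D (Sh_ar D f)) \<in> Tri D"
    and TR3: "(f, g, h) \<in> Tri D \<Longrightarrow> (f', g', h') \<in> Tri D \<Longrightarrow>
          f \<in> Hom D X Y \<Longrightarrow> g \<in> Hom D Y Z \<Longrightarrow>
          f' \<in> Hom D X' Y' \<Longrightarrow> g' \<in> Hom D Y' Z' \<Longrightarrow>
          a \<in> Hom D X X' \<Longrightarrow> b \<in> Hom D Y Y' \<Longrightarrow> b \<cdot> f = f' \<cdot> a \<Longrightarrow>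
          \<exists>c\<in>Hom D Z Z'. c \<cdot> g = g' \<cdot> b \<and> Sh_ar D a \<cdot> h = h' \<cdot> c"
    and TR4: "f \<in> Hom D X Y \<Longrightarrow> g \<in> Hom D Y Z \<Longrightarrow>
          (f, p1, d1) \<in> Tri D \<Longrightarrow> (g \<cdot> f, p2, d2) \<in> Tri D \<Longrightarrow> (g, p3, d3) \<in> Tri D \<Longrightarrow>
          \<exists>a\<in>Hom D (Cod D p1) (Cod D p2). \<exists>b\<in>Hom D (Cod D p2) (Cod D p3).
            (a, b, Sh_ar D p1 \<cdot> d3) \<in> Tri D \<and>
            a \<cdot> p1 = p2 \<cdot> g \<and> d2 \<cdot> a = d1 \<and>
            b \<cdot> p2 = p3 \<and> d3 \<cdot> b = Sh_ar D f \<cdot> d2"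


section \<open>The Grothendieck group of a triangulated category\<close>

definition K0_relations :: "('o, 'm) tri_data \<Rightarrow> ('o \<Rightarrow>\<^sub>0 int) set" where
  "K0_relations D =
     {frag_of (Cod D f) - frag_of (Dom D f) - frag_of (Cod D g) | f g h. (f, g, h) \<in> Tri D}"

definition K0_kernel :: "('o, 'm) tri_data \<Rightarrow> ('o \<Rightarrow>\<^sub>0 int) set" where
  "K0_kernel D = generate (free_Abelian_group UNIV) (K0_relations D)"

definition K0 :: "('o, 'm) tri_data \<Rightarrow> ('o \<Rightarrow>\<^sub>0 int) set monoid" where
  "K0 D = free_Abelian_group UNIV Mod K0_kernel D"

definition K0_class :: "('o, 'm) tri_data \<Rightarrow> 'o \<Rightarrow> ('o \<Rightarrow>\<^sub>0 int) set" where
  "K0_class D X = K0_kernel D #>\<^bsub>free_Abelian_group UNIV\<^esub> frag_of X"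

definition additive_group :: "'l::ab_group_add monoid" where
  "additive_group = \<lparr>carrier = UNIV, monoid.mult = (+), one = 0\<rparr>"


section \<open>Bounded hearts\<close>

text \<open>
  The full subcategory \<open>S[n]\<close>, for a full subcategory given by an isomorphism-closed class
  of objects \<open>S\<close>. Since the shift need not be invertible on the nose, \<open>S[-n]\<close> for \<open>n > 0\<close> is
  given by the objects whose \<open>n\<close>-th shift is in \<open>S\<close>.
\<close>

definition shift_set :: "('o, 'm) tri_data \<Rightarrow> 'o set \<Rightarrow> int \<Rightarrow> 'o set" where
  "shift_set D S n =
     (if n \<ge> 0 then {X. \<exists>A\<in>S. isomorphic D X ((Sh_ob D ^^ nat n) A)}
      else {X. (Sh_ob D ^^ nat (- n)) X \<in> S})"

definition iso_closed :: "('o, 'm) tri_data \<Rightarrow> 'o set \<Rightarrow> bool" where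
  "iso_closed D S \<longleftrightarrow> (\<forall>X Y. X \<in> S \<and> isomorphic D X Y \<longrightarrow> Y \<in> S)"

definition hom_vanish :: "('o, 'm) tri_data \<Rightarrow> 'o set \<Rightarrow> 'o set \<Rightarrow> bool" where
  "hom_vanish D A B \<longleftrightarrow> (\<forall>X\<in>A. \<forall>Y\<in>B. Hom D X Y = {Zero D X Y})"

text \<open>
  A t-structure with \<open>U\<close> and \<open>V\<close> the objects of non-positive resp. non-negative degree;
  degrees are cohomological, so the objects of degree \<open>\<le> n\<close> (\<open>\<ge> n\<close>) are those of \<open>U[-n]\<close>
  (\<open>V[-n]\<close>).
\<close>

definition t_structure :: "('o, 'm) tri_data \<Rightarrow> 'o set \<Rightarrow> 'o set \<Rightarrow> bool" where
  "t_structure D U V \<longleftrightarrow>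
     iso_closed D U \<and> iso_closed D V \<and>
     U \<subseteq> shift_set D U (- 1) \<and> shift_set D V (- 1) \<subseteq> V \<and>
     hom_vanish D U (shift_set D V (- 1)) \<and>
     (\<forall>X. \<exists>A\<in>U. \<exists>B\<in>shift_set D V (- 1). \<exists>f\<in>Hom D A X. \<exists>g\<in>Hom D X B. \<exists>h\<in>Hom D B (Sh_ob D A).
        (f, g, h) \<in> Tri D)"

definition bounded_t_structure :: "('o, 'm) tri_data \<Rightarrow> 'o set \<Rightarrow> 'o set \<Rightarrow> bool" where
  "bounded_t_structure D U V \<longleftrightarrow>
     t_structure D U V \<and> (\<forall>X. \<exists>n. X \<in> shift_set D U (- n) \<inter> shift_set D V n)"

definition bounded_heart :: "('o, 'm) tri_data \<Rightarrow> 'o set \<Rightarrow> bool" where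
  "bounded_heart D K \<longleftrightarrow> (\<exists>U V. bounded_t_structure D U V \<and> K = U \<inter> V)"

definition heart_ge :: "('o, 'm) tri_data \<Rightarrow> 'o set \<Rightarrow> 'o set \<Rightarrow> bool" where
  "heart_ge D K H \<longleftrightarrow> (\<forall>n>0. hom_vanish D (shift_set D K n) H)"

definition intermediate_hearts :: "('o, 'm) tri_data \<Rightarrow> 'o set \<Rightarrow> 'o set set" where
  "intermediate_hearts D H =
     {K. bounded_heart D K \<and> heart_ge D (shift_set D H 1) K \<and> heart_ge D K H}"

text \<open>
  \<open>mono_in D H X m\<close>: the morphism \<open>m\<close> is a monomorphism of the full subcategory \<open>H\<close> (it
  need not be one in \<open>D\<close>), that is, it represents a subobject of \<open>X\<close> in \<open>H\<close>.
\<close>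

definition mono_in :: "('o, 'm) tri_data \<Rightarrow> 'o set \<Rightarrow> 'o \<Rightarrow> 'm \<Rightarrow> bool" where
  "mono_in D H X m \<longleftrightarrow> (\<exists>A\<in>H. m \<in> Hom D A X \<and>
     (\<forall>B\<in>H. \<forall>f\<in>Hom D B A. \<forall>g\<in>Hom D B A. Comp D m f = Comp D m g \<longrightarrow> f = g))"

definition subobject_le :: "('o, 'm) tri_data \<Rightarrow> 'm \<Rightarrow> 'm \<Rightarrow> bool" where
  "subobject_le D m m' \<longleftrightarrow> (\<exists>t\<in>Hom D (Dom D m) (Dom D m'). m = Comp D m' t)"

definition noetherian_category :: "('o, 'm) tri_data \<Rightarrow> 'o set \<Rightarrow> bool" where
  "noetherian_category D H \<longleftrightarrow>
     (\<forall>X\<in>H. \<forall>m :: nat \<Rightarrow> 'm.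
        (\<forall>i. mono_in D H X (m i)) \<and> (\<forall>i. subobject_le D (m i) (m (Suc i))) \<longrightarrow>
        (\<exists>N. \<forall>i\<ge>N. subobject_le D (m i) (m N)))"

definition artinian_category :: "('o, 'm) tri_data \<Rightarrow> 'o set \<Rightarrow> bool" where
  "artinian_category D H \<longleftrightarrow>
     (\<forall>X\<in>H. \<forall>m :: nat \<Rightarrow> 'm.
        (\<forall>i. mono_in D H X (m i)) \<and> (\<forall>i. subobject_le D (m (Suc i)) (m i)) \<longrightarrow>
        (\<exists>N. \<forall>i\<ge>N. subobject_le D (m N) (m i)))"

definition length_category :: "('o, 'm) tri_data \<Rightarrow> 'o set \<Rightarrow> bool" where
  "length_category D H \<longleftrightarrow> noetherian_category D H \<and> artinian_category D H"

text \<open>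
  An additive equivalence from the full subcategory \<open>H\<close> of \<open>D\<close> to the full subcategory \<open>H'\<close>
  of \<open>D'\<close>, given by \<open>Fo\<close> on objects and \<open>Fa\<close> on morphisms.
\<close>

definition additive_equivalence ::
  "('o, 'm) tri_data \<Rightarrow> 'o set \<Rightarrow> ('p, 'n) tri_data \<Rightarrow> 'p set \<Rightarrow> ('o \<Rightarrow> 'p) \<Rightarrow> ('m \<Rightarrow> 'n) \<Rightarrow> bool"
where
  "additive_equivalence D H D' H' Fo Fa \<longleftrightarrow>
     Fo ` H \<subseteq> H' \<and>
     (\<forall>X\<in>H. Fa (Id D X) = Id D' (Fo X)) \<and>
     (\<forall>X\<in>H. \<forall>Y\<in>H. \<forall>Z\<in>H. \<forall>f\<in>Hom D X Y. \<forall>g\<in>Hom D Y Z.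
        Fa (Comp D g f) = Comp D' (Fa g) (Fa f)) \<and>
     (\<forall>X\<in>H. \<forall>Y\<in>H. \<forall>f\<in>Hom D X Y. \<forall>g\<in>Hom D X Y.
        Fa (Plus D f g) = Plus D' (Fa f) (Fa g)) \<and>
     (\<forall>X\<in>H. \<forall>Y\<in>H. bij_betw Fa (Hom D X Y) (Hom D' (Fo X) (Fo Y))) \<and>
     (\<forall>Y\<in>H'. \<exists>X\<in>H. isomorphic D' (Fo X) Y)"


section \<open>The heart fan and the real heart cofan\<close>

definition heart_cone ::
  "('o, 'm) tri_data \<Rightarrow> (('o \<Rightarrow>\<^sub>0 int) set \<Rightarrow> 'l::ab_group_add) \<Rightarrow> 'o set \<Rightarrow> 'l real_dual set"
where
  "heart_cone D lam K = {v. \<forall>X\<in>K. eval_dual v (lam (K0_class D X)) \<ge> 0}"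

definition heart_fan ::
  "('o, 'm) tri_data \<Rightarrow> (('o \<Rightarrow>\<^sub>0 int) set \<Rightarrow> 'l::ab_group_add) \<Rightarrow> 'o set \<Rightarrow> 'l real_dual set set"
where
  "heart_fan D lam H = (\<Union>K\<in>intermediate_hearts D H. Faces (heart_cone D lam K))"

definition effective_cone ::
  "('o, 'm) tri_data \<Rightarrow> (('o \<Rightarrow>\<^sub>0 int) set \<Rightarrow> 'l::ab_group_add) \<Rightarrow> 'o set \<Rightarrow> 'l tensor_real set"
where
  "effective_cone D lam K = convex_cone hull {tensor_one (lam (K0_class D X)) | X. X \<in> K}"

definition real_heart_cofan ::
  "('o, 'm) tri_data \<Rightarrow> (('o \<Rightarrow>\<^sub>0 int) set \<Rightarrow> 'l::ab_group_add) \<Rightarrow> 'o set \<Rightarrow> 'l tensor_real set set"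
where
  "real_heart_cofan D lam H = (\<Union>K\<in>intermediate_hearts D H. cofaces (effective_cone D lam K))"

end

theory Submission
  imports Defs
begin

text \<open>
  A bounded heart \<open>K\<close> with \<open>H[1] \<ge> K \<ge> H\<close> is the tilt of \<open>H\<close> at the torsion pair
  \<open>(T, F) = (H \<inter> K, H \<inter> K[-1])\<close>, and every object of \<open>K\<close> is an extension of an object of \<open>T\<close> by an
  object of \<open>F[1]\<close>. Hence \<open>C(K)\<close> consists of the functionals that are non-negative on \<open>T\<close> and
  non-positive on \<open>F\<close>. Torsion pairs and their cones only depend on the additive category \<open>H\<close>, which
  gives (2).

  For (1) let \<open>a, b\<close> lie in the cone of \<open>(T, F)\<close> and \<open>a + b\<close> in that of \<open>(T', F')\<close>. The torsion-free
  quotient of an object of \<open>T'\<close> lies in \<open>T' \<inter> F\<close>, where \<open>a + b\<close> is both non-negative and non-positive;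
  so \<open>a\<close> and \<open>b\<close> vanish there, and \<open>a\<close> is non-negative on \<open>T'\<close>. Dually \<open>a\<close> is non-positive on
  \<open>F'\<close>, and the two cones meet in a common face.

  For (3), a functional \<open>v\<close> on a length heart lies in the cone of the torsion pair whose torsion class
  consists of the objects all of whose quotients \<open>Q\<close> have \<open>v(Q) \<ge> 0\<close>.
\<close>

section \<open>Exact triangles\<close>

text \<open>The argument works with triangles and vanishing of Hom, without first making the heart
  an abelian category. A triangle with all three terms in H plays the role of a short exact
  sequence; kernel, image and cokernel of an arrow of H come from truncating its cone and applying
  the octahedral axiom. The order on hearts involves all positive shifts at once; for bounded
  t-structures a devissage turns H[1] >= K >= H into U[1] \<subseteq> U' \<subseteq> U for the
  aisles, and these inclusions drive the tilting correspondence. In (2) the equivalence of hearts is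
  only additive and knows nothing of triangles, so triangles with terms in the heart have to be
  recovered from composition and zero arrows alone. In (3) the two chain conditions have separate
  tasks: ascending chains yield the torsion pair, descending chains the sign on its torsion-free
  part. Since the shift is only an equivalence, X[-1] is throughout replaced by some Y with Y[1]
  isomorphic to X.\<close>

context additive_category
begin

definition hom_zero where
  "hom_zero X Y \<longleftrightarrow> Hom D X Y = {Zero D X Y}"

abbreviation iso_obj (infix "\<simeq>" 50) where
  "X \<simeq> Y \<equiv> isomorphic D X Y"

lemma hom_zeroI: "(\<And>f. f \<in> Hom D X Y \<Longrightarrow> f = Zero D X Y) \<Longrightarrow> hom_zero X Y"
  using zero_hom unfolding hom_zero_def by blast

lemma hom_zeroD: "hom_zero X Y \<Longrightarrow> f \<in> Hom D X Y \<Longrightarrow> f = Zero D X Y"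
  unfolding hom_zero_def by blast

text \<open>The source of every statement that an additive operation preserves zero: composition,
  the shift, and later the equivalence of hearts.\<close>

lemma plus_eq_selfD:
  assumes f: "f \<in> Hom D X Y" and g: "g \<in> Hom D X Y" and e: "f \<boxplus> g = f"
  shows "g = Zero D X Y"
proof -
  have "(Neg D f \<boxplus> f) \<boxplus> g = Neg D f \<boxplus> f"
    using plus_assoc[OF neg_hom[OF f] f g] e by simp
  then have "Zero D X Y \<boxplus> g = Zero D X Y"
    using plus_comm[OF neg_hom[OF f] f] plus_neg[OF f] by simp
  then show ?thesis
    using plus_comm[OF zero_hom g] plus_zero[OF g] by simp
qed

lemma neg_unique:
  assumes f: "f \<in> Hom D X Y" and g: "g \<in> Hom D X Y" and e: "f \<boxplus> g = Zero D X Y"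
  shows "g = Neg D f"
proof -
  have "(Neg D f \<boxplus> f) \<boxplus> g = Neg D f \<boxplus> Zero D X Y"
    using plus_assoc[OF neg_hom[OF f] f g] e by simp
  then have "Zero D X Y \<boxplus> g = Neg D f"
    using plus_comm[OF neg_hom[OF f] f] plus_neg[OF f] plus_zero[OF neg_hom[OF f]] by simp
  then show ?thesis
    using plus_comm[OF zero_hom g] plus_zero[OF g] by simp
qed

lemma neg_neg: "f \<in> Hom D X Y \<Longrightarrow> Neg D (Neg D f) = f"
  using neg_unique[OF neg_hom, of f X Y f] plus_comm[OF neg_hom, of f X Y f] plus_neg by metis

lemma neg_zero: "Neg D (Zero D X Y) = Zero D X Y"
  by (metis neg_unique plus_zero zero_hom)

lemma neg_inj:
  "f \<in> Hom D X Y \<Longrightarrow> g \<in> Hom D X Y \<Longrightarrow> Neg D f = Neg D g \<Longrightarrow> f = g"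
  by (metis neg_neg)

lemma comp_zero: "h \<in> Hom D Y Z \<Longrightarrow> h \<cdot> Zero D X Y = Zero D X Z"
proof (rule plus_eq_selfD)
  assume h: "h \<in> Hom D Y Z"
  show "h \<cdot> Zero D X Y \<in> Hom D X Z" "h \<cdot> Zero D X Y \<in> Hom D X Z"
    using comp_hom[OF zero_hom h] by blast+
  show "h \<cdot> Zero D X Y \<boxplus> h \<cdot> Zero D X Y = h \<cdot> Zero D X Y"
    using comp_plus_left[OF zero_hom zero_hom h] plus_zero[OF zero_hom] by simp
qed

lemma zero_comp: "f \<in> Hom D X Y \<Longrightarrow> Zero D Y Z \<cdot> f = Zero D X Z"
proof (rule plus_eq_selfD)
  assume f: "f \<in> Hom D X Y"
  show "Zero D Y Z \<cdot> f \<in> Hom D X Z" "Zero D Y Z \<cdot> f \<in> Hom D X Z"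
    using comp_hom[OF f zero_hom] by blast+
  show "Zero D Y Z \<cdot> f \<boxplus> Zero D Y Z \<cdot> f = Zero D Y Z \<cdot> f"
    using comp_plus_right[OF f zero_hom zero_hom] plus_zero[OF zero_hom] by simp
qed

lemma comp_neg:
  "f \<in> Hom D X Y \<Longrightarrow> h \<in> Hom D Y Z \<Longrightarrow> h \<cdot> Neg D f = Neg D (h \<cdot> f)"
proof (rule neg_unique)
  assume f: "f \<in> Hom D X Y" and h: "h \<in> Hom D Y Z"
  show "h \<cdot> f \<in> Hom D X Z" "h \<cdot> Neg D f \<in> Hom D X Z"
    using comp_hom f h neg_hom by blast+
  show "h \<cdot> f \<boxplus> h \<cdot> Neg D f = Zero D X Z"
    using comp_plus_left[OF f neg_hom[OF f] h] plus_neg[OF f] comp_zero[OF h] by simp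
qed

lemma neg_comp:
  "f \<in> Hom D X Y \<Longrightarrow> h \<in> Hom D Y Z \<Longrightarrow> Neg D h \<cdot> f = Neg D (h \<cdot> f)"
proof (rule neg_unique)
  assume f: "f \<in> Hom D X Y" and h: "h \<in> Hom D Y Z"
  show "h \<cdot> f \<in> Hom D X Z" "Neg D h \<cdot> f \<in> Hom D X Z"
    using comp_hom f h neg_hom by blast+
  show "h \<cdot> f \<boxplus> Neg D h \<cdot> f = Zero D X Z"
    using comp_plus_right[OF f h neg_hom[OF h]] plus_neg[OF h] zero_comp[OF f] by simp
qed

lemma diff_zeroD:
  "f \<in> Hom D X Y \<Longrightarrow> g \<in> Hom D X Y \<Longrightarrow> f \<boxplus> Neg D g = Zero D X Y \<Longrightarrow> f = g"
  using neg_unique[of f X Y "Neg D g"] neg_hom[of g X Y] neg_inj[of g X Y f] by auto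

lemma zero_object_iff: "zero_object D X \<longleftrightarrow> hom_zero X X"
proof
  assume z: "zero_object D X"
  show "hom_zero X X"
  proof (rule hom_zeroI)
    fix f assume f: "f \<in> Hom D X X"
    show "f = Zero D X X"
      using id_right[OF f] comp_zero[OF f, of X] z unfolding zero_object_def by simp
  qed
next
  assume "hom_zero X X"
  then show "zero_object D X" unfolding zero_object_def using hom_zeroD id_hom by blast
qed

lemma hom_zero_from: assumes "hom_zero X X" shows "hom_zero X Y"
proof (rule hom_zeroI)
  fix f assume f: "f \<in> Hom D X Y"
  show "f = Zero D X Y"
    using id_right[OF f] comp_zero[OF f, of X] hom_zeroD[OF assms id_hom] by simp
qed

lemma hom_zero_to: assumes "hom_zero X X" shows "hom_zero Y X"
proof (rule hom_zeroI)
  fix f assume f: "f \<in> Hom D Y X"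
  show "f = Zero D Y X"
    using id_left[OF f] zero_comp[OF f, of X] hom_zeroD[OF assms id_hom] by simp
qed

lemma Hom_unique: "f \<in> Hom D X Y \<Longrightarrow> f \<in> Hom D X' Y' \<Longrightarrow> X = X' \<and> Y = Y'"
  unfolding Hom_def by auto

lemma isomorphic_def':
  "X \<simeq> Y \<longleftrightarrow> (\<exists>f\<in>Hom D X Y. \<exists>g\<in>Hom D Y X. g \<cdot> f = Id D X \<and> f \<cdot> g = Id D Y)"
  (is "_ \<longleftrightarrow> ?R")
proof
  assume "X \<simeq> Y"
  then obtain f g X' Y' where "f \<in> Hom D X Y" "f \<in> Hom D X' Y'" "g \<in> Hom D Y' X'"
    "g \<cdot> f = Id D X'" "f \<cdot> g = Id D Y'"
    unfolding isomorphic_def iso_arrow_def inverse_arrows_def by blast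
  then show ?R using Hom_unique by metis
next
  assume ?R then show "X \<simeq> Y"
    unfolding isomorphic_def iso_arrow_def inverse_arrows_def by blast
qed

lemma iso_refl: "X \<simeq> X"
  unfolding isomorphic_def' using id_hom id_right by blast

lemma iso_sym: "X \<simeq> Y \<Longrightarrow> Y \<simeq> X"
  unfolding isomorphic_def' by blast

lemma iso_trans:
  assumes "X \<simeq> Y" "Y \<simeq> Z" shows "X \<simeq> Z"
proof -
  obtain f f' where f: "f \<in> Hom D X Y" "f' \<in> Hom D Y X" "f' \<cdot> f = Id D X" "f \<cdot> f' = Id D Y"
    using assms(1) isomorphic_def' by blast
  obtain g g' where g: "g \<in> Hom D Y Z" "g' \<in> Hom D Z Y" "g' \<cdot> g = Id D Y" "g \<cdot> g' = Id D Z"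
    using assms(2) isomorphic_def' by blast
  have "(f' \<cdot> g') \<cdot> (g \<cdot> f) = Id D X"
    using comp_assoc[OF comp_hom[OF f(1) g(1)] g(2) f(2)] comp_assoc[OF f(1) g(1) g(2)]
      f g id_left by simp
  moreover have "(g \<cdot> f) \<cdot> (f' \<cdot> g') = Id D Z"
    using comp_assoc[OF comp_hom[OF g(2) f(2)] f(1) g(1)] comp_assoc[OF g(2) f(2) f(1)]
      f g id_left by simp
  ultimately show ?thesis
    unfolding isomorphic_def' using f g comp_hom by meson
qed

lemma hom_zero_iso_left:
  assumes "X \<simeq> X'" "hom_zero X Y" shows "hom_zero X' Y"
proof (rule hom_zeroI)
  fix u assume u: "u \<in> Hom D X' Y"
  obtain f g where f: "f \<in> Hom D X X'" "g \<in> Hom D X' X" "g \<cdot> f = Id D X" "f \<cdot> g = Id D X'"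
    using assms(1) isomorphic_def' by blast
  have "u \<cdot> f = Zero D X Y" using assms(2) u f comp_hom hom_zeroD by blast
  then show "u = Zero D X' Y"
    using comp_assoc[OF f(2,1) u] f(4) id_right[OF u] zero_comp[OF f(2)] by simp
qed

lemma hom_zero_iso_right:
  assumes "Y \<simeq> Y'" "hom_zero X Y" shows "hom_zero X Y'"
proof (rule hom_zeroI)
  fix u assume u: "u \<in> Hom D X Y'"
  obtain f g where f: "f \<in> Hom D Y Y'" "g \<in> Hom D Y' Y" "g \<cdot> f = Id D Y" "f \<cdot> g = Id D Y'"
    using assms(1) isomorphic_def' by blast
  have "g \<cdot> u = Zero D X Y" using assms(2) u f comp_hom hom_zeroD by blast
  then show "u = Zero D X Y'"
    using comp_assoc[OF u f(2,1)] f(4) id_left[OF u] comp_zero[OF f(1)] by simp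
qed

end

section \<open>Exactness of Hom on triangles, and the octahedral axiom\<close>

context triangulated_category
begin

abbreviation sh where "sh \<equiv> Sh_ob D"

text \<open>Forgetting the arrows absorbs the sign in \<open>TR2\<close>, so that rotation in both
  directions, shifting and replacement by isomorphic objects become rules about objects.\<close>

definition tri where
  "tri A B C \<longleftrightarrow> (\<exists>f\<in>Hom D A B. \<exists>g\<in>Hom D B C. \<exists>h\<in>Hom D C (sh A). (f, g, h) \<in> Tri D)"

lemma sh_zero: "Sh_ar D (Zero D X Y) = Zero D (sh X) (sh Y)"
  using plus_eq_selfD[OF shift_hom[OF zero_hom] shift_hom[OF zero_hom]]
    shift_plus[OF zero_hom zero_hom] plus_zero[OF zero_hom] by metis

lemma sh_inj:
  "f \<in> Hom D X Y \<Longrightarrow> g \<in> Hom D X Y \<Longrightarrow> Sh_ar D f = Sh_ar D g \<Longrightarrow> f = g"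
  using shift_fully_faithful[of X Y] unfolding bij_betw_def inj_on_def by blast

lemma sh_full: "g \<in> Hom D (sh X) (sh Y) \<Longrightarrow> \<exists>f\<in>Hom D X Y. g = Sh_ar D f"
  using shift_fully_faithful[of X Y] unfolding bij_betw_def by blast

lemma sh_full_neg: "g \<in> Hom D (sh X) (sh Y) \<Longrightarrow> \<exists>f\<in>Hom D X Y. g = Neg D (Sh_ar D f)"
  using sh_full[OF neg_hom, of g X Y] neg_neg[of g] by metis

lemma hom_zero_sh: "hom_zero (sh X) (sh Y) \<longleftrightarrow> hom_zero X Y"
proof
  assume *: "hom_zero (sh X) (sh Y)"
  show "hom_zero X Y"
  proof (rule hom_zeroI)
    fix f assume f: "f \<in> Hom D X Y"
    show "f = Zero D X Y"
      using sh_inj[OF f zero_hom] hom_zeroD[OF * shift_hom[OF f]] sh_zero by simp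
  qed
next
  assume *: "hom_zero X Y"
  show "hom_zero (sh X) (sh Y)"
  proof (rule hom_zeroI)
    fix f assume "f \<in> Hom D (sh X) (sh Y)"
    then obtain g where g: "g \<in> Hom D X Y" "f = Sh_ar D g" using sh_full by blast
    then show "f = Zero D (sh X) (sh Y)" using hom_zeroD[OF * g(1)] sh_zero by simp
  qed
qed

lemma iso_sh: "X \<simeq> Y \<longleftrightarrow> sh X \<simeq> sh Y"
proof
  assume "X \<simeq> Y"
  then obtain f g where f: "f \<in> Hom D X Y" "g \<in> Hom D Y X" "g \<cdot> f = Id D X" "f \<cdot> g = Id D Y"
    using isomorphic_def' by blast
  then show "sh X \<simeq> sh Y"
    unfolding isomorphic_def'
    using shift_comp[OF f(1,2)] shift_comp[OF f(2,1)] shift_hom shift_id by metis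
next
  assume "sh X \<simeq> sh Y"
  then obtain f g where f: "f \<in> Hom D (sh X) (sh Y)" "g \<in> Hom D (sh Y) (sh X)"
    "g \<cdot> f = Id D (sh X)" "f \<cdot> g = Id D (sh Y)"
    using isomorphic_def' by blast
  obtain f' where f': "f' \<in> Hom D X Y" "f = Sh_ar D f'" using sh_full f by blast
  obtain g' where g': "g' \<in> Hom D Y X" "g = Sh_ar D g'" using sh_full f by blast
  have "Sh_ar D (g' \<cdot> f') = Sh_ar D (Id D X)" "Sh_ar D (f' \<cdot> g') = Sh_ar D (Id D Y)"
    using f f' g' by (simp_all add: shift_comp shift_id)
  then have "g' \<cdot> f' = Id D X" "f' \<cdot> g' = Id D Y"
    using sh_inj comp_hom f' g' id_hom by meson+
  then show "X \<simeq> Y" unfolding isomorphic_def' using f' g' by blast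
qed

lemma unshift: obtains Y where "sh Y \<simeq> X"
  using shift_ess_surj by blast

lemma triE:
  assumes "tri A B C"
  obtains f g h where "f \<in> Hom D A B" "g \<in> Hom D B C" "h \<in> Hom D C (sh A)" "(f, g, h) \<in> Tri D"
  using assms unfolding tri_def by blast

lemma Tri_third: 
  assumes "(f, g, h) \<in> Tri D" "f \<in> Hom D A B" "g \<in> Hom D B C"
  shows "h \<in> Hom D C (sh A)"
  using Tri_hom[OF assms(1)] assms(2,3) Hom_unique by metis

text \<open>Compare with A -> A -> 0: the filler given by \<open>TR3\<close> starts at a zero
  object, and the composite factors through it.\<close>

lemma Tri_comp:
  assumes T: "(f, g, h) \<in> Tri D" and f: "f \<in> Hom D A B" and g: "g \<in> Hom D B C"
  shows "g \<cdot> f = Zero D A C"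
proof -
  obtain Z where Z: "zero_object D Z" using ex_zero_object by blast
  have "\<exists>c\<in>Hom D Z C. c \<cdot> Zero D A Z = g \<cdot> f \<and> Sh_ar D (Id D A) \<cdot> Zero D Z (sh A) = h \<cdot> c"
    by (rule TR3[OF TR1_id[OF Z] T id_hom zero_hom f g id_hom f refl])
  then show ?thesis using comp_zero by metis
qed

text \<open>Exactness of Hom(E, -) at B. \<open>TR3\<close> is applied to the rotated triangles
  starting with E -> 0 -> E[1] and B -> C -> A[1]. The filler E[1] -> A[1] is the shift of the
  required arrow because the shift is full, and the two signs cancel.\<close>

lemma Tri_weak_kernel:
  assumes T: "(f, g, h) \<in> Tri D" and f: "f \<in> Hom D A B" and g: "g \<in> Hom D B C"
    and u: "u \<in> Hom D E B" and e: "g \<cdot> u = Zero D E C"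
  shows "\<exists>w\<in>Hom D E A. u = f \<cdot> w"
proof -
  obtain Z where Z: "zero_object D Z" using ex_zero_object by blast
  have h: "h \<in> Hom D C (sh A)" by (rule Tri_third[OF T f g])
  have T1: "(Zero D E Z, Zero D Z (sh E), Neg D (Sh_ar D (Id D E))) \<in> Tri D"
    using TR2[OF id_hom zero_hom zero_hom] TR1_id[OF Z] by blast
  have T2: "(g, h, Neg D (Sh_ar D f)) \<in> Tri D"
    using TR2[OF f g h] T by blast
  have "Zero D Z C \<cdot> Zero D E Z = g \<cdot> u"
    using e comp_zero[OF zero_hom] by simp
  then obtain c where c: "c \<in> Hom D (sh E) (sh A)"
    "Sh_ar D u \<cdot> Neg D (Sh_ar D (Id D E)) = Neg D (Sh_ar D f) \<cdot> c"
    using TR3[OF T1 T2 zero_hom zero_hom g h u zero_hom] by blast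
  obtain w where w: "w \<in> Hom D E A" "c = Sh_ar D w" using sh_full[OF c(1)] by blast
  have "Neg D (Sh_ar D (u \<cdot> Id D E)) = Neg D (Sh_ar D (f \<cdot> w))"
    using c(2) comp_neg[OF shift_hom[OF id_hom] shift_hom[OF u]] shift_comp[OF id_hom u]
      neg_comp[OF shift_hom[OF w(1)] shift_hom[OF f]] shift_comp[OF w(1) f] w(2) by simp
  then have "Sh_ar D u = Sh_ar D (f \<cdot> w)"
    using neg_inj[OF shift_hom[OF u] shift_hom[OF comp_hom[OF w(1) f]]] id_right[OF u] by simp
  then have "u = f \<cdot> w" using sh_inj u comp_hom[OF w(1) f] by blast
  then show ?thesis using w by blast
qed

text \<open>Exactness of Hom(-, E) at B, by comparison with the triangle 0 -> E -> E.\<close>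

lemma Tri_weak_cokernel:
  assumes T: "(f, g, h) \<in> Tri D" and f: "f \<in> Hom D A B" and g: "g \<in> Hom D B C"
    and u: "u \<in> Hom D B E" and e: "u \<cdot> f = Zero D A E"
  shows "\<exists>w\<in>Hom D C E. u = w \<cdot> g"
proof -
  obtain Z where Z: "zero_object D Z" using ex_zero_object by blast
  have sZ: "zero_object D (sh Z)" using Z zero_object_iff hom_zero_sh by blast
  have T2: "(Zero D Z E, Id D E, Zero D E (sh Z)) \<in> Tri D"
    using TR2[OF zero_hom id_hom zero_hom] TR1_id[OF sZ] by (simp add: sh_zero neg_zero)
  have "u \<cdot> f = Zero D Z E \<cdot> Zero D A Z"
    using e comp_zero[OF zero_hom] by simp
  then obtain c where "c \<in> Hom D C E" "c \<cdot> g = Id D E \<cdot> u"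
    using TR3[OF T T2 f g zero_hom id_hom zero_hom u] by blast
  then show ?thesis using u id_left by metis
qed

lemma tri_rot: "tri A B C \<Longrightarrow> tri B C (sh A)"
  unfolding tri_def using TR2 neg_hom shift_hom by meson

lemma Tri_unrot:
  assumes T: "(g, h, k) \<in> Tri D" and g: "g \<in> Hom D B C" and h: "h \<in> Hom D C (sh A)"
  shows "\<exists>f\<in>Hom D A B. (f, g, h) \<in> Tri D"
proof -
  have "k \<in> Hom D (sh A) (sh B)" by (rule Tri_third[OF T g h])
  then obtain f where f: "f \<in> Hom D A B" "k = Neg D (Sh_ar D f)" using sh_full_neg by blast
  then show ?thesis using TR2[OF f(1) g h] T by blast
qed

lemma tri_unrot: "tri B C (sh A) \<Longrightarrow> tri A B C"
  unfolding tri_def using Tri_unrot by meson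

lemma tri_sh: "tri (sh A) (sh B) (sh C) \<longleftrightarrow> tri A B C"
  using tri_rot tri_unrot by meson

lemma Tri_iso:
  assumes T: "(f, g, h) \<in> Tri D" and f: "f \<in> Hom D A B" and g: "g \<in> Hom D B C"
    and C: "C \<simeq> C'"
  shows "\<exists>g'\<in>Hom D B C'. \<exists>h'. (f, g', h') \<in> Tri D"
proof -
  have h: "h \<in> Hom D C (sh A)" by (rule Tri_third[OF T f g])
  obtain c d where c: "c \<in> Hom D C C'" "d \<in> Hom D C' C" "d \<cdot> c = Id D C" "c \<cdot> d = Id D C'"
    using C isomorphic_def' by blast
  have i: "iso_arrow D c" "\<And>X. iso_arrow D (Id D X)"
    using c id_hom id_right unfolding iso_arrow_def inverse_arrows_def by blast+
  have "(f, c \<cdot> g, h \<cdot> d) \<in> Tri D"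
  proof (rule TR1_iso[OF T f g h f _ _ id_hom id_hom c(1) i(2) i(2) i(1)])
    show "c \<cdot> g \<in> Hom D B C'" using c g comp_hom by blast
    then show "c \<cdot> g = (c \<cdot> g) \<cdot> Id D B" using id_right by simp
    show "h \<cdot> d \<in> Hom D C' (sh A)" using c h comp_hom by blast
    show "Id D B \<cdot> f = f \<cdot> Id D A" using f id_left id_right by simp
    show "Sh_ar D (Id D A) \<cdot> h = (h \<cdot> d) \<cdot> c"
      using comp_assoc[OF c(1,2) h] c(3) shift_id id_left[OF h] id_right[OF h] by simp
  qed
  then show ?thesis using c g comp_hom by blast
qed

lemma tri_iso3: "tri A B C \<Longrightarrow> C \<simeq> C' \<Longrightarrow> tri A B C'"
  unfolding tri_def using Tri_iso Tri_third by meson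

lemma tri_iso: "tri A B C \<Longrightarrow> A \<simeq> A' \<Longrightarrow> B \<simeq> B' \<Longrightarrow> C \<simeq> C' \<Longrightarrow> tri A' B' C'"
  by (meson iso_sh tri_iso3 tri_rot tri_unrot)

text \<open>Stands in for the rotation C[-1] -> A -> B, as C need not be a shift on the
  nose.\<close>

lemma tri_unrotE:
  assumes "tri A B C" obtains C' where "sh C' \<simeq> C" "tri C' A B"
  by (meson assms iso_sym tri_iso3 tri_unrot unshift)

lemma hom_zero_mid_right:
  assumes "tri A B C" "hom_zero E A" "hom_zero E C" shows "hom_zero E B"
proof (rule hom_zeroI)
  fix u assume u: "u \<in> Hom D E B"
  from assms(1) obtain f g h where T: "(f, g, h) \<in> Tri D" "f \<in> Hom D A B" "g \<in> Hom D B C"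
    by (rule triE)
  have "g \<cdot> u = Zero D E C" using assms(3) T u comp_hom hom_zeroD by blast
  then obtain w where "w \<in> Hom D E A" "u = f \<cdot> w" using Tri_weak_kernel[OF T u] by blast
  then show "u = Zero D E B" using assms(2) T comp_zero hom_zeroD by metis
qed

lemma hom_zero_mid_left:
  assumes "tri A B C" "hom_zero A E" "hom_zero C E" shows "hom_zero B E"
proof (rule hom_zeroI)
  fix u assume u: "u \<in> Hom D B E"
  from assms(1) obtain f g h where T: "(f, g, h) \<in> Tri D" "f \<in> Hom D A B" "g \<in> Hom D B C"
    by (rule triE)
  have "u \<cdot> f = Zero D A E" using assms(2) T u comp_hom hom_zeroD by blast
  then obtain w where "w \<in> Hom D C E" "u = w \<cdot> g" using Tri_weak_cokernel[OF T u] by blast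
  then show "u = Zero D B E" using assms(3) T zero_comp hom_zeroD by metis
qed

lemma tri_zero3: "hom_zero Z Z \<Longrightarrow> tri A A Z"
  unfolding tri_def using TR1_id zero_object_iff id_hom zero_hom by blast

text \<open>The identity of B is killed by g, so it factors as f w. For the other composite, w f - 1
  is killed by f, hence its shift factors through h, which starts at the zero object C.\<close>

lemma tri_zero3_iso:
  assumes "tri A B C" "hom_zero C C" shows "A \<simeq> B"
proof -
  from assms(1) obtain f g h where T: "(f, g, h) \<in> Tri D" "f \<in> Hom D A B" "g \<in> Hom D B C"
    "h \<in> Hom D C (sh A)"
    by (rule triE)
  obtain w where w: "w \<in> Hom D B A" "Id D B = f \<cdot> w"
    using Tri_weak_kernel[OF T(1,2,3) id_hom]
      hom_zeroD[OF hom_zero_to[OF assms(2)] comp_hom[OF id_hom T(3)]] by blast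
  have fw: "f \<cdot> (w \<cdot> f) = f \<cdot> Id D A"
    using comp_assoc[OF T(2) w(1) T(2)] w(2)[symmetric] id_left[OF T(2)] id_right[OF T(2)] by simp
  obtain C' where C': "sh C' \<simeq> C" "tri C' A B" using assms(1) by (rule tri_unrotE)
  have hz: "hom_zero (sh A) C" using hom_zero_to[OF assms(2)] .
  let ?d = "(w \<cdot> f) \<boxplus> Neg D (Id D A)"
  have wf: "w \<cdot> f \<in> Hom D A A" using w T comp_hom by blast
  then have d: "?d \<in> Hom D A A" using id_hom neg_hom plus_hom by blast
  have fd: "f \<cdot> ?d = Zero D A B"
    using comp_plus_left[OF wf neg_hom[OF id_hom] T(2)] comp_neg[OF id_hom T(2)]
      fw plus_neg[OF comp_hom[OF id_hom T(2)]] by simp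
  have T': "(h, Neg D (Sh_ar D f), Neg D (Sh_ar D g)) \<in> Tri D"
    using TR2 T shift_hom neg_hom by blast
  have "Neg D (Sh_ar D f) \<cdot> Sh_ar D ?d = Zero D (sh A) (sh B)"
    using neg_comp[OF shift_hom[OF d] shift_hom[OF T(2)]] shift_comp[OF d T(2)]
    unfolding fd sh_zero by (metis neg_zero)
  then obtain k where "k \<in> Hom D (sh A) C" "Sh_ar D ?d = h \<cdot> k"
    using Tri_weak_kernel[OF T' T(4) _ shift_hom[OF d]] T shift_hom neg_hom by blast
  then have "Sh_ar D ?d = Sh_ar D (Zero D A A)"
    using hom_zeroD[OF hz] comp_zero[OF T(4)] sh_zero by metis
  then have "?d = Zero D A A" using sh_inj d zero_hom by blast
  then have "w \<cdot> f = Id D A" using diff_zeroD wf id_hom by blast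
  then show ?thesis unfolding isomorphic_def' using w T by metis
qed

lemma tri_zero1: "hom_zero Z Z \<Longrightarrow> tri Z A A"
  by (meson hom_zero_sh tri_unrot tri_zero3)

lemma tri_zero1_iso: "tri A B C \<Longrightarrow> hom_zero A A \<Longrightarrow> B \<simeq> C"
  by (meson hom_zero_sh tri_rot tri_zero3_iso)

text \<open>The third object of a triangle on g is replaced by an isomorphic one that is a shift;
  then the triangle can be rotated back.\<close>

lemma Tri_fibre:
  assumes g: "g \<in> Hom D B C" obtains A f h where "f \<in> Hom D A B" "(f, g, h) \<in> Tri D"
proof -
  obtain h k where T: "(g, h, k) \<in> Tri D" using TR1_cone[OF g] by blast
  obtain W where h: "h \<in> Hom D C W" using Tri_hom[OF T] g Hom_unique by metis
  obtain A where "sh A \<simeq> W" by (rule unshift)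
  then obtain h' k' where "h' \<in> Hom D C (sh A)" "(g, h', k') \<in> Tri D"
    using Tri_iso[OF T g h] iso_sym by blast
  then show thesis using Tri_unrot[OF _ g] that by blast
qed

lemma Tri_cone:
  assumes f: "f \<in> Hom D A B" obtains C g h where "g \<in> Hom D B C" "(f, g, h) \<in> Tri D"
proof -
  obtain g h where T: "(f, g, h) \<in> Tri D" using TR1_cone[OF f] by blast
  then show thesis using Tri_hom[OF T] f Hom_unique that by metis
qed

text \<open>The third isomorphism theorem for A -> Y -> X: read I as Y/A, R as X/Y and W as
  X/A.\<close>

lemma tri_assoc_right:
  assumes "tri A Y I" "tri Y X R"
  shows "\<exists>W. tri A X W \<and> tri I W R"
proof -
  from assms(1) obtain f p1 d1 where T1: "(f, p1, d1) \<in> Tri D" "f \<in> Hom D A Y" "p1 \<in> Hom D Y I"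
    by (rule triE)
  from assms(2) obtain g p3 d3 where T3: "(g, p3, d3) \<in> Tri D" "g \<in> Hom D Y X" "p3 \<in> Hom D X R"
    by (rule triE)
  have gf: "g \<cdot> f \<in> Hom D A X" using T1 T3 comp_hom by blast
  obtain W p2 d2 where T2: "p2 \<in> Hom D X W" "(g \<cdot> f, p2, d2) \<in> Tri D" by (rule Tri_cone[OF gf])
  have "Cod D p1 = I" "Cod D p2 = W" "Cod D p3 = R"
    using T1 T2 T3 unfolding Hom_def by auto
  then obtain a b where "a \<in> Hom D I W" "b \<in> Hom D W R" "(a, b, Sh_ar D p1 \<cdot> d3) \<in> Tri D"
    using TR4[OF T1(2) T3(2) T1(1) T2(2) T3(1)] by auto
  then have "tri I W R" unfolding tri_def using Tri_third by blast
  moreover have "tri A X W" unfolding tri_def using gf T2 Tri_third by blast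
  ultimately show ?thesis by blast
qed

text \<open>The octahedral axiom, with the composite's fibre in place of its cone.\<close>

lemma Tri_assoc_left:
  assumes T1: "(m, g, h) \<in> Tri D" "m \<in> Hom D A X" "g \<in> Hom D X C"
    and T2: "(i, q, k) \<in> Tri D" "i \<in> Hom D I C" "q \<in> Hom D C Q"
  shows "\<exists>X' m' l. m' \<in> Hom D X' X \<and> (m', q \<cdot> g, l) \<in> Tri D \<and> tri A X' I"
proof -
  have qg: "q \<cdot> g \<in> Hom D X Q" using assms comp_hom by blast
  obtain X' m' l where T3: "m' \<in> Hom D X' X" "(m', q \<cdot> g, l) \<in> Tri D" by (rule Tri_fibre[OF qg])
  have h: "h \<in> Hom D C (sh A)" and k: "k \<in> Hom D Q (sh I)" and l: "l \<in> Hom D Q (sh X')"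
    using Tri_third T1 T2 T3 qg by blast+
  have R1: "(g, h, Neg D (Sh_ar D m)) \<in> Tri D" and R2: "(q, k, Neg D (Sh_ar D i)) \<in> Tri D"
    and R3: "(q \<cdot> g, l, Neg D (Sh_ar D m')) \<in> Tri D"
    using TR2 T1 T2 T3 h k l qg by blast+
  have "Cod D h = sh A" "Cod D l = sh X'" "Cod D k = sh I"
    using h k l unfolding Hom_def by auto
  then obtain a b c where "a \<in> Hom D (sh A) (sh X')" "b \<in> Hom D (sh X') (sh I)" "(a, b, c) \<in> Tri D"
    using TR4[OF T1(3) T2(3) R1 R3 R2] by auto
  then have "tri (sh A) (sh X') (sh I)" unfolding tri_def using Tri_third by blast
  then show ?thesis using T3 tri_sh by blast
qed

lemma tri_assoc_left:
  assumes "tri A X C" "tri I C Q"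
  shows "\<exists>X'. tri X' X Q \<and> tri A X' I"
proof -
  from assms(1) obtain m g h where T1: "(m, g, h) \<in> Tri D" "m \<in> Hom D A X" "g \<in> Hom D X C"
    by (rule triE)
  from assms(2) obtain i q k where T2: "(i, q, k) \<in> Tri D" "i \<in> Hom D I C" "q \<in> Hom D C Q"
    by (rule triE)
  have "q \<cdot> g \<in> Hom D X Q" using T1 T2 comp_hom by blast
  then show ?thesis
    using Tri_assoc_left[OF T1 T2] Tri_third unfolding tri_def by blast
qed

end

section \<open>Additive functions on triangles\<close>

context triangulated_category
begin

definition additive_on_triangles :: "('a \<Rightarrow> 'l::ab_group_add) \<Rightarrow> bool" where
  "additive_on_triangles \<phi> \<longleftrightarrow> (\<forall>A B C. tri A B C \<longrightarrow> \<phi> B = \<phi> A + \<phi> C)"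

lemma additive_tri: "additive_on_triangles \<phi> \<Longrightarrow> tri A B C \<Longrightarrow> \<phi> B = \<phi> A + \<phi> C"
  unfolding additive_on_triangles_def by blast

lemma additive_zero: "additive_on_triangles \<phi> \<Longrightarrow> hom_zero Z Z \<Longrightarrow> \<phi> Z = 0"
  using additive_tri[OF _ tri_zero3[of Z Z]] by force

lemma additive_iso: "additive_on_triangles \<phi> \<Longrightarrow> X \<simeq> Y \<Longrightarrow> \<phi> X = \<phi> Y"
proof -
  assume a: "additive_on_triangles \<phi>" and i: "X \<simeq> Y"
  obtain Z where Z: "hom_zero Z Z" using ex_zero_object zero_object_iff by blast
  have "tri X Y Z" using tri_iso[OF tri_zero3[OF Z] iso_refl i iso_refl] .
  from additive_tri[OF a this] additive_zero[OF a Z] show ?thesis by simp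
qed

lemma additive_sh: "additive_on_triangles \<phi> \<Longrightarrow> \<phi> (sh X) = - \<phi> X"
proof -
  assume a: "additive_on_triangles \<phi>"
  obtain Z where Z: "hom_zero Z Z" using ex_zero_object zero_object_iff by blast
  from additive_tri[OF a tri_rot[OF tri_zero3[OF Z]], of X] additive_zero[OF a Z]
  show ?thesis by (simp add: eq_neg_iff_add_eq_0 add.commute)
qed

text \<open>The generators of \<open>K0_kernel\<close> identify exactly the two cosets in question.
  Afterwards additivity on triangles is all that is used about \<open>lam\<close>.\<close>

lemma additive_K0:
  assumes "lam \<in> hom (K0 D) additive_group"
  shows "additive_on_triangles (\<lambda>X. lam (K0_class D X))"
  unfolding additive_on_triangles_def
proof (intro allI impI)
  fix A B C assume "tri A B C"
  then obtain f g h where f: "f \<in> Hom D A B" "g \<in> Hom D B C" "(f, g, h) \<in> Tri D" by (rule triE)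
  let ?F = "free_Abelian_group UNIV :: ('a \<Rightarrow>\<^sub>0 int) monoid"
  interpret F: comm_group ?F by (rule abelian_free_Abelian_group)
  have sub: "subgroup (K0_kernel D) ?F"
    unfolding K0_kernel_def by (rule F.generate_is_subgroup) auto
  then interpret K: normal "K0_kernel D" ?F using F.normal_iff_subgroup by blast
  have "Dom D f = A" "Cod D f = B" "Cod D g = C" using f unfolding Hom_def by auto
  then have "frag_of B - frag_of A - frag_of C \<in> K0_relations D"
    unfolding K0_relations_def using f by blast
  then have k: "frag_of B - frag_of A - frag_of C \<in> K0_kernel D"
    unfolding K0_kernel_def by (rule generate.incl)
  have "K0_class D A \<otimes>\<^bsub>K0 D\<^esub> K0_class D C = K0_kernel D #>\<^bsub>?F\<^esub> (frag_of A + frag_of C)"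
    unfolding K0_class_def K0_def FactGroup_def by (simp add: K.rcos_sum)
  also have "\<dots> = K0_class D B"
    unfolding K0_class_def
  proof (rule F.repr_independence[OF _ _ sub])
    show "frag_of B \<in> K0_kernel D #>\<^bsub>?F\<^esub> (frag_of A + frag_of C)"
      unfolding r_coset_def using k by (auto intro!: bexI[of _ "frag_of B - frag_of A - frag_of C"])
  qed simp
  finally have "lam (K0_class D B) = lam (K0_class D A \<otimes>\<^bsub>K0 D\<^esub> K0_class D C)" by simp
  also have "\<dots> = lam (K0_class D A) \<otimes>\<^bsub>additive_group\<^esub> lam (K0_class D C)"
  proof (rule hom_mult[OF assms])
    show "K0_class D A \<in> carrier (K0 D)" "K0_class D C \<in> carrier (K0 D)"
      unfolding K0_class_def K0_def FactGroup_def RCOSETS_def by auto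
  qed
  finally show "lam (K0_class D B) = lam (K0_class D A) + lam (K0_class D C)"
    by (simp add: additive_group_def)
qed

text \<open>Together with its dual below, the way objects are shown to vanish: apply Hom(-, C) to
  the rotated triangle B -> C -> A[1].\<close>

lemma hom_zero_cone:
  assumes "tri A B C" "hom_zero B C" "hom_zero (sh A) C" shows "hom_zero C C"
  using hom_zero_mid_left[OF tri_rot[OF assms(1)] assms(2,3)] .

lemma hom_zero_fibre:
  assumes "tri A B C" "hom_zero A B" "hom_zero (sh A) C" shows "hom_zero A A"
proof -
  obtain C' where "sh C' \<simeq> C" "tri C' A B" using assms(1) by (rule tri_unrotE)
  then show ?thesis
    using hom_zero_mid_right assms(2,3) hom_zero_iso_right iso_sym hom_zero_sh by meson
qed

lemma iso_sh_pow: "X \<simeq> Y \<Longrightarrow> (sh ^^ n) X \<simeq> (sh ^^ n) Y"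
  by (induction n) (simp_all add: iso_sh[symmetric])

lemma hom_zero_sh_pow: "hom_zero ((sh ^^ n) X) ((sh ^^ n) Y) \<longleftrightarrow> hom_zero X Y"
  by (induction n) (simp_all add: hom_zero_sh)

lemma sh_pow_sh: "(sh ^^ n) (sh X) = sh ((sh ^^ n) X)"
  by (simp add: funpow_swap1)

lemma sh_pow_add: "(sh ^^ m) ((sh ^^ n) X) = (sh ^^ (m + n)) X"
  by (simp add: funpow_add)

lemma unshift_pow: "\<exists>Y. X \<simeq> (sh ^^ n) Y"
proof (induction n arbitrary: X)
  case 0 then show ?case using iso_refl by auto
next
  case (Suc n)
  obtain W where W: "sh W \<simeq> X" by (rule unshift)
  obtain Y where "W \<simeq> (sh ^^ n) Y" using Suc by blast
  then show ?case using W iso_sh iso_trans iso_sym by (metis funpow.simps(2) comp_apply)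
qed

end

section \<open>t-structures\<close>

text \<open>\<open>U\<close> and \<open>V\<close> are the objects of degree \<open>\<le> 0\<close> and \<open>\<ge> 0\<close>; orthogonality and the truncation
  triangles are moved one shift up, so that no negative shift occurs.\<close>

locale tstruct = triangulated_category +
  fixes U V
  assumes U_iso: "X \<in> U \<Longrightarrow> X \<simeq> Y \<Longrightarrow> Y \<in> U"
    and V_iso: "X \<in> V \<Longrightarrow> X \<simeq> Y \<Longrightarrow> Y \<in> V"
    and U_sh: "X \<in> U \<Longrightarrow> sh X \<in> U"
    and V_unsh: "sh X \<in> V \<Longrightarrow> X \<in> V"
    and UV_orth: "X \<in> U \<Longrightarrow> Y \<in> V \<Longrightarrow> hom_zero (sh X) Y"
    and truncation: "\<exists>X\<in>U. \<exists>Y\<in>V. tri (sh X) Z Y"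
begin

text \<open>Truncate X[1] as A[1] -> X[1] -> B. No nonzero map to B comes from X[1], by assumption,
  or from A[2], so B is zero and X is isomorphic to A.\<close>

lemma U_iff: "X \<in> U \<longleftrightarrow> (\<forall>Y\<in>V. hom_zero (sh X) Y)"
proof
  assume *: "\<forall>Y\<in>V. hom_zero (sh X) Y"
  obtain A B where AB: "A \<in> U" "B \<in> V" "tri (sh A) (sh X) B" using truncation by blast
  then have "hom_zero B B" using hom_zero_cone[OF AB(3)] * UV_orth[OF U_sh] by blast
  then have "A \<simeq> X" using tri_zero3_iso[OF AB(3)] iso_sh by blast
  then show "X \<in> U" using AB U_iso by blast
qed (use UV_orth in blast)

lemma V_iff: "Y \<in> V \<longleftrightarrow> (\<forall>X\<in>U. hom_zero (sh X) Y)"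
proof
  assume *: "\<forall>X\<in>U. hom_zero (sh X) Y"
  obtain A B where AB: "A \<in> U" "B \<in> V" "tri (sh A) Y B" using truncation by blast
  have "hom_zero (sh (sh A)) B" using UV_orth[OF U_sh] AB by blast
  then have "hom_zero (sh A) (sh A)" using hom_zero_fibre[OF AB(3)] * AB by blast
  then have "Y \<simeq> B" using tri_zero1_iso[OF AB(3)] by blast
  then show "Y \<in> V" using AB V_iso iso_sym by blast
qed (use UV_orth in blast)

lemma U_ext: "tri A X B \<Longrightarrow> A \<in> U \<Longrightarrow> B \<in> U \<Longrightarrow> X \<in> U"
  by (meson U_iff hom_zero_mid_left tri_sh)

lemma V_ext: "tri A X B \<Longrightarrow> A \<in> V \<Longrightarrow> B \<in> V \<Longrightarrow> X \<in> V"
  by (meson V_iff hom_zero_mid_right)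

lemma U_cone: "tri A X B \<Longrightarrow> A \<in> U \<Longrightarrow> X \<in> U \<Longrightarrow> B \<in> U"
  by (meson U_ext U_sh tri_rot)

lemma V_fibre: "tri A X B \<Longrightarrow> X \<in> V \<Longrightarrow> B \<in> V \<Longrightarrow> A \<in> V"
  by (meson V_ext V_iso V_unsh iso_sym tri_unrotE)

lemma heart_ext: "tri A X B \<Longrightarrow> A \<in> U \<inter> V \<Longrightarrow> B \<in> U \<inter> V \<Longrightarrow> X \<in> U \<inter> V"
  using U_ext V_ext by blast

lemma heart_iso: "X \<in> U \<inter> V \<Longrightarrow> X \<simeq> Y \<Longrightarrow> Y \<in> U \<inter> V"
  using U_iso V_iso by blast

lemma zero_in_U: "hom_zero Z Z \<Longrightarrow> Z \<in> U"
  using U_iff hom_zero_sh hom_zero_from by meson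

lemma zero_in_V: "hom_zero Z Z \<Longrightarrow> Z \<in> V"
  using V_iff hom_zero_to by meson

lemma truncation_unshifted: "\<exists>A\<in>U. \<exists>B. sh B \<in> V \<and> tri A X B"
proof -
  obtain A Y where AY: "A \<in> U" "Y \<in> V" "tri (sh A) (sh X) Y" using truncation by blast
  obtain B where B: "sh B \<simeq> Y" by (rule unshift)
  then have "tri A X B" using tri_iso3[OF AY(3)] iso_sym tri_sh by blast
  moreover have "sh B \<in> V" using B AY V_iso iso_sym by blast
  ultimately show ?thesis using AY by blast
qed

lemma U_sh_pow: "X \<in> U \<Longrightarrow> (sh ^^ n) X \<in> U"
  by (induction n) (simp_all add: U_sh)

lemma V_unsh_pow: "(sh ^^ n) X \<in> V \<Longrightarrow> X \<in> V"
  by (induction n) (simp_all add: V_unsh)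

end

text \<open>Membership of X in V[n] is expressed by the vanishing of Hom(U[n+1], X), so neither
  bound mentions a negative shift.\<close>

locale bounded_tstruct = tstruct +
  assumes bounded_above: "\<exists>n. (sh ^^ n) X \<in> U"
    and bounded_below: "\<exists>n. \<forall>E\<in>U. hom_zero ((sh ^^ Suc n) E) X"
begin

text \<open>Devissage of Y. Truncation gives A -> Y -> B with A in the heart; B[1] lies in V again,
  needs one shift fewer to reach U, and is tested against X[1] instead of X.\<close>

lemma orth_V_if_orth_heart:
  assumes "\<And>m Y. m > 0 \<Longrightarrow> Y \<in> U \<inter> V \<Longrightarrow> hom_zero ((sh ^^ m) X) Y" "Y \<in> V"
  shows "hom_zero (sh X) Y"
proof -
  obtain n where "(sh ^^ n) Y \<in> U" using bounded_above by blast
  then show ?thesis using assms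
  proof (induction n arbitrary: X Y)
    case 0
    then show ?case using "0.prems"(2)[of 1 Y] by simp
  next
    case (Suc n)
    obtain A B where AB: "A \<in> U" "sh B \<in> V" "tri A Y B" using truncation_unshifted by blast
    have A: "A \<in> V" using V_fibre[OF AB(3)] Suc.prems AB V_unsh by blast
    have "tri ((sh ^^ k) A) ((sh ^^ k) Y) ((sh ^^ k) B)" for k
      using AB(3) by (induction k) (simp_all add: tri_sh)
    from U_cone[OF this[of "Suc n"] U_sh_pow[OF AB(1)] Suc.prems(1)]
    have sB: "(sh ^^ n) (sh B) \<in> U" by (simp add: sh_pow_sh)
    have "hom_zero ((sh ^^ m) (sh X)) W" if "m > 0" "W \<in> U \<inter> V" for m W
      using Suc.prems(2)[of "Suc m" W] that by (simp add: sh_pow_sh)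
    then have "hom_zero (sh (sh X)) (sh B)" using Suc.IH[OF sB _ AB(2)] by blast
    moreover have "hom_zero (sh X) A" using Suc.prems(2)[of 1 A] AB A by simp
    ultimately show ?case using hom_zero_mid_right[OF AB(3)] hom_zero_sh by blast
  qed
qed

text \<open>Devissage of the source. The truncation A[1] -> X -> B has B in the heart, and A has a
  smaller bound than X; it is tested against a desuspension of Y.\<close>

lemma orth_U_if_heart_orth:
  assumes "\<And>m X. m > 0 \<Longrightarrow> X \<in> U \<inter> V \<Longrightarrow> hom_zero ((sh ^^ m) X) Y" "X \<in> U"
  shows "hom_zero (sh X) Y"
proof -
  obtain n where "\<forall>E\<in>U. hom_zero ((sh ^^ Suc n) E) X" using bounded_below by blast
  then show ?thesis using assms
  proof (induction n arbitrary: X Y)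
    case 0
    then have "X \<in> V" using V_iff by simp
    then show ?case using "0.prems"(2)[of 1 X] "0.prems"(3) by simp
  next
    case (Suc n)
    obtain A B where AB: "A \<in> U" "B \<in> V" "tri (sh A) X B" using truncation by blast
    obtain B' where B': "sh B' \<simeq> B" "tri B' (sh A) X" using AB(3) by (rule tri_unrotE)
    have B'V: "B' \<in> V" using B'(1) AB(2) V_iso iso_sym V_unsh by blast
    obtain Y' where Y': "sh Y' \<simeq> Y" by (rule unshift)
    \<comment> \<open>The bound drops by one: A[1] sits between B[-1] and X, and neither of them
      receives maps from E[n+2].\<close>
    have "\<forall>E\<in>U. hom_zero ((sh ^^ Suc n) E) A"
    proof
      fix E assume E: "E \<in> U"
      have "hom_zero ((sh ^^ Suc (Suc n)) E) B'"
        using UV_orth[OF U_sh_pow[OF E] B'V, of "Suc n"] by simp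
      then have "hom_zero ((sh ^^ Suc (Suc n)) E) (sh A)"
        using hom_zero_mid_right[OF B'(2)] Suc.prems(1) E by blast
      then show "hom_zero ((sh ^^ Suc n) E) A" by (simp add: hom_zero_sh)
    qed
    moreover have "hom_zero ((sh ^^ m) W) Y'" if "m > 0" "W \<in> U \<inter> V" for m W
      using hom_zero_iso_right[OF iso_sym[OF Y'] Suc.prems(2)[of "Suc m" W]] that
      by (simp add: hom_zero_sh)
    ultimately have "hom_zero (sh A) Y'" using Suc.IH AB(1) by blast
    then have "hom_zero (sh (sh A)) Y" using hom_zero_sh hom_zero_iso_right[OF Y'] by blast
    moreover have "B \<in> U" using U_cone[OF AB(3)] U_sh AB Suc.prems(3) by blast
    then have "hom_zero (sh B) Y" using Suc.prems(2)[of 1 B] AB by simp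
    ultimately show ?case using hom_zero_mid_left AB(3) tri_sh by blast
  qed
qed

end

section \<open>Translation of the definitions, and the order on hearts in terms of aisles\<close>

context triangulated_category
begin

lemma t_structure_iff: "t_structure D U V \<longleftrightarrow> tstruct D U V"
proof -
  have s: "shift_set D S (- 1) = {X. sh X \<in> S}" for S
    unfolding shift_set_def by simp
  show ?thesis
  proof
    assume t: "t_structure D U V"
    show "tstruct D U V"
    proof (unfold_locales)
      show "Y \<in> U" if "X \<in> U" "X \<simeq> Y" for X Y
        using t that unfolding t_structure_def iso_closed_def by blast
      show V: "Y \<in> V" if "X \<in> V" "X \<simeq> Y" for X Y
        using t that unfolding t_structure_def iso_closed_def by blast
      show "sh X \<in> U" if "X \<in> U" for X
        using t that unfolding t_structure_def s by blast
      show "X \<in> V" if "sh X \<in> V" for X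
        using t that unfolding t_structure_def s by blast
      show "hom_zero (sh X) Y" if X: "X \<in> U" and Y: "Y \<in> V" for X Y
      proof -
        obtain B where B: "sh B \<simeq> Y" by (rule unshift)
        then have "sh B \<in> V" using V Y iso_sym by blast
        then have "hom_zero X B"
          using t X unfolding t_structure_def s hom_vanish_def hom_zero_def by blast
        then show ?thesis using hom_zero_sh hom_zero_iso_right[OF B] by blast
      qed
      show "\<exists>X\<in>U. \<exists>Y\<in>V. tri (sh X) Z Y" for Z
      proof -
        obtain W where W: "sh W \<simeq> Z" by (rule unshift)
        obtain A B where AB: "A \<in> U" "sh B \<in> V" "tri A W B"
          using t unfolding t_structure_def s tri_def by blast
        then have "tri (sh A) (sh W) (sh B)" using tri_sh by blast
        then have "tri (sh A) Z (sh B)" using tri_iso iso_refl W by blast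
        then show ?thesis using AB by blast
      qed
    qed
  next
    assume "tstruct D U V"
    then interpret tstruct D U V .
    show "t_structure D U V"
      unfolding t_structure_def s
    proof (intro conjI)
      show "iso_closed D U" "iso_closed D V" unfolding iso_closed_def using U_iso V_iso by blast+
      show "U \<subseteq> {X. sh X \<in> U}" "{X. sh X \<in> V} \<subseteq> V" using U_sh V_unsh by blast+
      show "hom_vanish D U {X. sh X \<in> V}"
        using UV_orth hom_zero_sh unfolding hom_vanish_def hom_zero_def[symmetric] by blast
      show "\<forall>X. \<exists>A\<in>U. \<exists>B\<in>{X. sh X \<in> V}. \<exists>f\<in>Hom D A X. \<exists>g\<in>Hom D X B. \<exists>h\<in>Hom D B (sh A).
          (f, g, h) \<in> Tri D"
        using truncation_unshifted unfolding tri_def by blast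
    qed
  qed
qed

lemma shift_set_nonneg: "shift_set D S (int n) = {X. \<exists>A\<in>S. X \<simeq> (sh ^^ n) A}"
  unfolding shift_set_def by simp

lemma bounded_t_structure_iff: "bounded_t_structure D U V \<longleftrightarrow> bounded_tstruct D U V"
proof
  assume b: "bounded_t_structure D U V"
  then interpret tstruct D U V unfolding bounded_t_structure_def t_structure_iff by blast
  show "bounded_tstruct D U V"
  proof unfold_locales
    fix X
    obtain n where n: "X \<in> shift_set D U (- n)" "X \<in> shift_set D V n"
      using b unfolding bounded_t_structure_def by blast
    show "\<exists>n. (sh ^^ n) X \<in> U"
    proof (cases "n \<le> 0")
      case True
      then obtain A where "A \<in> U" "X \<simeq> (sh ^^ nat (- n)) A"
        using n(1) unfolding shift_set_def by auto
      then have "X \<in> U" using U_iso U_sh_pow iso_sym by blast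
      then have "(sh ^^ 0) X \<in> U" by simp
      then show ?thesis by blast
    next
      case False
      then show ?thesis using n(1) unfolding shift_set_def by auto
    qed
    show "\<exists>n. \<forall>E\<in>U. hom_zero ((sh ^^ Suc n) E) X"
    proof (cases "n \<ge> 0")
      case True
      then obtain A where A: "A \<in> V" "X \<simeq> (sh ^^ nat n) A"
        using n(2) unfolding shift_set_def by auto
      have "hom_zero ((sh ^^ Suc (nat n)) E) X" if "E \<in> U" for E
        using hom_zero_iso_right[OF iso_sym[OF A(2)]] UV_orth[OF that A(1)]
          hom_zero_sh_pow[of "nat n" "sh E" A] by (simp add: sh_pow_sh)
      then show ?thesis by blast
    next
      case False
      then have "X \<in> V" using n(2) V_unsh_pow unfolding shift_set_def by auto
      then have "\<forall>E\<in>U. hom_zero ((sh ^^ Suc 0) E) X" using UV_orth by simp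
      then show ?thesis by blast
    qed
  qed
next
  assume "bounded_tstruct D U V"
  then interpret bounded_tstruct D U V .
  show "bounded_t_structure D U V"
    unfolding bounded_t_structure_def t_structure_iff
  proof (intro conjI allI)
    show "tstruct D U V" by unfold_locales
    fix X
    obtain k where k: "(sh ^^ k) X \<in> U" using bounded_above by blast
    obtain l where l: "\<forall>E\<in>U. hom_zero ((sh ^^ Suc l) E) X" using bounded_below by blast
    \<comment> \<open>One n has to serve both bounds, hence the sum; the successor keeps it
      positive, so that \<open>shift_set D U (- int n)\<close> is given by the branch for negative
      shifts.\<close>
    define n where "n = Suc (k + l)"
    obtain A where A: "X \<simeq> (sh ^^ n) A" using unshift_pow by blast
    have "(sh ^^ (Suc l)) ((sh ^^ k) X) \<in> U" using U_sh_pow[OF k] .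
    then have "(sh ^^ n) X \<in> U" unfolding n_def by (simp add: sh_pow_add add.commute)
    moreover have "A \<in> V"
      unfolding V_iff
    proof
      fix E assume "E \<in> U"
      then have "hom_zero ((sh ^^ Suc l) ((sh ^^ Suc k) E)) X" using l U_sh_pow by blast
      moreover have "(sh ^^ Suc l) ((sh ^^ Suc k) E) = (sh ^^ n) (sh E)"
        unfolding n_def
        by (simp add: sh_pow_sh sh_pow_add add.commute)
      ultimately have "hom_zero ((sh ^^ n) (sh E)) ((sh ^^ n) A)"
        using hom_zero_iso_right[OF A] by simp
      then show "hom_zero (sh E) A" using hom_zero_sh_pow by blast
    qed
    moreover have "n > 0" by (simp add: n_def)
    ultimately have "X \<in> shift_set D V (int n)" "X \<in> shift_set D U (- int n)"
      using A unfolding shift_set_nonneg by (auto simp: shift_set_def)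
    then show "\<exists>n. X \<in> shift_set D U (- n) \<inter> shift_set D V n" by blast
  qed
qed

lemma bounded_heart_iff: "bounded_heart D K \<longleftrightarrow> (\<exists>U V. bounded_tstruct D U V \<and> K = U \<inter> V)"
  unfolding bounded_heart_def bounded_t_structure_iff ..

lemma heart_ge_iff:
  "heart_ge D K H \<longleftrightarrow> (\<forall>m>0. \<forall>X\<in>K. \<forall>Y\<in>H. hom_zero ((sh ^^ m) X) Y)"
proof
  assume h: "heart_ge D K H"
  show "\<forall>m>0. \<forall>X\<in>K. \<forall>Y\<in>H. hom_zero ((sh ^^ m) X) Y"
  proof (intro allI ballI impI)
    fix m :: nat and X Y assume m: "m > 0" "X \<in> K" "Y \<in> H"
    then have "(sh ^^ m) X \<in> shift_set D K (int m)"
      unfolding shift_set_nonneg using iso_refl by blast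
    then show "hom_zero ((sh ^^ m) X) Y"
      using h[unfolded heart_ge_def hom_vanish_def, rule_format, of "int m" "(sh ^^ m) X" Y] m
      unfolding hom_zero_def by simp
  qed
next
  assume *: "\<forall>m>0. \<forall>X\<in>K. \<forall>Y\<in>H. hom_zero ((sh ^^ m) X) Y"
  show "heart_ge D K H"
    unfolding heart_ge_def hom_vanish_def hom_zero_def[symmetric]
  proof (intro allI ballI impI)
    fix n :: int and X Y assume n: "0 < n" and X: "X \<in> shift_set D K n" and Y: "Y \<in> H"
    then obtain A where "A \<in> K" "X \<simeq> (sh ^^ nat n) A" unfolding shift_set_def by auto
    then show "hom_zero X Y" using * n Y hom_zero_iso_left iso_sym by (metis zero_less_nat_eq)
  qed
qed

lemma heart_ge_shift_iff:
  "heart_ge D (shift_set D H 1) K \<longleftrightarrow> (\<forall>m>0. \<forall>X\<in>H. \<forall>Y\<in>K. hom_zero ((sh ^^ m) (sh X)) Y)"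
proof -
  have "shift_set D H 1 = {X. \<exists>A\<in>H. X \<simeq> sh A}" unfolding shift_set_def by simp
  then have "(\<forall>X\<in>shift_set D H 1. hom_zero ((sh ^^ m) X) Y) \<longleftrightarrow>
      (\<forall>X\<in>H. hom_zero ((sh ^^ m) (sh X)) Y)" for m Y
    using iso_refl hom_zero_iso_left[OF iso_sym[OF iso_sh_pow]] by blast
  then show ?thesis unfolding heart_ge_iff by blast
qed

text \<open>Vanishing of Hom between positive shifts of heart objects spreads by two devissages, one
  in the target and one in the source, to the whole aisle and coaisle. Since an aisle is the
  orthogonal of its coaisle, that is an inclusion of aisles.\<close>

lemma between_hearts_iff:
  assumes b: "bounded_tstruct D U V" and b': "bounded_tstruct D U' V'"
  shows "heart_ge D (shift_set D (U \<inter> V) 1) (U' \<inter> V') \<and> heart_ge D (U' \<inter> V') (U \<inter> V) \<longleftrightarrow>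
    (\<forall>X\<in>U. sh X \<in> U') \<and> U' \<subseteq> U" (is "?L1 \<and> ?L2 \<longleftrightarrow> ?R1 \<and> ?R2")
proof -
  interpret t: bounded_tstruct D U V by fact
  interpret t': bounded_tstruct D U' V' by fact
  have "?R2" if h: ?L2
  proof
    fix X assume X: "X \<in> U'"
    have "hom_zero (sh X) Y" if Y: "Y \<in> V" for Y
    proof (rule t'.orth_U_if_heart_orth[OF _ X])
      fix m W assume mW: "m > (0::nat)" "W \<in> U' \<inter> V'"
      obtain l where l: "m = Suc l" using mW gr0_conv_Suc by blast
      have "hom_zero (sh ((sh ^^ l) W)) Y"
      proof (rule t.orth_V_if_orth_heart[OF _ Y])
        fix k Z assume "k > (0::nat)" "Z \<in> U \<inter> V"
        then have "hom_zero ((sh ^^ (k + l)) W) Z" using h mW unfolding heart_ge_iff by simp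
        then show "hom_zero ((sh ^^ k) ((sh ^^ l) W)) Z" by (simp add: sh_pow_add)
      qed
      then show "hom_zero ((sh ^^ m) W) Y" using l by simp
    qed
    then show "X \<in> U" unfolding t.U_iff by blast
  qed
  moreover have "?R1" if h: ?L1
  proof
    fix X assume X: "X \<in> U"
    have "hom_zero (sh (sh X)) Y" if Y: "Y \<in> V'" for Y
    proof -
      \<comment> \<open>One of the two shifts is moved to the target, because the devissage concerns
        Hom(X[1], -).\<close>
      obtain Y' where Y': "sh Y' \<simeq> Y" by (rule unshift)
      have "hom_zero (sh X) Y'"
      proof (rule t.orth_U_if_heart_orth[OF _ X])
        fix m W assume mW: "m > (0::nat)" "W \<in> U \<inter> V"
        have "hom_zero (sh ((sh ^^ m) W)) Y"
        proof (rule t'.orth_V_if_orth_heart[OF _ Y])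
          fix k Z assume k: "k > (0::nat)" "Z \<in> U' \<inter> V'"
          obtain l where l: "m = Suc l" using mW gr0_conv_Suc by blast
          have "hom_zero ((sh ^^ (k + l)) (sh W)) Z"
            using h mW k unfolding heart_ge_shift_iff by simp
          then show "hom_zero ((sh ^^ k) ((sh ^^ m) W)) Z"
            unfolding l by (simp add: sh_pow_add sh_pow_sh)
        qed
        then show "hom_zero ((sh ^^ m) W) Y'"
          using hom_zero_iso_right[OF iso_sym[OF Y']] hom_zero_sh by blast
      qed
      then show ?thesis using hom_zero_sh hom_zero_iso_right[OF Y'] by blast
    qed
    then show "sh X \<in> U'" unfolding t'.U_iff by blast
  qed
  moreover have "?L1" if ?R1
    unfolding heart_ge_shift_iff
  proof (intro allI ballI impI)
    fix m X Y assume *: "m > (0::nat)" "X \<in> U \<inter> V" "Y \<in> U' \<inter> V'"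
    then obtain l where "m = Suc l" using gr0_conv_Suc by blast
    then show "hom_zero ((sh ^^ m) (sh X)) Y"
      using * that t'.UV_orth t'.U_sh_pow by simp
  qed
  moreover have "?L2" if ?R2
    unfolding heart_ge_iff
  proof (intro allI ballI impI)
    fix m X Y assume *: "m > (0::nat)" "X \<in> U' \<inter> V'" "Y \<in> U \<inter> V"
    then obtain l where "m = Suc l" using gr0_conv_Suc by blast
    then show "hom_zero ((sh ^^ m) X) Y"
      using * that t.UV_orth t.U_sh_pow by auto
  qed
  ultimately show ?thesis by blast
qed

end

section \<open>Torsion pairs and tilting\<close>

context triangulated_category
begin

text \<open>For a heart H this is the usual notion: the triangles with all terms in H are its short
  exact sequences.\<close>

definition torsion_pair where
  "torsion_pair H T F \<longleftrightarrow> T \<subseteq> H \<and> F \<subseteq> H \<and>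
     (\<forall>X\<in>T. \<forall>Y. X \<simeq> Y \<longrightarrow> Y \<in> T) \<and> (\<forall>X\<in>F. \<forall>Y. X \<simeq> Y \<longrightarrow> Y \<in> F) \<and>
     (\<forall>X\<in>T. \<forall>Y\<in>F. hom_zero X Y) \<and> (\<forall>X\<in>H. \<exists>A\<in>T. \<exists>B\<in>F. tri A X B)"

end

context tstruct
begin

lemma torsion_left_iff:
  assumes "torsion_pair (U \<inter> V) T F"
  shows "X \<in> T \<longleftrightarrow> X \<in> U \<inter> V \<and> (\<forall>Y\<in>F. hom_zero X Y)"
proof
  assume *: "X \<in> U \<inter> V \<and> (\<forall>Y\<in>F. hom_zero X Y)"
  then obtain A B where AB: "A \<in> T" "B \<in> F" "tri A X B"
    using assms unfolding torsion_pair_def by blast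
  then have "A \<in> U" "B \<in> V" using assms unfolding torsion_pair_def by auto
  then have "hom_zero B B" using hom_zero_cone[OF AB(3)] * AB UV_orth by blast
  then have "A \<simeq> X" using tri_zero3_iso[OF AB(3)] by blast
  then show "X \<in> T" using AB assms unfolding torsion_pair_def by blast
qed (use assms in \<open>auto simp: torsion_pair_def\<close>)

lemma torsion_right_iff:
  assumes "torsion_pair (U \<inter> V) T F"
  shows "Y \<in> F \<longleftrightarrow> Y \<in> U \<inter> V \<and> (\<forall>X\<in>T. hom_zero X Y)"
proof
  assume *: "Y \<in> U \<inter> V \<and> (\<forall>X\<in>T. hom_zero X Y)"
  then obtain A B where AB: "A \<in> T" "B \<in> F" "tri A Y B"
    using assms unfolding torsion_pair_def by blast
  then have "A \<in> U" "B \<in> V" using assms unfolding torsion_pair_def by auto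
  then have "hom_zero A A" using hom_zero_fibre[OF AB(3)] * AB UV_orth by blast
  then have "Y \<simeq> B" using tri_zero1_iso[OF AB(3)] by blast
  then show "Y \<in> F" using AB assms iso_sym unfolding torsion_pair_def by blast
qed (use assms in \<open>auto simp: torsion_pair_def\<close>)

text \<open>Truncation with respect to the second t-structure does not leave the heart: U[1]
  \<subseteq> U' forces B into V, hence also the fibre A; U' \<subseteq> U puts A into U, hence also
  the cone B.\<close>

lemma torsion_pair_of_tilt:
  assumes "tstruct D U' V'" and sU: "\<forall>X\<in>U. sh X \<in> U'" and U': "U' \<subseteq> U"
  shows "torsion_pair (U \<inter> V) (U \<inter> V \<inter> U') {Y \<in> U \<inter> V. sh Y \<in> V'}"
proof -
  interpret t': tstruct D U' V' by fact
  have "\<exists>A\<in>U \<inter> V \<inter> U'. \<exists>B\<in>{Y \<in> U \<inter> V. sh Y \<in> V'}. tri A X B" if X: "X \<in> U" "X \<in> V" for X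
  proof -
    obtain A B where AB: "A \<in> U'" "sh B \<in> V'" "tri A X B" using t'.truncation_unshifted by blast
    have B: "B \<in> V" unfolding V_iff using sU AB(2) t'.UV_orth hom_zero_sh by blast
    have A: "A \<in> V" using V_fibre[OF AB(3) X(2) B] .
    have "B \<in> U" using U_cone[OF AB(3)] AB(1) U' X by blast
    then show ?thesis using A B AB U' by blast
  qed
  moreover have "hom_zero X Y" if "X \<in> U'" "sh Y \<in> V'" for X Y
    using t'.UV_orth[OF that] hom_zero_sh by blast
  moreover have "sh X \<in> V' \<Longrightarrow> X \<simeq> Y \<Longrightarrow> sh Y \<in> V'" for X Y
    using t'.V_iso iso_sh by blast
  ultimately show ?thesis
    unfolding torsion_pair_def using t'.U_iso U_iso V_iso by auto
qed

text \<open>Both the torsion class and the shift of the torsion-free class lie in the tilted heart,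
  and \<psi> changes sign under the shift. Conversely, in the truncation A[1] -> X -> B with respect
  to the original t-structure, B turns out torsion and A torsion-free.\<close>

lemma tilt_nonneg_iff:
  fixes \<psi> :: "_ \<Rightarrow> real"
  assumes "tstruct D U' V'" and sU: "\<forall>X\<in>U. sh X \<in> U'" and U': "U' \<subseteq> U"
    and \<psi>: "additive_on_triangles \<psi>"
  shows "(\<forall>X\<in>U' \<inter> V'. 0 \<le> \<psi> X) \<longleftrightarrow>
    (\<forall>X\<in>U \<inter> V \<inter> U'. 0 \<le> \<psi> X) \<and> (\<forall>Y\<in>{Y \<in> U \<inter> V. sh Y \<in> V'}. \<psi> Y \<le> 0)"
proof -
  interpret t': tstruct D U' V' by fact
  have VV': "V \<subseteq> V'" using t'.V_iff UV_orth U' by blast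
  show ?thesis
  proof
    assume *: "\<forall>X\<in>U' \<inter> V'. 0 \<le> \<psi> X"
    have "\<psi> Y \<le> 0" if "Y \<in> U" "sh Y \<in> V'" for Y
      using * sU that additive_sh[OF \<psi>, of Y] by force
    then show "(\<forall>X\<in>U \<inter> V \<inter> U'. 0 \<le> \<psi> X) \<and> (\<forall>Y\<in>{Y \<in> U \<inter> V. sh Y \<in> V'}. \<psi> Y \<le> 0)"
      using * VV' by auto
  next
    assume *: "(\<forall>X\<in>U \<inter> V \<inter> U'. 0 \<le> \<psi> X) \<and> (\<forall>Y\<in>{Y \<in> U \<inter> V. sh Y \<in> V'}. \<psi> Y \<le> 0)"
    show "\<forall>X\<in>U' \<inter> V'. 0 \<le> \<psi> X"
    proof
      fix X assume X: "X \<in> U' \<inter> V'"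
      obtain A B where AB: "A \<in> U" "B \<in> V" "tri (sh A) X B" using truncation by blast
      have "B \<in> U'" using t'.U_cone[OF AB(3)] sU AB X by blast
      then have B: "0 \<le> \<psi> B" using * AB U' by blast
      have sA: "sh A \<in> V'" using t'.V_fibre[OF AB(3)] X AB VV' by blast
      then have "A \<in> V" unfolding V_iff using t'.UV_orth sU hom_zero_sh by blast
      then have "\<psi> A \<le> 0" using * AB sA by blast
      then show "0 \<le> \<psi> X" using B additive_tri[OF \<psi> AB(3)] additive_sh[OF \<psi>, of A] by simp
    qed
  qed
qed

end

text \<open>The Happel-Reiten-Smalo tilt, inverse to the passage from intermediate t-structures to
  torsion pairs.\<close>

lemma (in bounded_tstruct) tilt_exists:
  assumes tp: "torsion_pair (U \<inter> V) T F"
  obtains U' V' where "bounded_tstruct D U' V'" "\<forall>X\<in>U. sh X \<in> U'" "U' \<subseteq> U"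
    "U \<inter> V \<inter> U' = T" "{Y \<in> U \<inter> V. sh Y \<in> V'} = F"
proof -
  \<comment> \<open>An object of U belongs to \<open>U'\<close> when its zeroth cohomology is
    torsion, that is, when it has no maps to F. The class \<open>V'\<close> is the orthogonal of
    U[2] and T[1], from which the shift of \<open>U'\<close> is built by extensions.\<close>
  define U' where "U' = {X \<in> U. \<forall>Y\<in>F. hom_zero X Y}"
  define V' where "V' = {Y. (\<forall>X\<in>U. hom_zero (sh (sh X)) Y) \<and> (\<forall>X\<in>T. hom_zero (sh X) Y)}"
  have T: "T \<subseteq> U" "T \<subseteq> V" and F: "F \<subseteq> U" "F \<subseteq> V"
    using tp unfolding torsion_pair_def by auto
  have TF: "hom_zero X Y" if "X \<in> T" "Y \<in> F" for X Y
    using tp that unfolding torsion_pair_def by blast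
  have sU: "\<forall>X\<in>U. sh X \<in> U'" unfolding U'_def using U_sh UV_orth F by blast
  have "bounded_tstruct D U' V'"
  proof unfold_locales
    show "Y \<in> U'" if "X \<in> U'" "X \<simeq> Y" for X Y
      using that U_iso hom_zero_iso_left unfolding U'_def by blast
    show "Y \<in> V'" if "X \<in> V'" "X \<simeq> Y" for X Y
      using that hom_zero_iso_right unfolding V'_def by blast
    show "sh X \<in> U'" if "X \<in> U'" for X
      using that sU unfolding U'_def by blast
    show "X \<in> V'" if "sh X \<in> V'" for X
      using that U_sh T hom_zero_sh unfolding V'_def by blast
    show "hom_zero (sh X) Y" if X: "X \<in> U'" and Y: "Y \<in> V'" for X Y
    proof -
      \<comment> \<open>B is the zeroth cohomology of X and inherits from X the absence of maps to
        F, so it is torsion. Then X[1] is an extension of B[1] by A[2], and Y is orthogonal to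
        both.\<close>
      obtain A B where AB: "A \<in> U" "B \<in> V" "tri (sh A) X B" using truncation by blast
      have "B \<in> U" using U_cone[OF AB(3)] U_sh AB X unfolding U'_def by blast
      moreover have "hom_zero B Z" if "Z \<in> F" for Z
        using hom_zero_mid_left[OF tri_rot[OF AB(3)]] X UV_orth[OF U_sh[OF AB(1)]] F that
        unfolding U'_def by blast
      ultimately have "B \<in> T" using torsion_left_iff[OF tp] AB by blast
      then show ?thesis
        using hom_zero_mid_left[of "sh (sh A)" "sh X" "sh B" Y] AB tri_sh Y unfolding V'_def by blast
    qed
    show "\<exists>X\<in>U'. \<exists>Y\<in>V'. tri (sh X) Z Y" for Z
    proof -
      obtain A B where AB: "A \<in> U" "B \<in> V" "tri (sh A) Z B" using truncation by blast
      obtain A' X where AX: "A' \<in> U" "X \<in> V" "tri (sh A') A X" using truncation by blast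
      have "X \<in> U" using U_cone[OF AX(3)] U_sh AB AX by blast
      then obtain T0 F0 where TF0: "T0 \<in> T" "F0 \<in> F" "tri T0 X F0"
        using tp AX unfolding torsion_pair_def by blast
      \<comment> \<open>P is the preimage in A of the torsion part T0 of X, the zeroth cohomology of
        A. The torsion-free quotient F0 moves to the other side: W is an extension of B by
        F0[1].\<close>
      obtain P where P: "tri P A F0" "tri (sh A') P T0"
        using tri_assoc_left[OF AX(3) TF0(3)] by blast
      obtain W where W: "tri (sh P) Z W" "tri (sh F0) W B"
        using tri_assoc_right[OF _ AB(3), of "sh P" "sh F0"] P(1) tri_sh by blast
      have "P \<in> U" using U_ext[OF P(2)] U_sh AX TF0 T by blast
      moreover have "hom_zero P Y" if "Y \<in> F" for Y
        using hom_zero_mid_left[OF P(2)] UV_orth[OF AX(1)] TF TF0 F that by blast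
      ultimately have "P \<in> U'" unfolding U'_def by blast
      moreover have "hom_zero (sh (sh X)) W" if "X \<in> U" for X
        using hom_zero_mid_right[OF W(2)] UV_orth[OF that] UV_orth[OF U_sh[OF that]] hom_zero_sh
          TF0 F AB by blast
      moreover have "hom_zero (sh X) W" if "X \<in> T" for X
        using hom_zero_mid_right[OF W(2)] TF[OF that] UV_orth hom_zero_sh TF0 T that AB by blast
      ultimately show ?thesis using W unfolding V'_def by blast
    qed
    show "\<exists>n. (sh ^^ n) X \<in> U'" for X
    proof -
      obtain n where "(sh ^^ n) X \<in> U" using bounded_above by blast
      then have "(sh ^^ Suc n) X \<in> U'" using sU by simp
      then show ?thesis by blast
    qed
    show "\<exists>n. \<forall>E\<in>U'. hom_zero ((sh ^^ Suc n) E) X" for X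
      using bounded_below unfolding U'_def by blast
  qed
  moreover have "U' \<subseteq> U" unfolding U'_def by blast
  moreover have "U \<inter> V \<inter> U' = T" unfolding U'_def using torsion_left_iff[OF tp] by blast
  moreover have "{Y \<in> U \<inter> V. sh Y \<in> V'} = F"
    unfolding V'_def using torsion_right_iff[OF tp] UV_orth hom_zero_sh by blast
  ultimately show thesis using that sU by blast
qed

section \<open>Faces, fans and dual cones\<close>

lemma cone_face_refl: "convex_cone \<sigma> \<Longrightarrow> cone_face \<sigma> \<sigma>"
  unfolding cone_face_def using convex_cone_add convex_cone_nonempty by blast

lemma cone_face_trans: "cone_face \<rho> \<tau> \<Longrightarrow> cone_face \<tau> \<sigma> \<Longrightarrow> cone_face \<rho> \<sigma>"
  unfolding cone_face_def by blast

lemma cone_face_convex_cone: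
  assumes "convex_cone \<sigma>" "cone_face \<tau> \<sigma>" shows "convex_cone \<tau>"
  unfolding convex_cone_iff
proof (intro conjI ballI allI impI)
  have add: "a + b \<in> \<tau> \<longleftrightarrow> a \<in> \<tau> \<and> b \<in> \<tau>" if "a \<in> \<sigma>" "b \<in> \<sigma>" for a b
    using assms(2) that unfolding cone_face_def by blast
  have sub: "\<tau> \<subseteq> \<sigma>" using assms(2) unfolding cone_face_def by blast
  obtain x where "x \<in> \<tau>" using assms(2) unfolding cone_face_def by blast
  then show z: "0 \<in> \<tau>" using add[of 0 x] sub convex_cone_contains_0[OF assms(1)] by auto
  show "x + y \<in> \<tau>" if "x \<in> \<tau>" "y \<in> \<tau>" for x y using add that sub by blast
  show "c *\<^sub>R x \<in> \<tau>" if x: "x \<in> \<tau>" and c: "0 \<le> c" for x and c :: real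
  proof -
    \<comment> \<open>Closure under real scalars comes from the face condition: n x is a sum of
      copies of x, and it splits inside \<sigma> as c x + (n - c) x.\<close>
    obtain n :: nat where n: "c \<le> real n" using real_arch_simple by blast
    have "real m *\<^sub>R x \<in> \<tau>" for m
    proof (induction m)
      case (Suc m)
      then show ?case using add[of "real m *\<^sub>R x" x] x sub by (auto simp: algebra_simps)
    qed (use z in simp)
    then have "c *\<^sub>R x + (real n - c) *\<^sub>R x \<in> \<tau>" by (simp flip: scaleR_add_left)
    then show ?thesis
      using add[of "c *\<^sub>R x" "(real n - c) *\<^sub>R x"] convex_cone_scaleR[OF assms(1)] x c n sub by auto
  qed
qed

text \<open>For faces of the generating cones the condition is checked in two stages: that of
  \<open>\<sigma> \<inter> \<tau>\<close> in \<sigma>, then that of \<open>\<tau>'\<close> in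
  \<tau>. One-sided faces suffice in the assumption, as the two cones can be exchanged.\<close>

lemma is_fan_Union_Faces:
  assumes cc: "\<And>\<sigma>. \<sigma> \<in> \<C> \<Longrightarrow> convex_cone \<sigma>"
    and int: "\<And>\<sigma> \<tau>. \<sigma> \<in> \<C> \<Longrightarrow> \<tau> \<in> \<C> \<Longrightarrow> cone_face (\<sigma> \<inter> \<tau>) \<sigma>"
  shows "is_fan (\<Union>\<sigma>\<in>\<C>. Faces \<sigma>)"
proof -
  have inter: "cone_face (\<sigma>' \<inter> \<tau>') \<sigma>'"
    if s: "\<sigma> \<in> \<C>" "cone_face \<sigma>' \<sigma>" and t: "\<tau> \<in> \<C>" "cone_face \<tau>' \<tau>" for \<sigma> \<tau> \<sigma>' \<tau>'
  proof -
    have "0 \<in> \<sigma>' \<inter> \<tau>'"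
      using cone_face_convex_cone s t cc convex_cone_contains_0 by blast
    moreover have "a + b \<in> \<sigma>' \<inter> \<tau>' \<longleftrightarrow> a \<in> \<sigma>' \<inter> \<tau>' \<and> b \<in> \<sigma>' \<inter> \<tau>'" if ab: "a \<in> \<sigma>'" "b \<in> \<sigma>'" for a b
    proof -
      have sub: "\<sigma>' \<subseteq> \<sigma>" "\<tau>' \<subseteq> \<tau>" using s t unfolding cone_face_def by blast+
      then have "a + b \<in> \<sigma> \<inter> \<tau> \<longleftrightarrow> a \<in> \<tau> \<and> b \<in> \<tau>"
        using int[OF s(1) t(1)] ab unfolding cone_face_def by blast
      moreover have "a + b \<in> \<sigma>'" using s(2) ab sub unfolding cone_face_def by blast
      moreover have "a + b \<in> \<tau>' \<longleftrightarrow> a \<in> \<tau>' \<and> b \<in> \<tau>'" if "a \<in> \<tau>" "b \<in> \<tau>"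
        using t(2) that unfolding cone_face_def by blast
      ultimately show ?thesis using ab sub by blast
    qed
    ultimately show ?thesis unfolding cone_face_def by blast
  qed
  show ?thesis
    unfolding is_fan_def Faces_def
  proof (intro conjI ballI)
    fix \<sigma>' assume "\<sigma>' \<in> (\<Union>\<sigma>\<in>\<C>. {\<tau>. cone_face \<tau> \<sigma>})"
    then obtain \<sigma> where s: "\<sigma> \<in> \<C>" "cone_face \<sigma>' \<sigma>" by blast
    show "convex_cone \<sigma>'" using cone_face_convex_cone[OF cc] s by blast
    show "{\<tau>. cone_face \<tau> \<sigma>'} \<subseteq> (\<Union>\<sigma>\<in>\<C>. {\<tau>. cone_face \<tau> \<sigma>})"
      using s cone_face_trans by blast
    fix \<tau>' assume "\<tau>' \<in> (\<Union>\<sigma>\<in>\<C>. {\<tau>. cone_face \<tau> \<sigma>})"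
    then obtain \<tau> where t: "\<tau> \<in> \<C>" "cone_face \<tau>' \<tau>" by blast
    show "cone_face (\<sigma>' \<inter> \<tau>') \<sigma>'" using inter[OF s t] .
    show "cone_face (\<sigma>' \<inter> \<tau>') \<tau>'" using inter[OF t s] by (simp add: Int_commute)
  qed
qed

section \<open>The pairing, dual cones and cofaces\<close>

lemma eval_dual_add: "eval_dual v (a + b) = eval_dual v a + eval_dual v b"
  using eval_dual[of v] by (simp add: additive_def)

lemma pairing_add_left: "pairing (v + w) x = pairing v x + pairing w x"
  by transfer (simp add: formal_eval_def sum.distrib algebra_simps)

lemma pairing_diff_right: "pairing v (x - y) = pairing v x - pairing v y"
  by transfer (simp add: formal_eval_diff)

lemma pairing_zero_right: "pairing v 0 = 0"
  using pairing_diff_right[of v 0 0] by simp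

lemma pairing_add_right: "pairing v (x + y) = pairing v x + pairing v y"
  using pairing_diff_right[of v "x + y" y] by simp

lemma pairing_scaleR_left: "pairing (r *\<^sub>R v) x = r * pairing v x"
  by transfer (simp add: formal_eval_def sum_distrib_left algebra_simps)

lemma formal_eval_scale: "formal_eval v (formal_scale r p) = r * formal_eval v p"
proof -
  have "Poly_Mapping.keys (formal_scale r p) \<subseteq> Poly_Mapping.keys p"
    by (auto simp: in_keys_iff)
  then show ?thesis
    by (simp add: formal_eval_superset[of "Poly_Mapping.keys p"] sum_distrib_left algebra_simps)
qed

lemma pairing_scaleR_right: "pairing v (r *\<^sub>R x) = r * pairing v x"
  by transfer (rule formal_eval_scale)

lemma convex_cone_dual_cone: "convex_cone (dual_cone \<sigma>)"
proof -
  have "pairing 0 x = 0" for x :: "'a tensor_real" using pairing_scaleR_left[of 0 0 x] by simp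
  then show ?thesis
    unfolding convex_cone_iff dual_cone_def by (simp add: pairing_add_left pairing_scaleR_left)
qed

lemma dual_cone_hull: "dual_cone (convex_cone hull S) = dual_cone S"
proof -
  have "pairing v x \<ge> 0" if "v \<in> dual_cone S" "x \<in> convex_cone hull S" for v x
  proof -
    have "convex_cone {x. pairing v x \<ge> 0}"
      unfolding convex_cone_iff by (simp add: pairing_add_right pairing_scaleR_right pairing_zero_right)
    moreover have "S \<subseteq> {x. pairing v x \<ge> 0}" using that unfolding dual_cone_def by blast
    ultimately show ?thesis using that(2) hull_minimal[of S] by blast
  qed
  then show ?thesis using hull_subset[of S convex_cone] unfolding dual_cone_def by blast
qed

text \<open>Since 0 lies in both cones, a functional is nonnegative on \<sigma> - \<kappa> exactly
  when it is nonnegative on \<sigma> and vanishes on \<kappa>. Vanishing on \<kappa> cuts out a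
  face, because a sum of nonnegative numbers is zero only if both are.\<close>

lemma cone_face_dual_coface:
  assumes "convex_cone \<sigma>" "\<rho> \<in> cofaces \<sigma>"
  shows "cone_face (dual_cone \<rho>) (dual_cone \<sigma>)"
proof -
  obtain \<kappa> where k: "convex_cone \<kappa>" "\<kappa> \<subseteq> \<sigma>" "\<rho> = {s - k | s k. s \<in> \<sigma> \<and> k \<in> \<kappa>}"
    using assms(2) unfolding cofaces_def by blast
  have 0: "0 \<in> \<sigma>" "0 \<in> \<kappa>" using assms(1) k(1) convex_cone_contains_0 by blast+
  have eq: "dual_cone \<rho> = {v \<in> dual_cone \<sigma>. \<forall>x\<in>\<kappa>. pairing v x = 0}"
  proof (intro equalityI subsetI)
    fix v assume "v \<in> dual_cone \<rho>"
    then have v: "pairing v s - pairing v k \<ge> 0" if "s \<in> \<sigma>" "k \<in> \<kappa>" for s k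
      using that unfolding dual_cone_def k(3) by (force simp flip: pairing_diff_right)
    have "pairing v s \<ge> 0" if "s \<in> \<sigma>" for s using v[OF that 0(2)] by (simp add: pairing_zero_right)
    moreover have "pairing v x \<le> 0" if "x \<in> \<kappa>" for x
      using v[OF 0(1) that] by (simp add: pairing_zero_right)
    ultimately show "v \<in> {v \<in> dual_cone \<sigma>. \<forall>x\<in>\<kappa>. pairing v x = 0}"
      using k(2) unfolding dual_cone_def by (auto intro: antisym)
  qed (auto simp: dual_cone_def k(3) pairing_diff_right)
  show ?thesis
    unfolding cone_face_def
  proof (intro conjI ballI)
    show "dual_cone \<rho> \<noteq> {}" using convex_cone_dual_cone convex_cone_nonempty by blast
    show "dual_cone \<rho> \<subseteq> dual_cone \<sigma>" using eq by blast
    fix a b assume ab: "a \<in> dual_cone \<sigma>" "b \<in> dual_cone \<sigma>"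
    have "pairing a x + pairing b x = 0 \<longleftrightarrow> pairing a x = 0 \<and> pairing b x = 0" if "x \<in> \<kappa>" for x
      using ab that k(2) unfolding dual_cone_def by (simp add: add_nonneg_eq_0_iff subset_eq)
    moreover have "a + b \<in> dual_cone \<sigma>"
      using ab convex_cone_add[OF convex_cone_dual_cone] by blast
    ultimately show "a + b \<in> dual_cone \<rho> \<longleftrightarrow> a \<in> dual_cone \<rho> \<and> b \<in> dual_cone \<rho>"
      using ab unfolding eq by (auto simp: pairing_add_left)
  qed
qed

lemma self_in_cofaces: "convex_cone \<sigma> \<Longrightarrow> \<sigma> \<in> cofaces \<sigma>"
  unfolding cofaces_def using convex_cone_contains_0
  by (auto intro!: exI[of _ "{0}"])

text \<open>A cone is its own coface, for the subcone {0}, and the duals of all its cofaces are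
  faces of its dual, so no new cones arise.\<close>

lemma Union_Faces_dual_cofaces:
  assumes "\<And>\<sigma>. \<sigma> \<in> \<C> \<Longrightarrow> convex_cone \<sigma>"
  shows "(\<Union>\<rho>\<in>(\<Union>\<sigma>\<in>\<C>. cofaces \<sigma>). Faces (dual_cone \<rho>)) = (\<Union>\<sigma>\<in>\<C>. Faces (dual_cone \<sigma>))"
  unfolding Faces_def
  using assms self_in_cofaces cone_face_dual_coface cone_face_trans by fast

section \<open>The heart fan in terms of torsion pairs\<close>

definition torsion_cone :: "('o \<Rightarrow> 'l::ab_group_add) \<Rightarrow> 'o set \<Rightarrow> 'o set \<Rightarrow> 'l real_dual set" where
  "torsion_cone \<phi> T F =
     {v. (\<forall>X\<in>T. 0 \<le> eval_dual v (\<phi> X)) \<and> (\<forall>Y\<in>F. eval_dual v (\<phi> Y) \<le> 0)}"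

lemma convex_cone_torsion_cone: "convex_cone (torsion_cone \<phi> T F)"
  unfolding convex_cone_iff torsion_cone_def
  by (auto simp: zero_real_dual.rep_eq plus_real_dual.rep_eq scaleR_real_dual.rep_eq
      mult_nonneg_nonpos intro: add_nonneg_nonneg add_nonpos_nonpos)

text \<open>Only sets of values in the group matter, which permits comparison of torsion pairs in
  different categories.\<close>

lemma torsion_cone_cong:
  assumes "\<phi> ` T = \<phi>' ` T'" "\<phi> ` F = \<phi>' ` F'"
  shows "torsion_cone \<phi> T F = torsion_cone \<phi>' T' F'"
proof -
  have "torsion_cone \<phi> T F =
      {v. (\<forall>l\<in>\<phi> ` T. 0 \<le> eval_dual v l) \<and> (\<forall>l\<in>\<phi> ` F. eval_dual v l \<le> 0)}"
    unfolding torsion_cone_def by simp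
  moreover have "torsion_cone \<phi>' T' F' =
      {v. (\<forall>l\<in>\<phi>' ` T'. 0 \<le> eval_dual v l) \<and> (\<forall>l\<in>\<phi>' ` F'. eval_dual v l \<le> 0)}"
    unfolding torsion_cone_def by simp
  ultimately show ?thesis using assms by simp
qed

context triangulated_category
begin

lemma heart_cone_eq_dual: "heart_cone D lam K = dual_cone (effective_cone D lam K)"
  unfolding effective_cone_def dual_cone_hull
  by (auto simp: heart_cone_def dual_cone_def pairing_tensor_one)

lemma heart_fan_eq_cofan:
  "heart_fan D lam H = (\<Union>\<sigma>\<in>real_heart_cofan D lam H. Faces (dual_cone \<sigma>))"
proof -
  have "(\<Union>\<sigma>\<in>real_heart_cofan D lam H. Faces (dual_cone \<sigma>)) =
    (\<Union>\<rho>\<in>(\<Union>\<sigma>\<in>effective_cone D lam ` intermediate_hearts D H. cofaces \<sigma>). Faces (dual_cone \<rho>))"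
    unfolding real_heart_cofan_def by simp
  also have "\<dots> = (\<Union>\<sigma>\<in>effective_cone D lam ` intermediate_hearts D H. Faces (dual_cone \<sigma>))"
    by (rule Union_Faces_dual_cofaces) (auto simp: effective_cone_def convex_cone_convex_cone_hull)
  finally show ?thesis unfolding heart_fan_def heart_cone_eq_dual by simp
qed

lemma additive_eval_dual:
  "additive_on_triangles \<phi> \<Longrightarrow> additive_on_triangles (\<lambda>X. eval_dual v (\<phi> X))"
  unfolding additive_on_triangles_def by (simp add: eval_dual_add)

lemma cone_face_torsion_cone:
  assumes \<phi>: "additive_on_triangles \<phi>" and t: "tstruct D U V"
    and tp: "torsion_pair (U \<inter> V) T F" and tp': "torsion_pair (U \<inter> V) T' F'"
  shows "cone_face (torsion_cone \<phi> T F \<inter> torsion_cone \<phi> T' F') (torsion_cone \<phi> T F)"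
proof -
  interpret tstruct D U V by fact
  let ?C = "torsion_cone \<phi> T F" and ?C' = "torsion_cone \<phi> T' F'"
  have H: "T \<subseteq> U \<inter> V" "F \<subseteq> U \<inter> V" "T' \<subseteq> U \<inter> V" "F' \<subseteq> U \<inter> V"
    using tp tp' unfolding torsion_pair_def by blast+
  have *: "a \<in> ?C'" if a: "a \<in> ?C" and b: "b \<in> ?C" and ab: "a + b \<in> ?C'" for a b
  proof -
    have vanish: "eval_dual a (\<phi> X) = 0" if X: "X \<in> T \<inter> F' \<or> X \<in> F \<inter> T'" for X
    proof -
      have "eval_dual a (\<phi> X) + eval_dual b (\<phi> X) = eval_dual (a + b) (\<phi> X)"
        by (simp add: plus_real_dual.rep_eq)
      then show ?thesis using X a b ab unfolding torsion_cone_def by fastforce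
    qed
    have "0 \<le> eval_dual a (\<phi> X)" if X: "X \<in> T'" for X
    proof -
      obtain A B where AB: "A \<in> T" "B \<in> F" "tri A X B"
        using tp X H unfolding torsion_pair_def by blast
      have "hom_zero B Y" if "Y \<in> F'" for Y
        using hom_zero_mid_left[OF tri_rot[OF AB(3)]] UV_orth AB H that X tp'
        unfolding torsion_pair_def by blast
      then have "B \<in> T'" using torsion_left_iff[OF tp'] AB H by blast
      then have "eval_dual a (\<phi> B) = 0" using vanish AB by blast
      moreover have "0 \<le> eval_dual a (\<phi> A)" using a AB unfolding torsion_cone_def by blast
      ultimately show ?thesis using additive_tri[OF \<phi> AB(3)] by (simp add: eval_dual_add)
    qed
    moreover have "eval_dual a (\<phi> X) \<le> 0" if X: "X \<in> F'" for X
    proof -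
      obtain A B where AB: "A \<in> T" "B \<in> F" "tri A X B"
        using tp X H unfolding torsion_pair_def by blast
      \<comment> \<open>The torsion part A of X is its subobject: maps from \<open>T'\<close> to A
        are caught between those to X and those to B[-1], both zero.\<close>
      obtain B' where B': "sh B' \<simeq> B" "tri B' A X" using AB(3) by (rule tri_unrotE)
      have "hom_zero Y A" if "Y \<in> T'" for Y
      proof -
        have "hom_zero (sh Y) B" using UV_orth that AB H by blast
        then have "hom_zero Y B'" using hom_zero_iso_right[OF iso_sym[OF B'(1)]] hom_zero_sh by blast
        moreover have "hom_zero Y X" using tp' that X unfolding torsion_pair_def by blast
        ultimately show ?thesis using hom_zero_mid_right[OF B'(2)] by blast
      qed
      then have "A \<in> F'" using torsion_right_iff[OF tp'] AB H by blast
      then have "eval_dual a (\<phi> A) = 0" using vanish AB by blast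
      moreover have "eval_dual a (\<phi> B) \<le> 0" using a AB unfolding torsion_cone_def by blast
      ultimately show ?thesis using additive_tri[OF \<phi> AB(3)] by (simp add: eval_dual_add)
    qed
    ultimately show ?thesis unfolding torsion_cone_def by blast
  qed
  have "0 \<in> ?C \<inter> ?C'" using convex_cone_torsion_cone convex_cone_contains_0 by blast
  moreover have "a + b \<in> ?C \<inter> ?C' \<longleftrightarrow> a \<in> ?C \<inter> ?C' \<and> b \<in> ?C \<inter> ?C'" if "a \<in> ?C" "b \<in> ?C" for a b
    using *[of a b] *[of b a] that convex_cone_add[OF convex_cone_torsion_cone]
    by (auto simp: add.commute)
  ultimately show ?thesis unfolding cone_face_def by blast
qed

text \<open>The right-hand side sees the ambient category only through vanishing of Hom,
  isomorphisms and triangles between objects of the heart. All but the cofan description start from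
  this form.\<close>

lemma heart_fan_eq_torsion_pairs:
  assumes lam: "lam \<in> hom (K0 D) additive_group" and t: "bounded_tstruct D U V"
  shows "heart_fan D lam (U \<inter> V) =
    (\<Union>\<sigma>\<in>{torsion_cone (\<lambda>X. lam (K0_class D X)) T F | T F. torsion_pair (U \<inter> V) T F}. Faces \<sigma>)"
proof -
  interpret bounded_tstruct D U V by fact
  let ?\<phi> = "\<lambda>X. lam (K0_class D X)"
  have cone: "heart_cone D lam (U' \<inter> V') = torsion_cone ?\<phi> (U \<inter> V \<inter> U') {Y \<in> U \<inter> V. sh Y \<in> V'}"
    if "tstruct D U' V'" "\<forall>X\<in>U. sh X \<in> U'" "U' \<subseteq> U" for U' V'
    unfolding heart_cone_def torsion_cone_def
    using tilt_nonneg_iff[OF that additive_eval_dual[OF additive_K0[OF lam]]] by blast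
  have "heart_cone D lam ` intermediate_hearts D (U \<inter> V) =
    {torsion_cone ?\<phi> T F | T F. torsion_pair (U \<inter> V) T F}"
  proof (intro equalityI subsetI)
    fix \<sigma> assume "\<sigma> \<in> heart_cone D lam ` intermediate_hearts D (U \<inter> V)"
    then obtain U' V' where b: "bounded_tstruct D U' V'" and s: "\<sigma> = heart_cone D lam (U' \<inter> V')"
      and "heart_ge D (shift_set D (U \<inter> V) 1) (U' \<inter> V')" "heart_ge D (U' \<inter> V') (U \<inter> V)"
      unfolding intermediate_hearts_def bounded_heart_iff by blast
    then have "\<forall>X\<in>U. sh X \<in> U'" "U' \<subseteq> U" using between_hearts_iff[OF t b] by blast+
    then show "\<sigma> \<in> {torsion_cone ?\<phi> T F | T F. torsion_pair (U \<inter> V) T F}"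
      using s cone torsion_pair_of_tilt b unfolding bounded_tstruct_def by blast
  next
    fix \<sigma> assume "\<sigma> \<in> {torsion_cone ?\<phi> T F | T F. torsion_pair (U \<inter> V) T F}"
    then obtain T F where s: "\<sigma> = torsion_cone ?\<phi> T F" and tp: "torsion_pair (U \<inter> V) T F" by blast
    obtain U' V' where b: "bounded_tstruct D U' V'" and u: "\<forall>X\<in>U. sh X \<in> U'" "U' \<subseteq> U"
      and TF: "U \<inter> V \<inter> U' = T" "{Y \<in> U \<inter> V. sh Y \<in> V'} = F"
      using tilt_exists[OF tp] by blast
    have "U' \<inter> V' \<in> intermediate_hearts D (U \<inter> V)"
      unfolding intermediate_hearts_def bounded_heart_iff using b u between_hearts_iff[OF t b] by blast
    moreover have "tstruct D U' V'" using b unfolding bounded_tstruct_def by blast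
    ultimately show "\<sigma> \<in> heart_cone D lam ` intermediate_hearts D (U \<inter> V)"
      using cone[OF _ u] TF s by blast
  qed
  moreover have "heart_fan D lam (U \<inter> V) =
      (\<Union>\<sigma>\<in>heart_cone D lam ` intermediate_hearts D (U \<inter> V). Faces \<sigma>)"
    unfolding heart_fan_def by simp
  ultimately show ?thesis by simp
qed

lemma is_fan_heart_fan:
  assumes "lam \<in> hom (K0 D) additive_group" and "bounded_heart D H"
  shows "is_fan (heart_fan D lam H)"
proof -
  obtain U V where UV: "bounded_tstruct D U V" "H = U \<inter> V"
    using assms(2) unfolding bounded_heart_iff by blast
  then have t: "tstruct D U V" unfolding bounded_tstruct_def by blast
  show ?thesis
    unfolding UV(2) heart_fan_eq_torsion_pairs[OF assms(1) UV(1)]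
    by (rule is_fan_Union_Faces)
      (auto intro: convex_cone_torsion_cone cone_face_torsion_cone[OF additive_K0[OF assms(1)] t])
qed

end

section \<open>Short exact sequences in a heart\<close>

context triangulated_category
begin

text \<open>An arrow killed by m factors through C[-1], and Hom(E, C[-1]) is Hom(E[1], C). For heart
  objects it vanishes, so m is monic in the heart though not in general in D.\<close>

lemma Tri_mono_zero:
  assumes T: "(m, g, h) \<in> Tri D" "m \<in> Hom D A X" "g \<in> Hom D X C"
    and d: "d \<in> Hom D E A" "m \<cdot> d = Zero D E X" and z: "hom_zero (sh E) C"
  shows "d = Zero D E A"
proof -
  obtain C' where C': "sh C' \<simeq> C" by (rule unshift)
  obtain g' h' where g': "g' \<in> Hom D X (sh C')" "(m, g', h') \<in> Tri D"
    using Tri_iso[OF T iso_sym[OF C']] by blast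
  obtain f where f: "f \<in> Hom D C' A" "(f, m, g') \<in> Tri D" using Tri_unrot[OF g'(2) T(2) g'(1)] by blast
  obtain w where w: "w \<in> Hom D E C'" "d = f \<cdot> w" using Tri_weak_kernel[OF f(2,1) T(2) d] by blast
  have "hom_zero E C'" using hom_zero_iso_right[OF iso_sym[OF C'] z] hom_zero_sh by blast
  then show ?thesis using w hom_zeroD comp_zero[OF f(1)] by metis
qed

lemma Tri_mono:
  assumes T: "(m, g, h) \<in> Tri D" "m \<in> Hom D A X" "g \<in> Hom D X C"
    and f: "f \<in> Hom D E A" "f' \<in> Hom D E A" "m \<cdot> f = m \<cdot> f'" and z: "hom_zero (sh E) C"
  shows "f = f'"
proof -
  have "m \<cdot> (f \<boxplus> Neg D f') = Zero D E X"
    using comp_plus_left[OF f(1) neg_hom[OF f(2)] T(2)] comp_neg[OF f(2) T(2)]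
      plus_neg[OF comp_hom[OF f(2) T(2)]] f(3) by simp
  then have "f \<boxplus> Neg D f' = Zero D E A"
    using Tri_mono_zero[OF T _ _ z] plus_hom[OF f(1) neg_hom[OF f(2)]] by blast
  then show ?thesis using diff_zeroD f by blast
qed

text \<open>Dually, an arrow that kills g factors through A[1].\<close>

lemma Tri_epi_zero:
  assumes T: "(m, g, h) \<in> Tri D" "m \<in> Hom D A X" "g \<in> Hom D X C"
    and d: "d \<in> Hom D C E" "d \<cdot> g = Zero D X E" and z: "hom_zero (sh A) E"
  shows "d = Zero D C E"
proof -
  have h: "h \<in> Hom D C (sh A)" by (rule Tri_third[OF T])
  have R: "(g, h, Neg D (Sh_ar D m)) \<in> Tri D" using TR2[OF T(2,3) h] T(1) by blast
  obtain w where "w \<in> Hom D (sh A) E" "d = w \<cdot> h" using Tri_weak_cokernel[OF R T(3) h d] by blast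
  then show ?thesis using hom_zeroD[OF z] zero_comp[OF h] by metis
qed

lemma Tri_epi:
  assumes T: "(m, g, h) \<in> Tri D" "m \<in> Hom D A X" "g \<in> Hom D X C"
    and f: "f \<in> Hom D C E" "f' \<in> Hom D C E" "f \<cdot> g = f' \<cdot> g" and z: "hom_zero (sh A) E"
  shows "f = f'"
proof -
  have "(f \<boxplus> Neg D f') \<cdot> g = Zero D X E"
    using comp_plus_right[OF T(3) f(1) neg_hom[OF f(2)]] neg_comp[OF T(3) f(2)]
      plus_neg[OF comp_hom[OF T(3) f(2)]] f(3) by simp
  then have "f \<boxplus> Neg D f' = Zero D C E"
    using Tri_epi_zero[OF T _ _ z] plus_hom[OF f(1) neg_hom[OF f(2)]] by blast
  then show ?thesis using diff_zeroD f by blast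
qed

end

section \<open>Kernel, image and cokernel of an arrow between heart objects\<close>

context tstruct
begin

lemma heart_triangle_mono_in:
  assumes T: "(m, g, h) \<in> Tri D" "m \<in> Hom D A X" "g \<in> Hom D X C"
    and "A \<in> U \<inter> V" "C \<in> V"
  shows "mono_in D (U \<inter> V) X m"
  unfolding mono_in_def
proof (intro bexI conjI ballI impI)
  show "m \<in> Hom D A X" "A \<in> U \<inter> V" by fact+
  fix B f f' assume "B \<in> U \<inter> V" "f \<in> Hom D B A" "f' \<in> Hom D B A" "m \<cdot> f = m \<cdot> f'"
  then show "f = f'" using Tri_mono[OF T] UV_orth assms by blast
qed

text \<open>For an arrow A -> Q with cone Z, the truncation K[1] -> Z -> C exhibits K as kernel and
  C as cokernel, and the octahedral axiom supplies the image I. Closure of U under cones and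
  extensions and of V under fibres keeps all three in the heart.\<close>

lemma image_truncation:
  assumes A: "A \<in> U \<inter> V" and Q: "Q \<in> U \<inter> V" and Z: "tri A Q Z" and tr: "tri (sh K) Z C" "K \<in> U" "C \<in> V"
    and I: "tri I Q C" "tri A I (sh K)"
  shows "C \<in> U \<inter> V" "I \<in> U \<inter> V" "K \<in> U \<inter> V"
proof -
  have ZU: "Z \<in> U" using U_cone[OF Z] A Q by blast
  show C: "C \<in> U \<inter> V" using U_cone[OF tr(1)] U_sh tr ZU by blast
  show I': "I \<in> U \<inter> V" using U_ext[OF I(2)] U_sh tr A V_fibre[OF I(1)] Q by blast
  show "K \<in> U \<inter> V" using V_fibre[OF tri_unrot[OF I(2)]] A I' tr by blast
qed

lemma image_objects:
  assumes A: "A \<in> U \<inter> V" and Q: "Q \<in> U \<inter> V" and Z: "tri A Q Z"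
  obtains K I C where "K \<in> U \<inter> V" "I \<in> U \<inter> V" "C \<in> U \<inter> V"
    "tri (sh K) Z C" "tri I Q C" "tri K A I"
proof -
  obtain K C where tr: "K \<in> U" "C \<in> V" "tri (sh K) Z C" using truncation by blast
  obtain I where I: "tri I Q C" "tri A I (sh K)" using tri_assoc_left[OF Z tr(3)] by blast
  show thesis
    using that image_truncation[OF A Q Z tr(3,1,2) I] tr I tri_unrot by blast
qed

text \<open>The version with arrows: as p kills f, the arrow f factors through i, so a nonzero f has
  a nonzero i.\<close>

lemma image_factorization:
  assumes A: "A \<in> U \<inter> V" and Q: "Q \<in> U \<inter> V" and f: "f \<in> Hom D A Q"
  obtains K I C i p l where "K \<in> U \<inter> V" "I \<in> U \<inter> V" "C \<in> U \<inter> V" "tri K A I"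
    "i \<in> Hom D I Q" "p \<in> Hom D Q C" "(i, p, l) \<in> Tri D" "p \<cdot> f = Zero D A C"
proof -
  obtain Z g h where T: "g \<in> Hom D Q Z" "(f, g, h) \<in> Tri D" by (rule Tri_cone[OF f])
  have Z: "tri A Q Z" unfolding tri_def using f T Tri_third by blast
  obtain K C where tr: "K \<in> U" "C \<in> V" "tri (sh K) Z C" using truncation by blast
  obtain k q j where q: "k \<in> Hom D (sh K) Z" "q \<in> Hom D Z C" "(k, q, j) \<in> Tri D"
    using tr(3) by (rule triE)
  obtain I i l where I: "i \<in> Hom D I Q" "(i, q \<cdot> g, l) \<in> Tri D" "tri A I (sh K)"
    using Tri_assoc_left[OF T(2) f T(1) q(3,1,2)] by blast
  have qg: "q \<cdot> g \<in> Hom D Q C" using comp_hom T q by blast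
  have "tri I Q C" unfolding tri_def using I qg Tri_third by blast
  note H = image_truncation[OF A Q Z tr(3,1,2) this I(3)]
  have "(q \<cdot> g) \<cdot> f = Zero D A C"
    using comp_assoc[OF f T(1) q(2)] Tri_comp[OF T(2) f T(1)] comp_zero[OF q(2)] by simp
  then show thesis using that H I qg tri_unrot by blast
qed

end

section \<open>The torsion pair of a linear functional on a length heart\<close>

context tstruct
begin

definition nonneg_quotients :: "('a \<Rightarrow> real) \<Rightarrow> 'a set" where
  "nonneg_quotients \<psi> =
     {X \<in> U \<inter> V. \<forall>S Q. S \<in> U \<inter> V \<and> Q \<in> U \<inter> V \<and> tri S X Q \<longrightarrow> 0 \<le> \<psi> Q}"

lemma nonneg_quotientsD:
  "X \<in> nonneg_quotients \<psi> \<Longrightarrow> tri S X Q \<Longrightarrow> S \<in> U \<inter> V \<Longrightarrow> Q \<in> U \<inter> V \<Longrightarrow> 0 \<le> \<psi> Q"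
  unfolding nonneg_quotients_def by blast

lemma nonneg_quotients_heart: "X \<in> nonneg_quotients \<psi> \<Longrightarrow> X \<in> U \<inter> V"
  unfolding nonneg_quotients_def by blast

lemma nonneg_quotients_iso:
  assumes "X \<in> nonneg_quotients \<psi>" "X \<simeq> Y" shows "Y \<in> nonneg_quotients \<psi>"
proof -
  have "tri S X Q" if "tri S Y Q" for S Q
    using tri_iso[OF that iso_refl iso_sym[OF assms(2)] iso_refl] .
  then show ?thesis
    using assms(1) heart_iso[OF _ assms(2)] unfolding nonneg_quotients_def by blast
qed

lemma nonneg_quotients_quotient:
  assumes X: "X \<in> nonneg_quotients \<psi>" and t: "tri S X Q" "S \<in> U \<inter> V" "Q \<in> U \<inter> V"
  shows "Q \<in> nonneg_quotients \<psi>"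
  unfolding nonneg_quotients_def
proof (intro CollectI conjI allI impI)
  fix S' Q' assume *: "S' \<in> U \<inter> V \<and> Q' \<in> U \<inter> V \<and> tri S' Q Q'"
  then obtain P where P: "tri P X Q'" "tri S P S'" using tri_assoc_left[OF t(1)] by blast
  then show "0 \<le> \<psi> Q'" using nonneg_quotientsD[OF X P(1)] heart_ext[OF P(2)] * t by blast
qed (use t in auto)

text \<open>A quotient Q of X is an extension of C by I, where I is the image of A in Q, a quotient
  of A, and C = Q/I is a quotient of B. Both contribute nonnegatively.\<close>

lemma nonneg_quotients_ext:
  assumes \<psi>: "additive_on_triangles \<psi>"
    and A: "A \<in> nonneg_quotients \<psi>" and B: "B \<in> nonneg_quotients \<psi>" and t: "tri A X B"
  shows "X \<in> nonneg_quotients \<psi>"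
  unfolding nonneg_quotients_def
proof (intro CollectI conjI allI impI)
  note H = nonneg_quotients_heart[OF A] nonneg_quotients_heart[OF B]
  show "X \<in> U \<inter> V" using heart_ext[OF t H] .
  fix S Q assume *: "S \<in> U \<inter> V \<and> Q \<in> U \<inter> V \<and> tri S X Q"
  then obtain W where W: "tri A Q W" "tri B W (sh S)"
    using tri_assoc_right[OF t tri_rot] by blast
  obtain K I C where I: "K \<in> U \<inter> V" "I \<in> U \<inter> V" "C \<in> U \<inter> V" "tri (sh K) W C" "tri I Q C" "tri K A I"
    using image_objects[OF H(1) _ W(1)] * by blast
  \<comment> \<open>M is the kernel of B -> C. It is in U as an extension of K[1] by S, and in V as
    the fibre of B -> C.\<close>
  obtain M where M: "tri M B C" "tri S M (sh K)" using tri_assoc_left[OF tri_unrot[OF W(2)] I(4)] by blast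
  have "M \<in> U \<inter> V" using U_ext[OF M(2)] U_sh V_fibre[OF M(1)] I H * by blast
  then have "0 \<le> \<psi> C" using nonneg_quotientsD[OF B M(1)] I by blast
  moreover have "0 \<le> \<psi> I" using nonneg_quotientsD[OF A I(6)] I by blast
  ultimately show "0 \<le> \<psi> Q" using additive_tri[OF \<psi> I(5)] by simp
qed

lemma zero_nonneg_quotients:
  assumes \<psi>: "additive_on_triangles \<psi>" and Z: "hom_zero Z Z"
  shows "Z \<in> nonneg_quotients \<psi>"
  unfolding nonneg_quotients_def
proof (intro CollectI conjI allI impI)
  show "Z \<in> U \<inter> V" using zero_in_U zero_in_V Z by blast
  fix S Q assume *: "S \<in> U \<inter> V \<and> Q \<in> U \<inter> V \<and> tri S Z Q"
  then have "hom_zero Q Q" using hom_zero_cone UV_orth hom_zero_from[OF Z] by blast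
  then show "0 \<le> \<psi> Q" using additive_zero[OF \<psi>] by simp
qed

text \<open>If a nonzero map E -> X/A with E in the class exists, its image I is a quotient of E and
  so in the class; the preimage of I in X is an extension of I by A, again in the class and strictly
  larger than A. Repetition contradicts the ascending chain condition.\<close>

lemma maximal_nonneg_subobject:
  assumes \<psi>: "additive_on_triangles \<psi>" and noeth: "noetherian_category D (U \<inter> V)"
    and X: "X \<in> U \<inter> V"
  shows "\<exists>A\<in>nonneg_quotients \<psi>. \<exists>C\<in>U \<inter> V. tri A X C \<and> (\<forall>E\<in>nonneg_quotients \<psi>. hom_zero E C)"
proof (rule ccontr)
  assume "\<not> ?thesis"
  then have no: "\<exists>E\<in>nonneg_quotients \<psi>. \<not> hom_zero E C"
    if "A \<in> nonneg_quotients \<psi>" "C \<in> U \<inter> V" "tri A X C" for A C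
    using that by blast
  define P where "P m \<longleftrightarrow> (\<exists>A\<in>nonneg_quotients \<psi>. \<exists>C\<in>U \<inter> V. \<exists>g h.
      m \<in> Hom D A X \<and> g \<in> Hom D X C \<and> (m, g, h) \<in> Tri D)" for m
  have start: "\<exists>m. P m"
  proof -
    obtain Z where Z: "hom_zero Z Z" using ex_zero_object zero_object_iff by blast
    from tri_zero1[OF Z, of X] show ?thesis
      unfolding P_def tri_def using zero_nonneg_quotients[OF \<psi> Z] X by blast
  qed
  have step: "\<exists>m'. P m' \<and> subobject_le D m m' \<and> \<not> subobject_le D m' m" if Pm: "P m" for m
  proof -
    obtain A C g h where A: "A \<in> nonneg_quotients \<psi>" and C: "C \<in> U \<inter> V"
      and T: "(m, g, h) \<in> Tri D" "m \<in> Hom D A X" "g \<in> Hom D X C"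
      using Pm unfolding P_def by blast
    have "tri A X C" unfolding tri_def using T Tri_third by blast
    then obtain E e where E: "E \<in> nonneg_quotients \<psi>" "e \<in> Hom D E C" "e \<noteq> Zero D E C"
      using no[OF A C] hom_zeroI by blast
    obtain K I Q i q l where I: "K \<in> U \<inter> V" "I \<in> U \<inter> V" "Q \<in> U \<inter> V" "tri K E I"
      and i: "i \<in> Hom D I C" "q \<in> Hom D C Q" "(i, q, l) \<in> Tri D" and qe: "q \<cdot> e = Zero D E Q"
      using image_factorization[OF nonneg_quotients_heart[OF E(1)] C E(2)] by blast
    obtain w where w: "w \<in> Hom D E I" "e = i \<cdot> w" using Tri_weak_kernel[OF i(3,1,2) E(2) qe] by blast
    have i0: "i \<noteq> Zero D I C" using w E(3) zero_comp by metis
    obtain X' m' l' where m': "m' \<in> Hom D X' X" "(m', q \<cdot> g, l') \<in> Tri D" "tri A X' I"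
      using Tri_assoc_left[OF T i(3,1,2)] by blast
    have qg: "q \<cdot> g \<in> Hom D X Q" using comp_hom T i by blast
    have "I \<in> nonneg_quotients \<psi>" using nonneg_quotients_quotient[OF E(1) I(4)] I by blast
    then have "X' \<in> nonneg_quotients \<psi>" using nonneg_quotients_ext[OF \<psi> A _ m'(3)] by blast
    then have "P m'" unfolding P_def using m' qg I by blast
    moreover have "subobject_le D m m'"
    proof -
      have "(q \<cdot> g) \<cdot> m = Zero D A Q"
        using comp_assoc[OF T(2,3) i(2)] Tri_comp[OF T] comp_zero[OF i(2)] by simp
      then obtain t where "t \<in> Hom D A X'" "m = m' \<cdot> t"
        using Tri_weak_kernel[OF m'(2,1) qg T(2)] by blast
      then show ?thesis unfolding subobject_le_def using T m' unfolding Hom_def by auto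
    qed
    \<comment> \<open>If \<open>m'\<close> factored through m, then g would kill \<open>m'\<close>
      and so factor as r q g. Since g is epi in the heart, r q is the identity, and i = r q i =
      0.\<close>
    moreover have "\<not> subobject_le D m' m"
    proof
      assume "subobject_le D m' m"
      then obtain t where t: "t \<in> Hom D X' A" "m' = m \<cdot> t"
        unfolding subobject_le_def using T m' unfolding Hom_def by auto
      have "g \<cdot> m' = Zero D X' C"
        using t comp_assoc[OF t(1) T(2,3)] Tri_comp[OF T] zero_comp[OF t(1)] by simp
      then obtain r where r: "r \<in> Hom D Q C" "g = r \<cdot> (q \<cdot> g)"
        using Tri_weak_cokernel[OF m'(2,1) qg T(3)] by blast
      have rq: "r \<cdot> q \<in> Hom D C C" using comp_hom i r by blast
      have "(r \<cdot> q) \<cdot> g = Id D C \<cdot> g"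
        using comp_assoc[OF T(3) i(2) r(1)] r(2) id_left[OF T(3)] by simp
      then have "r \<cdot> q = Id D C"
        using Tri_epi[OF T rq id_hom] UV_orth nonneg_quotients_heart[OF A] C by blast
      then have "i = r \<cdot> (q \<cdot> i)"
        using comp_assoc[OF i(1,2) r(1)] id_left[OF i(1)] by simp
      also have "\<dots> = Zero D I C" using Tri_comp[OF i(3,1,2)] comp_zero[OF r(1)] by simp
      finally show False using i0 by blast
    qed
    ultimately show ?thesis by blast
  qed
  obtain m where m: "\<And>n. P (m n)"
    "\<And>n. subobject_le D (m n) (m (Suc n)) \<and> \<not> subobject_le D (m (Suc n)) (m n)"
    using dependent_nat_choice[of "\<lambda>_. P" "\<lambda>_ m m'. subobject_le D m m' \<and> \<not> subobject_le D m' m"]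
      start step by blast
  have "mono_in D (U \<inter> V) X (m n)" for n
    using m(1)[of n] heart_triangle_mono_in nonneg_quotients_heart unfolding P_def by blast
  then obtain N where "\<forall>i\<ge>N. subobject_le D (m i) (m N)"
    using noeth X m(2) unfolding noetherian_category_def by blast
  then show False using m(2)[of N] by auto
qed

text \<open>Start from Y with positive value. A subobject S of positive value is nonzero and hence
  not in the torsion class, which has no maps to Y; so S has a quotient Q of negative value. Its
  kernel has an even larger value and is strictly smaller, against the descending chain
  condition.\<close>

lemma orth_nonneg_quotients_nonpos:
  assumes \<psi>: "additive_on_triangles \<psi>" and art: "artinian_category D (U \<inter> V)"
    and Y: "Y \<in> U \<inter> V" and orth: "\<forall>E\<in>nonneg_quotients \<psi>. hom_zero E Y"
  shows "\<psi> Y \<le> 0"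
proof (rule ccontr)
  assume pos: "\<not> \<psi> Y \<le> 0"
  define P where "P m \<longleftrightarrow> (\<exists>S\<in>U \<inter> V. \<exists>C\<in>U \<inter> V. \<exists>g h. 0 < \<psi> S \<and>
      m \<in> Hom D S Y \<and> g \<in> Hom D Y C \<and> (m, g, h) \<in> Tri D)" for m
  have start: "\<exists>m. P m"
  proof -
    obtain Z where Z: "hom_zero Z Z" using ex_zero_object zero_object_iff by blast
    then have "Z \<in> U \<inter> V" using zero_in_U zero_in_V by blast
    with tri_zero3[OF Z, of Y] show ?thesis
      unfolding P_def tri_def using Y pos by (meson not_le)
  qed
  have step: "\<exists>m'. P m' \<and> subobject_le D m' m \<and> \<not> subobject_le D m m'" if Pm: "P m" for m
  proof -
    obtain S C g h where S: "S \<in> U \<inter> V" "0 < \<psi> S" and C: "C \<in> U \<inter> V"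
      and T: "(m, g, h) \<in> Tri D" "m \<in> Hom D S Y" "g \<in> Hom D Y C"
      using Pm unfolding P_def by blast
    have SY: "tri S Y C" unfolding tri_def using T Tri_third by blast
    have "S \<notin> nonneg_quotients \<psi>"
    proof
      assume "S \<in> nonneg_quotients \<psi>"
      then have "hom_zero S Y" using orth by blast
      then have "hom_zero S S" using hom_zero_fibre[OF SY] UV_orth S C by blast
      then show False using S(2) additive_zero[OF \<psi>] by force
    qed
    then obtain S' Q where Q: "S' \<in> U \<inter> V" "Q \<in> U \<inter> V" "tri S' S Q" "\<psi> Q < 0"
      using S unfolding nonneg_quotients_def by force
    obtain k p j where k: "k \<in> Hom D S' S" "p \<in> Hom D S Q" "(k, p, j) \<in> Tri D" using Q(3) by (rule triE)
    have mk: "m \<cdot> k \<in> Hom D S' Y" using comp_hom k T by blast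
    obtain W g' h' where W: "g' \<in> Hom D Y W" "(m \<cdot> k, g', h') \<in> Tri D" by (rule Tri_cone[OF mk])
    have "Cod D p = Q" "Cod D g' = W" "Cod D g = C"
      using k W T unfolding Hom_def by auto
    \<comment> \<open>The quotient W = Y/S' is an extension of C = Y/S by Q = S/S', hence in the
      heart.\<close>
    then obtain a b where ab: "a \<in> Hom D Q W" "b \<in> Hom D W C" "(a, b, Sh_ar D p \<cdot> h) \<in> Tri D"
      using TR4[OF k(1) T(2) k(3) W(2) T(1)] by auto
    then have "tri Q W C" unfolding tri_def using Tri_third by blast
    then have "W \<in> U \<inter> V" using heart_ext Q C by blast
    moreover have "0 < \<psi> S'" using additive_tri[OF \<psi> Q(3)] S Q by simp
    ultimately have "P (m \<cdot> k)" unfolding P_def using mk W Q by blast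
    moreover have "subobject_le D (m \<cdot> k) m"
      unfolding subobject_le_def using k mk T unfolding Hom_def by auto
    moreover have "\<not> subobject_le D m (m \<cdot> k)"
    \<comment> \<open>As m is monic, such a factorisation would make t a right inverse of k. Then p
      = p k t = 0, and Q would be zero although its value is negative.\<close>
    proof
      assume "subobject_le D m (m \<cdot> k)"
      then obtain t where t: "t \<in> Hom D S S'" "m = (m \<cdot> k) \<cdot> t"
        unfolding subobject_le_def using mk T unfolding Hom_def by auto
      have kt: "k \<cdot> t \<in> Hom D S S" using comp_hom k t by blast
      have "m \<cdot> (k \<cdot> t) = m \<cdot> Id D S"
        using comp_assoc[OF t(1) k(1) T(2)] t(2) id_right[OF T(2)] by simp
      then have "k \<cdot> t = Id D S" using Tri_mono[OF T kt id_hom] UV_orth S C by blast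
      then have "p = (p \<cdot> k) \<cdot> t" using comp_assoc[OF t(1) k(1,2)] id_right[OF k(2)] by simp
      then have "Id D Q \<cdot> p = Zero D S Q"
        using Tri_comp[OF k(3,1,2)] zero_comp[OF t(1)] id_left[OF k(2)] by simp
      then have "Id D Q = Zero D Q Q"
        using Tri_epi_zero[OF k(3,1,2) id_hom] UV_orth Q by blast
      then have "hom_zero Q Q" using zero_object_iff zero_object_def by metis
      then show False using Q(4) additive_zero[OF \<psi>] by force
    qed
    ultimately show ?thesis by blast
  qed
  obtain m where m: "\<And>n. P (m n)"
    "\<And>n. subobject_le D (m (Suc n)) (m n) \<and> \<not> subobject_le D (m n) (m (Suc n))"
    using dependent_nat_choice[of "\<lambda>_. P" "\<lambda>_ m m'. subobject_le D m' m \<and> \<not> subobject_le D m m'"]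
      start step by blast
  have "mono_in D (U \<inter> V) Y (m n)" for n
    using m(1)[of n] heart_triangle_mono_in unfolding P_def by blast
  then obtain N where "\<forall>i\<ge>N. subobject_le D (m N) (m i)"
    using art Y m(2) unfolding artinian_category_def by blast
  then show False using m(2)[of N] by auto
qed

lemma torsion_pair_nonneg_quotients:
  assumes \<psi>: "additive_on_triangles \<psi>" and noeth: "noetherian_category D (U \<inter> V)"
  shows "torsion_pair (U \<inter> V) (nonneg_quotients \<psi>)
    {Y \<in> U \<inter> V. \<forall>E\<in>nonneg_quotients \<psi>. hom_zero E Y}"
proof -
  have "\<exists>A\<in>nonneg_quotients \<psi>. \<exists>B\<in>{Y \<in> U \<inter> V. \<forall>E\<in>nonneg_quotients \<psi>. hom_zero E Y}. tri A X B"
    if "X \<in> U \<inter> V" for X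
    using maximal_nonneg_subobject[OF \<psi> noeth that] by blast
  then show ?thesis
    unfolding torsion_pair_def
    using nonneg_quotients_heart nonneg_quotients_iso heart_iso hom_zero_iso_right by blast
qed

end

lemma (in triangulated_category) complete_heart_fan:
  assumes lam: "lam \<in> hom (K0 D) additive_group" and H: "bounded_heart D H"
    and len: "length_category D H"
  shows "complete_fan (heart_fan D lam H)"
proof -
  obtain U V where UV: "bounded_tstruct D U V" "H = U \<inter> V"
    using H unfolding bounded_heart_iff by blast
  interpret bounded_tstruct D U V by fact
  let ?\<phi> = "\<lambda>X. lam (K0_class D X)"
  have "v \<in> \<Union> (heart_fan D lam H)" for v
  proof -
    define \<psi> where "\<psi> = (\<lambda>X. eval_dual v (?\<phi> X))"
    have \<psi>: "additive_on_triangles \<psi>"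
      unfolding \<psi>_def using additive_eval_dual[OF additive_K0[OF lam]] .
    define T where "T = nonneg_quotients \<psi>"
    define F where "F = {Y \<in> U \<inter> V. \<forall>E\<in>T. hom_zero E Y}"
    have tp: "torsion_pair (U \<inter> V) T F"
      unfolding T_def F_def
      using torsion_pair_nonneg_quotients[OF \<psi>] len UV unfolding length_category_def by blast
    have "\<psi> X \<ge> 0" if "X \<in> T" for X
    proof -
      obtain Z where Z: "hom_zero Z Z" using ex_zero_object zero_object_iff by blast
      \<comment> \<open>X is a quotient of itself, with zero kernel.\<close>
      show ?thesis
        using nonneg_quotientsD[OF _ tri_zero1[OF Z]] that nonneg_quotients_heart zero_in_U[OF Z]
          zero_in_V[OF Z] unfolding T_def by blast
    qed
    moreover have "\<psi> Y \<le> 0" if "Y \<in> F" for Y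
      using orth_nonneg_quotients_nonpos[OF \<psi>] len UV that
      unfolding length_category_def F_def T_def by blast
    ultimately have "v \<in> torsion_cone ?\<phi> T F" unfolding torsion_cone_def \<psi>_def by blast
    moreover have "torsion_cone ?\<phi> T F \<in> heart_fan D lam H"
      unfolding UV(2) heart_fan_eq_torsion_pairs[OF lam UV(1)] Faces_def
      using tp cone_face_refl[OF convex_cone_torsion_cone] by blast
    ultimately show ?thesis by blast
  qed
  then show ?thesis unfolding complete_fan_def by blast
qed

section \<open>Independence of the ambient triangulated category\<close>

context triangulated_category
begin

text \<open>Only composition and zero arrows occur, so an additive functor can transport this. The
  class G of test objects is a parameter because the image of an equivalence need not be closed
  under isomorphism.\<close>

definition short_exact_in where
  "short_exact_in G A X C i p \<longleftrightarrow> i \<in> Hom D A X \<and> p \<in> Hom D X C \<and> p \<cdot> i = Zero D A C \<and>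
     (\<forall>E\<in>G. \<forall>f\<in>Hom D E A. i \<cdot> f = Zero D E X \<longrightarrow> f = Zero D E A) \<and>
     (\<forall>E\<in>G. \<forall>f\<in>Hom D C E. f \<cdot> p = Zero D X E \<longrightarrow> f = Zero D C E) \<and>
     (\<forall>E\<in>G. \<forall>u\<in>Hom D X E. u \<cdot> i = Zero D A E \<longrightarrow> (\<exists>w\<in>Hom D C E. u = w \<cdot> p))"

lemma short_exact_in_mono: "short_exact_in G A X C i p \<Longrightarrow> G' \<subseteq> G \<Longrightarrow> short_exact_in G' A X C i p"
  unfolding short_exact_in_def by blast

text \<open>An arrow from or to a new test object is composed with an isomorphism to an old one and
  pulled back afterwards.\<close>

lemma short_exact_in_iso_closure:
  assumes s: "short_exact_in G A X C i p" and G: "\<And>E'. E' \<in> G' \<Longrightarrow> \<exists>E\<in>G. E \<simeq> E'"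
  shows "short_exact_in G' A X C i p"
proof -
  have i: "i \<in> Hom D A X" and p: "p \<in> Hom D X C" and pi: "p \<cdot> i = Zero D A C"
    using s unfolding short_exact_in_def by blast+
  have "f = Zero D E' A" if E': "E' \<in> G'" and f: "f \<in> Hom D E' A" "i \<cdot> f = Zero D E' X" for E' f
  proof -
    obtain E where "E \<in> G" "E \<simeq> E'" using G[OF E'] by blast
    then obtain a b where a: "E \<in> G" "a \<in> Hom D E E'" "b \<in> Hom D E' E" "a \<cdot> b = Id D E'"
      unfolding isomorphic_def' by blast
    have "i \<cdot> (f \<cdot> a) = Zero D E X" using comp_assoc[OF a(2) f(1) i] f(2) zero_comp[OF a(2)] by simp
    then have fa: "f \<cdot> a = Zero D E A"
      using s a(1) comp_hom[OF a(2) f(1)] unfolding short_exact_in_def by blast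
    show ?thesis using comp_assoc[OF a(3,2) f(1)] a(4) fa id_right[OF f(1)] zero_comp[OF a(3)] by simp
  qed
  moreover have "f = Zero D C E'" if E': "E' \<in> G'" and f: "f \<in> Hom D C E'" "f \<cdot> p = Zero D X E'" for E' f
  proof -
    obtain E where "E \<in> G" "E \<simeq> E'" using G[OF E'] by blast
    then obtain a b where a: "E \<in> G" "a \<in> Hom D E E'" "b \<in> Hom D E' E" "a \<cdot> b = Id D E'"
      unfolding isomorphic_def' by blast
    have "(b \<cdot> f) \<cdot> p = Zero D X E" using comp_assoc[OF p f(1) a(3)] f(2) comp_zero[OF a(3)] by simp
    then have bf: "b \<cdot> f = Zero D C E"
      using s a(1) comp_hom[OF f(1) a(3)] unfolding short_exact_in_def by blast
    show ?thesis using comp_assoc[OF f(1) a(3,2)] a(4) bf id_left[OF f(1)] comp_zero[OF a(2)] by simp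
  qed
  moreover have "\<exists>w\<in>Hom D C E'. u = w \<cdot> p"
    if E': "E' \<in> G'" and u: "u \<in> Hom D X E'" "u \<cdot> i = Zero D A E'" for E' u
  proof -
    obtain E where "E \<in> G" "E \<simeq> E'" using G[OF E'] by blast
    then obtain a b where a: "E \<in> G" "a \<in> Hom D E E'" "b \<in> Hom D E' E" "a \<cdot> b = Id D E'"
      unfolding isomorphic_def' by blast
    have "(b \<cdot> u) \<cdot> i = Zero D A E" using comp_assoc[OF i u(1) a(3)] u(2) comp_zero[OF a(3)] by simp
    then obtain w where w: "w \<in> Hom D C E" "b \<cdot> u = w \<cdot> p"
      using s a(1) comp_hom[OF u(1) a(3)] unfolding short_exact_in_def by blast
    have "u = (a \<cdot> w) \<cdot> p"
      using comp_assoc[OF u(1) a(3,2)] a(4) id_left[OF u(1)] w(2) comp_assoc[OF p w(1) a(2)] by simp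
    then show ?thesis using comp_hom[OF w(1) a(2)] by blast
  qed
  ultimately show ?thesis unfolding short_exact_in_def using i p pi by blast
qed

end

context tstruct
begin

lemma short_exact_in_of_Tri:
  assumes T: "(i, p, h) \<in> Tri D" "i \<in> Hom D A X" "p \<in> Hom D X C"
    and H: "A \<in> U \<inter> V" "C \<in> U \<inter> V"
  shows "short_exact_in (U \<inter> V) A X C i p"
  unfolding short_exact_in_def
proof (intro conjI ballI impI)
  show "f = Zero D E A" if "E \<in> U \<inter> V" "f \<in> Hom D E A" "i \<cdot> f = Zero D E X" for E f
    using Tri_mono_zero[OF T that(2,3)] UV_orth that H by blast
  show "f = Zero D C E" if "E \<in> U \<inter> V" "f \<in> Hom D C E" "f \<cdot> p = Zero D X E" for E f
    using Tri_epi_zero[OF T that(2,3)] UV_orth that H by blast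
  show "\<exists>w\<in>Hom D C E. u = w \<cdot> p" if "u \<in> Hom D X E" "u \<cdot> i = Zero D A E" for E u
    using Tri_weak_cokernel[OF T that] .
qed (use T Tri_comp in auto)

text \<open>The bridge from additive data to triangles. That i is monic makes K, the kernel read off
  the cone Z of i, vanish, so Z lies in the heart. Then Z and C are both cokernels of i and hence
  isomorphic.\<close>

lemma tri_of_short_exact_in:
  assumes s: "short_exact_in (U \<inter> V) A X C i p" and H: "A \<in> U \<inter> V" "X \<in> U \<inter> V" "C \<in> U \<inter> V"
  shows "tri A X C"
proof -
  have i: "i \<in> Hom D A X" and p: "p \<in> Hom D X C" and pi: "p \<cdot> i = Zero D A C"
    using s unfolding short_exact_in_def by blast+
  obtain Z g h where g: "g \<in> Hom D X Z" and T: "(i, g, h) \<in> Tri D" by (rule Tri_cone[OF i])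
  have h: "h \<in> Hom D Z (sh A)" by (rule Tri_third[OF T i g])
  have AXZ: "tri A X Z" unfolding tri_def using T i g h by blast
  obtain K I B where K: "K \<in> U \<inter> V" "B \<in> U \<inter> V" "tri (sh K) Z B"
    using image_objects[OF H(1,2) AXZ] by metis
  have R: "(g, h, Neg D (Sh_ar D i)) \<in> Tri D" using TR2[OF i g h] T by blast
  have si: "Neg D (Sh_ar D i) \<in> Hom D (sh A) (sh X)" using neg_hom shift_hom i by blast
  have R2: "(h, Neg D (Sh_ar D i), Neg D (Sh_ar D g)) \<in> Tri D" using TR2[OF g h si] R by blast
  \<comment> \<open>For u from K[1] to Z, the composite with h is the shift of some w from K to A
    killed by i, so w = 0. Then u factors through X, which receives nothing from K[1].\<close>
  have "hom_zero (sh K) Z"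
  proof (rule hom_zeroI)
    fix u assume u: "u \<in> Hom D (sh K) Z"
    obtain w where w: "w \<in> Hom D K A" "h \<cdot> u = Sh_ar D w" using sh_full[OF comp_hom[OF u h]] by blast
    have "Neg D (Sh_ar D (i \<cdot> w)) = Neg D (Sh_ar D i) \<cdot> (h \<cdot> u)"
      using neg_comp[OF shift_hom[OF w(1)] shift_hom[OF i]] shift_comp[OF w(1) i] w(2) by simp
    also have "\<dots> = Zero D (sh K) (sh X)"
      using comp_assoc[OF u h si] Tri_comp[OF R2 h si] zero_comp[OF u] by simp
    finally have "Neg D (Sh_ar D (i \<cdot> w)) = Neg D (Sh_ar D (Zero D K X))"
      by (simp add: sh_zero neg_zero)
    then have "i \<cdot> w = Zero D K X"
      using neg_inj[OF shift_hom shift_hom, OF comp_hom[OF w(1) i] zero_hom]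
        sh_inj[OF comp_hom[OF w(1) i] zero_hom] by blast
    then have "w = Zero D K A" using s K(1) w(1) unfolding short_exact_in_def by blast
    then have "h \<cdot> u = Zero D (sh K) (sh A)" using w(2) sh_zero by simp
    then obtain u' where "u' \<in> Hom D (sh K) X" "u = g \<cdot> u'" using Tri_weak_kernel[OF R g h u] by blast
    moreover have "hom_zero (sh K) X" using UV_orth K H by blast
    ultimately show "u = Zero D (sh K) Z" using hom_zeroD comp_zero[OF g] by metis
  qed
  then have "hom_zero (sh K) (sh K)" using hom_zero_fibre[OF K(3)] UV_orth U_sh K by blast
  then have "B \<simeq> Z" using tri_zero1_iso[OF K(3)] iso_sym by blast
  then have Z: "Z \<in> U \<inter> V" using heart_iso K by blast
  \<comment> \<open>The arrow r comes from the cokernel property of p, the arrow t from that of the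
    triangle; both composites are identities since g and p are epi in the heart.\<close>
  obtain r where r: "r \<in> Hom D C Z" "g = r \<cdot> p"
    using s Z g Tri_comp[OF T i g] unfolding short_exact_in_def by blast
  obtain t where t: "t \<in> Hom D Z C" "p = t \<cdot> g" using Tri_weak_cokernel[OF T i g p pi] by blast
  have rt: "r \<cdot> t \<in> Hom D Z Z" and tr: "t \<cdot> r \<in> Hom D C C" using comp_hom r t by blast+
  have "(r \<cdot> t) \<cdot> g = Id D Z \<cdot> g" using comp_assoc[OF g t(1) r(1)] r(2)[symmetric] t(2)[symmetric] id_left[OF g] by simp
  then have "r \<cdot> t = Id D Z" using Tri_epi[OF T i g rt id_hom] UV_orth H Z by blast
  moreover have "t \<cdot> r = Id D C"
  proof (rule diff_zeroD[OF tr id_hom])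
    have d: "(t \<cdot> r) \<boxplus> Neg D (Id D C) \<in> Hom D C C" using plus_hom[OF tr neg_hom[OF id_hom]] .
    have "((t \<cdot> r) \<boxplus> Neg D (Id D C)) \<cdot> p = ((t \<cdot> r) \<cdot> p) \<boxplus> Neg D p"
      using comp_plus_right[OF p tr neg_hom[OF id_hom]] neg_comp[OF p id_hom] id_left[OF p] by simp
    also have "(t \<cdot> r) \<cdot> p = p" using comp_assoc[OF p r(1) t(1)] r(2)[symmetric] t(2)[symmetric] by simp
    also have "p \<boxplus> Neg D p = Zero D X C" using plus_neg[OF p] .
    finally show "(t \<cdot> r) \<boxplus> Neg D (Id D C) = Zero D C C"
      using s H(3) d unfolding short_exact_in_def by blast
  qed
  ultimately have "Z \<simeq> C" unfolding isomorphic_def' using r t by blast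
  then show ?thesis using tri_iso3[OF AXZ] by blast
qed

end

section \<open>Transport along an additive equivalence of hearts\<close>

locale heart_equivalence =
  t: tstruct D U V + t': tstruct D' U' V'
  for D :: "('o, 'm) tri_data" and U V and D' :: "('p, 'n) tri_data" and U' V' +
  fixes Fo Fa
  assumes equivalence: "additive_equivalence D (U \<inter> V) D' (U' \<inter> V') Fo Fa"
begin

lemma Fo_heart: "X \<in> U \<inter> V \<Longrightarrow> Fo X \<in> U' \<inter> V'"
  using equivalence unfolding additive_equivalence_def by blast

lemma Fo_surj: "Y \<in> U' \<inter> V' \<Longrightarrow> \<exists>X\<in>U \<inter> V. isomorphic D' (Fo X) Y"
  using equivalence unfolding additive_equivalence_def by blast

lemma Fa_id: "X \<in> U \<inter> V \<Longrightarrow> Fa (Id D X) = Id D' (Fo X)"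
  using equivalence unfolding additive_equivalence_def by blast

lemma Fa_comp:
  "f \<in> Hom D X Y \<Longrightarrow> g \<in> Hom D Y Z \<Longrightarrow> X \<in> U \<inter> V \<Longrightarrow> Y \<in> U \<inter> V \<Longrightarrow> Z \<in> U \<inter> V \<Longrightarrow>
    Fa (Comp D g f) = Comp D' (Fa g) (Fa f)"
  using equivalence unfolding additive_equivalence_def by blast

lemma Fa_bij:
  "X \<in> U \<inter> V \<Longrightarrow> Y \<in> U \<inter> V \<Longrightarrow> bij_betw Fa (Hom D X Y) (Hom D' (Fo X) (Fo Y))"
  using equivalence unfolding additive_equivalence_def by blast

lemma Fa_hom: "f \<in> Hom D X Y \<Longrightarrow> X \<in> U \<inter> V \<Longrightarrow> Y \<in> U \<inter> V \<Longrightarrow> Fa f \<in> Hom D' (Fo X) (Fo Y)"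
  using Fa_bij bij_betwE by blast

lemma Fa_full:
  "g \<in> Hom D' (Fo X) (Fo Y) \<Longrightarrow> X \<in> U \<inter> V \<Longrightarrow> Y \<in> U \<inter> V \<Longrightarrow> \<exists>f\<in>Hom D X Y. g = Fa f"
  using Fa_bij[of X Y] unfolding bij_betw_def by blast

lemma Fa_inj:
  "f \<in> Hom D X Y \<Longrightarrow> g \<in> Hom D X Y \<Longrightarrow> X \<in> U \<inter> V \<Longrightarrow> Y \<in> U \<inter> V \<Longrightarrow> Fa f = Fa g \<longleftrightarrow> f = g"
  using Fa_bij[of X Y] unfolding bij_betw_def inj_on_def by blast

lemma Fa_zero:
  assumes "X \<in> U \<inter> V" "Y \<in> U \<inter> V" shows "Fa (Zero D X Y) = Zero D' (Fo X) (Fo Y)"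
proof (rule t'.plus_eq_selfD)
  show *: "Fa (Zero D X Y) \<in> Hom D' (Fo X) (Fo Y)" "Fa (Zero D X Y) \<in> Hom D' (Fo X) (Fo Y)"
    using Fa_hom[OF t.zero_hom assms] by blast+
  have "Fa (Plus D (Zero D X Y) (Zero D X Y)) = Plus D' (Fa (Zero D X Y)) (Fa (Zero D X Y))"
    using equivalence assms t.zero_hom unfolding additive_equivalence_def by blast
  then show "Plus D' (Fa (Zero D X Y)) (Fa (Zero D X Y)) = Fa (Zero D X Y)"
    using t.plus_zero[OF t.zero_hom] by simp
qed

lemma Fa_eq_zero_iff:
  "f \<in> Hom D X Y \<Longrightarrow> X \<in> U \<inter> V \<Longrightarrow> Y \<in> U \<inter> V \<Longrightarrow>
    Fa f = Zero D' (Fo X) (Fo Y) \<longleftrightarrow> f = Zero D X Y"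
  using Fa_inj[OF _ t.zero_hom, of f X Y] Fa_zero[of X Y] by simp

lemma hom_zero_transfer:
  assumes "X \<in> U \<inter> V" "Y \<in> U \<inter> V"
  shows "t'.hom_zero (Fo X) (Fo Y) \<longleftrightarrow> t.hom_zero X Y"
proof
  assume z: "t'.hom_zero (Fo X) (Fo Y)"
  show "t.hom_zero X Y"
    using t'.hom_zeroD[OF z Fa_hom[OF _ assms]] Fa_eq_zero_iff[OF _ assms] by (intro t.hom_zeroI) simp
next
  assume z: "t.hom_zero X Y"
  show "t'.hom_zero (Fo X) (Fo Y)"
  proof (rule t'.hom_zeroI)
    fix g assume "g \<in> Hom D' (Fo X) (Fo Y)"
    then obtain f where "f \<in> Hom D X Y" "g = Fa f" using Fa_full assms by blast
    then show "g = Zero D' (Fo X) (Fo Y)" using t.hom_zeroD[OF z] Fa_zero[OF assms] by simp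
  qed
qed

lemma iso_transfer:
  assumes i: "isomorphic D X Y" and H: "X \<in> U \<inter> V" "Y \<in> U \<inter> V"
  shows "isomorphic D' (Fo X) (Fo Y)"
proof -
  obtain f g where f: "f \<in> Hom D X Y" "g \<in> Hom D Y X" "Comp D g f = Id D X" "Comp D f g = Id D Y"
    using i t.isomorphic_def' by blast
  have "Comp D' (Fa g) (Fa f) = Id D' (Fo X)" "Comp D' (Fa f) (Fa g) = Id D' (Fo Y)"
    using Fa_comp[OF f(1,2)] Fa_comp[OF f(2,1)] f(3,4) H Fa_id by auto
  then show ?thesis unfolding t'.isomorphic_def' using Fa_hom f H by blast
qed

text \<open>With test objects restricted to the image of \<open>Fo\<close>, each quantifier over
  arrows transfers through a bijection of Hom sets.\<close>

lemma short_exact_transfer: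
  assumes H: "A \<in> U \<inter> V" "X \<in> U \<inter> V" "C \<in> U \<inter> V" and i: "i \<in> Hom D A X" and p: "p \<in> Hom D X C"
  shows "t'.short_exact_in (Fo ` (U \<inter> V)) (Fo A) (Fo X) (Fo C) (Fa i) (Fa p) \<longleftrightarrow>
    t.short_exact_in (U \<inter> V) A X C i p"
proof -
  have all: "(\<forall>g\<in>Hom D' (Fo S) (Fo E). Q g) \<longleftrightarrow> (\<forall>f\<in>Hom D S E. Q (Fa f))"
    and ex: "(\<exists>g\<in>Hom D' (Fo S) (Fo E). Q g) \<longleftrightarrow> (\<exists>f\<in>Hom D S E. Q (Fa f))"
    if "S \<in> U \<inter> V" "E \<in> U \<inter> V" for S E Q
    using Fa_hom[OF _ that] Fa_full[OF _ that] by blast+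
  have 1: "Comp D' (Fa p) (Fa i) = Zero D' (Fo A) (Fo C) \<longleftrightarrow> Comp D p i = Zero D A C"
    using Fa_comp[OF i p H] Fa_eq_zero_iff[OF t.comp_hom[OF i p]] H by simp
  have 2: "Comp D' (Fa i) (Fa f) = Zero D' (Fo E) (Fo X) \<longleftrightarrow> Comp D i f = Zero D E X"
    if "E \<in> U \<inter> V" "f \<in> Hom D E A" for E f
    using Fa_comp[OF that(2) i] Fa_eq_zero_iff[OF t.comp_hom[OF that(2) i]] H that by simp
  have 3: "Comp D' (Fa f) (Fa p) = Zero D' (Fo X) (Fo E) \<longleftrightarrow> Comp D f p = Zero D X E"
    if "E \<in> U \<inter> V" "f \<in> Hom D C E" for E f
    using Fa_comp[OF p that(2)] Fa_eq_zero_iff[OF t.comp_hom[OF p that(2)]] H that by simp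
  have 4: "Comp D' (Fa u) (Fa i) = Zero D' (Fo A) (Fo E) \<longleftrightarrow> Comp D u i = Zero D A E"
    if "E \<in> U \<inter> V" "u \<in> Hom D X E" for E u
    using Fa_comp[OF i that(2)] Fa_eq_zero_iff[OF t.comp_hom[OF i that(2)]] H that by simp
  have 5: "Fa u = Comp D' (Fa w) (Fa p) \<longleftrightarrow> u = Comp D w p"
    if "E \<in> U \<inter> V" "u \<in> Hom D X E" "w \<in> Hom D C E" for E u w
    using Fa_comp[OF p that(3)] Fa_inj[OF that(2) t.comp_hom[OF p that(3)]] H that by simp
  have m: "(\<forall>g\<in>Hom D' (Fo E) (Fo A). Comp D' (Fa i) g = Zero D' (Fo E) (Fo X) \<longrightarrow> g = Zero D' (Fo E) (Fo A))
      \<longleftrightarrow> (\<forall>f\<in>Hom D E A. Comp D i f = Zero D E X \<longrightarrow> f = Zero D E A)" if "E \<in> U \<inter> V" for E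
    unfolding all[OF that H(1)] using 2 Fa_eq_zero_iff that H by auto
  have e: "(\<forall>g\<in>Hom D' (Fo C) (Fo E). Comp D' g (Fa p) = Zero D' (Fo X) (Fo E) \<longrightarrow> g = Zero D' (Fo C) (Fo E))
      \<longleftrightarrow> (\<forall>f\<in>Hom D C E. Comp D f p = Zero D X E \<longrightarrow> f = Zero D C E)" if "E \<in> U \<inter> V" for E
    unfolding all[OF H(3) that] using 3 Fa_eq_zero_iff that H by auto
  have c: "(\<forall>g\<in>Hom D' (Fo X) (Fo E). Comp D' g (Fa i) = Zero D' (Fo A) (Fo E) \<longrightarrow>
        (\<exists>w\<in>Hom D' (Fo C) (Fo E). g = Comp D' w (Fa p)))
      \<longleftrightarrow> (\<forall>u\<in>Hom D X E. Comp D u i = Zero D A E \<longrightarrow> (\<exists>w\<in>Hom D C E. u = Comp D w p))"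
    if "E \<in> U \<inter> V" for E
    unfolding all[OF H(2) that] ex[OF H(3) that] using 4 5 that H by auto
  show ?thesis
    unfolding t'.short_exact_in_def t.short_exact_in_def ball_simps
    using i p Fa_hom[OF i] Fa_hom[OF p] H 1 m e c by simp
qed

text \<open>The equivalence need not come from a functor between the triangulated categories; short
  exactness in the heart mediates between the two kinds of triangles.\<close>

lemma tri_transfer:
  assumes H: "A \<in> U \<inter> V" "X \<in> U \<inter> V" "C \<in> U \<inter> V"
  shows "t'.tri (Fo A) (Fo X) (Fo C) \<longleftrightarrow> t.tri A X C"
proof
  assume "t.tri A X C"
  then obtain i p h where T: "i \<in> Hom D A X" "p \<in> Hom D X C" "(i, p, h) \<in> Tri D" by (rule t.triE)
  have "t.short_exact_in (U \<inter> V) A X C i p" using t.short_exact_in_of_Tri[OF T(3,1,2)] H by blast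
  then have "t'.short_exact_in (Fo ` (U \<inter> V)) (Fo A) (Fo X) (Fo C) (Fa i) (Fa p)"
    using short_exact_transfer[OF H T(1,2)] by blast
  then have "t'.short_exact_in (U' \<inter> V') (Fo A) (Fo X) (Fo C) (Fa i) (Fa p)"
    by (rule t'.short_exact_in_iso_closure) (use Fo_surj in blast)
  then show "t'.tri (Fo A) (Fo X) (Fo C)" using t'.tri_of_short_exact_in Fo_heart H by blast
next
  assume "t'.tri (Fo A) (Fo X) (Fo C)"
  then obtain i' p' h where T: "i' \<in> Hom D' (Fo A) (Fo X)" "p' \<in> Hom D' (Fo X) (Fo C)"
    "(i', p', h) \<in> Tri D'" by (rule t'.triE)
  obtain i where i: "i \<in> Hom D A X" "i' = Fa i" using Fa_full[OF T(1)] H by blast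
  obtain p where p: "p \<in> Hom D X C" "p' = Fa p" using Fa_full[OF T(2)] H by blast
  have "t'.short_exact_in (U' \<inter> V') (Fo A) (Fo X) (Fo C) i' p'"
    using t'.short_exact_in_of_Tri[OF T(3,1,2)] Fo_heart H by blast
  then have "t'.short_exact_in (Fo ` (U \<inter> V)) (Fo A) (Fo X) (Fo C) i' p'"
    using t'.short_exact_in_mono Fo_heart by blast
  then have "t.short_exact_in (U \<inter> V) A X C i p"
    using short_exact_transfer[OF H i(1) p(1)] i p by blast
  then show "t.tri A X C" using t.tri_of_short_exact_in H by blast
qed

text \<open>The images of T and F are closed up under isomorphism, as torsion pairs must be.\<close>

lemma torsion_pair_image:
  assumes tp: "t.torsion_pair (U \<inter> V) T F"
  shows "t'.torsion_pair (U' \<inter> V')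
    {Y \<in> U' \<inter> V'. \<exists>X\<in>T. isomorphic D' (Fo X) Y} {Y \<in> U' \<inter> V'. \<exists>X\<in>F. isomorphic D' (Fo X) Y}"
    (is "t'.torsion_pair _ ?T ?F")
  unfolding t'.torsion_pair_def
proof (intro conjI ballI allI impI)
  have H: "T \<subseteq> U \<inter> V" "F \<subseteq> U \<inter> V" using tp unfolding t.torsion_pair_def by blast+
  show "?T \<subseteq> U' \<inter> V'" "?F \<subseteq> U' \<inter> V'" by blast+
  show "Y \<in> ?T" if "X \<in> ?T" "isomorphic D' X Y" for X Y
    using that t'.heart_iso t'.iso_trans by blast
  show "Y \<in> ?F" if "X \<in> ?F" "isomorphic D' X Y" for X Y
    using that t'.heart_iso t'.iso_trans by blast
  show "t'.hom_zero X Y" if XY: "X \<in> ?T" "Y \<in> ?F" for X Y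
  proof -
    obtain A B where AB: "A \<in> T" "isomorphic D' (Fo A) X" "B \<in> F" "isomorphic D' (Fo B) Y"
      using XY by blast
    then have "t.hom_zero A B" using tp unfolding t.torsion_pair_def by blast
    then have "t'.hom_zero (Fo A) (Fo B)" using hom_zero_transfer AB H by blast
    then show ?thesis using t'.hom_zero_iso_left t'.hom_zero_iso_right AB by blast
  qed
  show "\<exists>A\<in>?T. \<exists>B\<in>?F. t'.tri A Y B" if Y: "Y \<in> U' \<inter> V'" for Y
  proof -
    obtain X where X: "X \<in> U \<inter> V" "isomorphic D' (Fo X) Y" using Fo_surj[OF Y] by blast
    obtain A B where AB: "A \<in> T" "B \<in> F" "t.tri A X B"
      using tp X unfolding t.torsion_pair_def by blast
    have AB': "A \<in> U \<inter> V" "B \<in> U \<inter> V" using AB H by blast+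
    have "t'.tri (Fo A) (Fo X) (Fo B)" using tri_transfer[OF AB'(1) X(1) AB'(2)] AB by blast
    then have "t'.tri (Fo A) Y (Fo B)" using t'.tri_iso t'.iso_refl X by blast
    moreover have "Fo A \<in> ?T" "Fo B \<in> ?F" using AB AB' Fo_heart t'.iso_refl by blast+
    ultimately show ?thesis by blast
  qed
qed

lemma torsion_pair_preimage:
  assumes tp: "t'.torsion_pair (U' \<inter> V') T F"
  shows "t.torsion_pair (U \<inter> V) {X \<in> U \<inter> V. Fo X \<in> T} {X \<in> U \<inter> V. Fo X \<in> F}"
    (is "t.torsion_pair _ ?T ?F")
  unfolding t.torsion_pair_def
proof (intro conjI ballI allI impI)
  have cl: "isomorphic D' X Y \<Longrightarrow> X \<in> T \<Longrightarrow> Y \<in> T" "isomorphic D' X Y \<Longrightarrow> X \<in> F \<Longrightarrow> Y \<in> F" for X Y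
    using tp unfolding t'.torsion_pair_def by blast+
  have H: "T \<subseteq> U' \<inter> V'" "F \<subseteq> U' \<inter> V'" using tp unfolding t'.torsion_pair_def by blast+
  show "?T \<subseteq> U \<inter> V" "?F \<subseteq> U \<inter> V" by blast+
  show "Y \<in> ?T" if "X \<in> ?T" "isomorphic D X Y" for X Y
    using that t.heart_iso[of X Y] iso_transfer[of X Y] cl by blast
  show "Y \<in> ?F" if "X \<in> ?F" "isomorphic D X Y" for X Y
    using that t.heart_iso[of X Y] iso_transfer[of X Y] cl by blast
  show "t.hom_zero X Y" if "X \<in> ?T" "Y \<in> ?F" for X Y
    using that tp hom_zero_transfer[of X Y] unfolding t'.torsion_pair_def by blast
  show "\<exists>A\<in>?T. \<exists>B\<in>?F. t.tri A X B" if X: "X \<in> U \<inter> V" for X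
  proof -
    obtain A' B' where AB': "A' \<in> T" "B' \<in> F" "t'.tri A' (Fo X) B'"
      using tp Fo_heart[OF X] unfolding t'.torsion_pair_def by blast
    obtain A where A: "A \<in> U \<inter> V" "isomorphic D' (Fo A) A'" using Fo_surj AB' H by blast
    obtain B where B: "B \<in> U \<inter> V" "isomorphic D' (Fo B) B'" using Fo_surj AB' H by blast
    have "t'.tri (Fo A) (Fo X) (Fo B)"
      using t'.tri_iso[OF AB'(3) t'.iso_sym[OF A(2)] t'.iso_refl t'.iso_sym[OF B(2)]] .
    then have "t.tri A X B" using tri_transfer[OF A(1) X B(1)] by blast
    moreover have "A \<in> ?T" "B \<in> ?F" using A B AB' cl t'.iso_sym by blast+
    ultimately show ?thesis by blast
  qed
qed

text \<open>Each torsion pair has a partner on the other side with the same sets of values: an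
  additive function is constant on isomorphism classes, so closing up under isomorphism adds no
  value.\<close>

lemma torsion_cones_eq:
  fixes \<phi> :: "'o \<Rightarrow> 'l::ab_group_add"
  assumes \<phi>': "t'.additive_on_triangles \<phi>'" and eq: "\<And>X. X \<in> U \<inter> V \<Longrightarrow> \<phi>' (Fo X) = \<phi> X"
  shows "{torsion_cone \<phi>' T F | T F. t'.torsion_pair (U' \<inter> V') T F} =
    {torsion_cone \<phi> T F | T F. t.torsion_pair (U \<inter> V) T F}"
proof (intro equalityI subsetI)
  have eq': "\<phi>' Y = \<phi> X" if "X \<in> U \<inter> V" "isomorphic D' (Fo X) Y" for X Y
    using t'.additive_iso[OF \<phi>' that(2)] eq[OF that(1)] by simp
  {
    fix \<sigma> assume "\<sigma> \<in> {torsion_cone \<phi> T F | T F. t.torsion_pair (U \<inter> V) T F}"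
    then obtain T F where s: "\<sigma> = torsion_cone \<phi> T F" and tp: "t.torsion_pair (U \<inter> V) T F" by blast
    have H: "T \<subseteq> U \<inter> V" "F \<subseteq> U \<inter> V" using tp unfolding t.torsion_pair_def by blast+
    have img: "\<phi> ` S = \<phi>' ` {Y \<in> U' \<inter> V'. \<exists>X\<in>S. isomorphic D' (Fo X) Y}" if S: "S \<subseteq> U \<inter> V" for S
    proof (intro equalityI subsetI)
      fix l assume "l \<in> \<phi> ` S"
      then obtain X where X: "X \<in> S" "l = \<phi> X" by blast
      then have "X \<in> U \<inter> V" using S by blast
      then have "\<phi>' (Fo X) = l" "Fo X \<in> U' \<inter> V'" using eq X Fo_heart by blast+
      then show "l \<in> \<phi>' ` {Y \<in> U' \<inter> V'. \<exists>X\<in>S. isomorphic D' (Fo X) Y}"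
        using X(1) t'.iso_refl by blast
    next
      fix l assume "l \<in> \<phi>' ` {Y \<in> U' \<inter> V'. \<exists>X\<in>S. isomorphic D' (Fo X) Y}"
      then obtain X Y where XY: "X \<in> S" "isomorphic D' (Fo X) Y" "l = \<phi>' Y" by blast
      then have "l = \<phi> X" using eq' S by blast
      then show "l \<in> \<phi> ` S" using XY by blast
    qed
    show "\<sigma> \<in> {torsion_cone \<phi>' T F | T F. t'.torsion_pair (U' \<inter> V') T F}"
      using torsion_pair_image[OF tp] torsion_cone_cong[OF img[OF H(1)] img[OF H(2)]] s by blast
  next
    fix \<sigma> assume "\<sigma> \<in> {torsion_cone \<phi>' T F | T F. t'.torsion_pair (U' \<inter> V') T F}"
    then obtain T F where s: "\<sigma> = torsion_cone \<phi>' T F" and tp: "t'.torsion_pair (U' \<inter> V') T F" by blast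
    have img: "\<phi>' ` S = \<phi> ` {X \<in> U \<inter> V. Fo X \<in> S}"
      if S: "S \<subseteq> U' \<inter> V'" and cl: "\<forall>X\<in>S. \<forall>Y. isomorphic D' X Y \<longrightarrow> Y \<in> S" for S
    proof (intro equalityI subsetI)
      fix l assume "l \<in> \<phi>' ` S"
      then obtain Y where Y: "Y \<in> S" "l = \<phi>' Y" by blast
      then obtain X where X: "X \<in> U \<inter> V" "isomorphic D' (Fo X) Y" using Fo_surj S by blast
      then have "Fo X \<in> S" "l = \<phi> X" using cl Y t'.iso_sym eq' by blast+
      then show "l \<in> \<phi> ` {X \<in> U \<inter> V. Fo X \<in> S}" using X by blast
    next
      fix l assume "l \<in> \<phi> ` {X \<in> U \<inter> V. Fo X \<in> S}"
      then obtain X where X: "X \<in> U \<inter> V" "Fo X \<in> S" "l = \<phi> X" by blast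
      then show "l \<in> \<phi>' ` S" using eq[OF X(1)] by force
    qed
    have H: "T \<subseteq> U' \<inter> V'" "\<forall>X\<in>T. \<forall>Y. isomorphic D' X Y \<longrightarrow> Y \<in> T"
      "F \<subseteq> U' \<inter> V'" "\<forall>X\<in>F. \<forall>Y. isomorphic D' X Y \<longrightarrow> Y \<in> F"
      using tp unfolding t'.torsion_pair_def by blast+
    show "\<sigma> \<in> {torsion_cone \<phi> T F | T F. t.torsion_pair (U \<inter> V) T F}"
      using torsion_pair_preimage[OF tp] torsion_cone_cong[OF img[OF H(1,2)] img[OF H(3,4)]] s by blast
  }
qed

end

lemma heart_fan_eq_of_equivalence:
  fixes D :: "('o, 'm) tri_data" and D' :: "('p, 'n) tri_data"
  assumes "triangulated_category D" "bounded_heart D H" "lam \<in> hom (K0 D) additive_group"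
    and "triangulated_category D'" "bounded_heart D' H'" "lam' \<in> hom (K0 D') additive_group"
    and eq: "additive_equivalence D H D' H' Fo Fa"
    and lam: "\<And>X. X \<in> H \<Longrightarrow> lam' (K0_class D' (Fo X)) = lam (K0_class D X)"
  shows "heart_fan D' lam' H' = heart_fan D lam H"
proof -
  interpret D: triangulated_category D by fact
  interpret D': triangulated_category D' by fact
  obtain U V where UV: "bounded_tstruct D U V" "H = U \<inter> V"
    using assms(2) unfolding D.bounded_heart_iff by blast
  obtain U' V' where UV': "bounded_tstruct D' U' V'" "H' = U' \<inter> V'"
    using assms(5) unfolding D'.bounded_heart_iff by blast
  interpret t: bounded_tstruct D U V by fact
  interpret t': bounded_tstruct D' U' V' by fact
  interpret heart_equivalence D U V D' U' V' Fo Fa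
    by unfold_locales (use eq UV UV' in simp)
  show ?thesis
    unfolding UV(2) UV'(2) D.heart_fan_eq_torsion_pairs[OF assms(3) UV(1)]
      D'.heart_fan_eq_torsion_pairs[OF assms(6) UV'(1)]
    using torsion_cones_eq[OF D'.additive_K0[OF assms(6)], of "\<lambda>X. lam (K0_class D X)"] lam UV(2)
    by simp
qed

theorem mainTheorem4:
  fixes D :: "('o, 'm) tri_data" and H :: "'o set"
    and lam :: "('o \<Rightarrow>\<^sub>0 int) set \<Rightarrow> 'l::ab_group_add"
  assumes "triangulated_category D"
    and "bounded_heart D H"
    and "free_of_finite_rank TYPE('l)"
    and "lam \<in> hom (K0 D) additive_group"
  shows
    "is_fan (heart_fan D lam H) \<and>
     heart_fan D lam H = (\<Union>\<sigma>\<in>real_heart_cofan D lam H. Faces (dual_cone \<sigma>)) \<and>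
     (\<forall>(D' :: ('p, 'n) tri_data) H' (lam' :: ('p \<Rightarrow>\<^sub>0 int) set \<Rightarrow> 'l) Fo Fa.
        triangulated_category D' \<and> bounded_heart D' H' \<and>
        lam' \<in> hom (K0 D') additive_group \<and>
        additive_equivalence D H D' H' Fo Fa \<and>
        (\<forall>X\<in>H. lam' (K0_class D' (Fo X)) = lam (K0_class D X)) \<longrightarrow>
        heart_fan D' lam' H' = heart_fan D lam H) \<and>
     (length_category D H \<longrightarrow> complete_fan (heart_fan D lam H))"
proof (intro conjI allI impI)
  interpret triangulated_category D by fact
  show "is_fan (heart_fan D lam H)" using is_fan_heart_fan assms by blast
  show "heart_fan D lam H = (\<Union>\<sigma>\<in>real_heart_cofan D lam H. Faces (dual_cone \<sigma>))"
    by (rule heart_fan_eq_cofan)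
  show "complete_fan (heart_fan D lam H)" if "length_category D H"
    using complete_heart_fan assms that by blast
  show "heart_fan D' lam' H' = heart_fan D lam H"
    if "triangulated_category D' \<and> bounded_heart D' H' \<and> lam' \<in> hom (K0 D') additive_group \<and>
      additive_equivalence D H D' H' Fo Fa \<and>
      (\<forall>X\<in>H. lam' (K0_class D' (Fo X)) = lam (K0_class D X))"
    for D' :: "('p, 'n) tri_data" and H' lam' Fo Fa
    using heart_fan_eq_of_equivalence[OF assms(1,2,4)] that by blast
qed

end
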